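(* Let $\delta\in\mathbb{C}$. When $\delta\to0$, the non-reciprocal scattering problem $(\mathrm{NR}_\delta)$ has exactly $2N$ subwavelength resonant frequencies: • a trivial frequency $\omega^*=0$; • the first eigenfrequency $\omega_1(\delta)$, which is an analytic function of $\delta$ with leading asymptotic expansion $$\omega_1(\delta)=\frac{-i\,\delta\,v_b^2\left[\prod_{j=1}^N\left(\frac{\gamma_j}2e^{\frac{\gamma_jr\ell_j}2}\right)+\prod_{j=1}^N\left(\frac{\gamma_j}2e^{-\frac{\gamma_jr\ell_j}2}\right)\right]}{v\,\sum_{i=1}^N\left[\sinh\left(\frac{\gamma_ir\ell_i}2\right)\prod_{j=1}^{i-1}\left(\gamma_je^{-\frac{\gamma_jr\ell_j}2}\right)\prod_{j=i+1}^N\left(\gamma_je^{\frac{\gamma_jr\ell_j}2}\right)\right]}+O(\delta^2);$$ • the remaining $2N-2$ frequencies are analytic functions of $\delta^{1/2}$, with leading-order asymptotic expansions $$\omega_i^\pm(\delta)=\pm v\sqrt{\frac{\lambda_i}{r}\delta}-i\,\delta\,\frac{v_b}2\,\frac{\theta_0a_{i1}b_{i1}+\theta_{2N-1}a_{iN}b_{iN}}{\sum_{j=1}^Na_{ij}b_{ij}}+O(\delta^{3/2}),\qquad i=2,3,\dots,N,$$ where $0=\lambda_1<\lambda_2<\dots<\lambda_N$ are the eigenvalues of the matrix $\mathcal C$, and $\boldsymbol a_i=(a_{i1},\dots,a_{iN})^\top$, $\boldsymbol b_i=(b_{i1},\dots,b_{iN})$ are the right and left eigenvectors corresponding to $\lambda_i$,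 respectively. Moreover, the eigenmodes $u$ corresponding to the resonant frequencies $\omega_i=k_iv$ with $k_i=\sqrt{\lambda_i\delta/r}+O(\delta)$, $i=1,\dots,N$, have the form $$u(x)=\begin{cases}a_j+O(\delta^{1/2}),&x\in(x_j^-,x_j^+),\ j=1,\dots,N,\\ a_j+b_j(x-x_j^+)+O(\delta^{1/2}),&x\in(x_j^+,x_{j+1}^-),\ j=0,1,\dots,N,\end{cases}$$ $$u'(x)=\begin{cases}O(\delta),&x\in(x_j^-,x_j^+),\ j=1,\dots,N,\\ b_j+O(\delta^{1/2}),&x\in(x_j^+,x_{j+1}^-),\ j=0,1,\dots,N,\end{cases}$$ where $\boldsymbol a=(a_1,a_2,\dots,a_N)^\top$ is the corresponding eigenvector of $\mathcal C$ and $b_j=\frac{a_{j+1}-a_j}{s_j}$ for $j=1,2,\dots,N-1$.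
   Context: Setting. There are $N$ resonators $D_j=(x_j^-,x_j^+)\subset\mathbb{R}$, $1\le j\le N$, with $x_j^-<x_j^+<x_{j+1}^-$; $D=\bigcup_{j=1}^ND_j$, $\ell_j=x_j^+-x_j^-$, $s_j=x_{j+1}^--x_j^+$; in the eigenmode expansion $x_0^+:=-M$ and $x_{N+1}^-:=M$ for a large enough $M$, and the constants $a_0,b_0,b_N$ on the two outer intervals are not further specified. $v$ and $v_b$ are the wave speeds outside and inside $D$, $r=v/v_b$ is a fixed positive constant, $\delta$ is the density ratio, and $\gamma_1,\dots,\gamma_N$ are the values on $D_1,\dots,D_N$ of an imaginary gauge potential. $w|_\pm(x)=\lim_{s\to0^+}w(x\pm s)$. The non-reciprocal problem $(\mathrm{NR}_\delta)$ at frequency $\omega\in\mathbb{C}$ is: $u''+\gamma_iu'+\frac{\omega^2}{v_b^2}u=0$ on $D_i$; $u''+\frac{\omega^2}{v^2}u=0$ on $\mathbb{R}\setminus D$; for all $1\le i\le N$: $u|_+(x_i^\pm)=u|_-(x_i^\pm)$, $u'|_+(x_i^-)=\delta\,u'|_-(x_i^-)$, $u'|_-(x_i^+)=\delta\,u'|_+(x_i^+)$; and $\frac{du}{d|x|}-i\frac\omega vu=0$ on $(-\infty,x_1^-)\cup(x_N^+,\infty)$. $\omega$ is a resonant frequency if there is a non-trivial solution $u$ (an eigenmode). It is a subwavelength resonant frequency if $\omega(\delta)$ depends continuously on $\delta\in\mathbb{C}$ for sufficiently small $\delta$ and $\omega(\delta)\to0$ as $\delta\to0$. Square root: $\sqrt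 z$ is defined on $\mathbb{C}\setminus[0,+\infty)$ with the branch $\operatorname{Im}\sqrt z>0$; for $z\in[0,+\infty)$, $\sqrt z:=\lim_{\varepsilon\to0^+}\sqrt{z+\varepsilon i}$. Put $(t_1,\dots,t_{2N-1})=(r\ell_1,s_1,r\ell_2,\dots,s_{N-1},r\ell_N)$, $t_0=t_{2N}=1$, $(\beta_1,\dots,\beta_{2N-1})=(\frac{\gamma_1}r,0,\frac{\gamma_2}r,\dots,0,\frac{\gamma_N}r)$, and $$\theta_j=\begin{cases}\dfrac{\beta_je^{\beta_jt_j/2}}{2\sinh(\beta_jt_j/2)\,t_{j+1}},&j=2i-1,\ i=1,\dots,N,\\[3mm]\dfrac{\beta_{j+1}e^{-\beta_{j+1}t_{j+1}/2}}{2\sinh(\beta_{j+1}t_{j+1}/2)\,t_j},&j=2i,\ i=0,\dots,N-1.\end{cases}$$ The generalized capacitance matrix is the $N\times N$ tridiagonal matrix $$\mathcal C=\begin{pmatrix}\theta_1&-\theta_1\\-\theta_2&\theta_2+\theta_3&-\theta_3\\&-\theta_4&\theta_4+\theta_5&-\theta_5\\&&\ddots&\ddots&\ddots\\&&&-\theta_{2N-4}&\theta_{2N-4}+\theta_{2N-3}&-\theta_{2N-3}\\&&&&-\theta_{2N-2}&\theta_{2N-2}\end{pmatrix}.$$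
   Formalization: In ω_1 the exponents and sinh use γ_jℓ_j/2, not γ_jrℓ_j/2; in the denominator γ_j/2 replaces γ_j and the exponential signs are swapped (printed formula fails for N=1, r≠1). Continuity in δ is on the disc cut along [0,∞), since ω_i^± swap around 0. *)

theory Defs
  imports
    "HOL-Complex_Analysis.Complex_Analysis"
    "HOL-Library.Landau_Symbols"
    "Jordan_Normal_Form.Char_Poly"
begin

section \<open>Square root with branch cut on the nonnegative reals\<close>

definition sqrt_up :: "complex \<Rightarrow> complex" where
  "sqrt_up z = (if Im (csqrt z) < 0 then - csqrt z else csqrt z)"

text \<open>The next four facts say that this is the square root with positive imaginary part off
  the half-line of nonnegative reals, extended to that half-line by its limit from above.\<close>

lemma sqrt_up_square: "sqrt_up z ^ 2 = z"
  by (simp add: sqrt_up_def)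

lemma sqrt_up_Im_pos:
  assumes "z \<notin> \<real>\<^sub>\<ge>\<^sub>0"
  shows "0 < Im (sqrt_up z)"
proof -
  have "Im (sqrt_up z) \<noteq> 0"
  proof
    assume "Im (sqrt_up z) = 0"
    then have "sqrt_up z = of_real (Re (sqrt_up z))"
      by (simp add: complex_eq_iff)
    then have "z = of_real ((Re (sqrt_up z))\<^sup>2)"
      by (metis of_real_power sqrt_up_square)
    then have "z \<in> \<real>\<^sub>\<ge>\<^sub>0"
      by (metis nonneg_Reals_of_real_iff zero_le_power2)
    with assms show False by simp
  qed
  moreover have "0 \<le> Im (if Im w < 0 then - w else w)" for w
    by simp
  then have "0 \<le> Im (sqrt_up z)"
    unfolding sqrt_up_def .
  ultimately show ?thesis by simp
qed

lemma sqrt_up_of_nonneg: "0 \<le> x \<Longrightarrow> sqrt_up (of_real x) = of_real (sqrt x)"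
  by (simp only: sqrt_up_def of_real_sqrt[symmetric] Im_complex_of_real less_irrefl if_False)

lemma sqrt_up_limit_from_above:
  assumes "0 \<le> x"
  shows "((\<lambda>e. sqrt_up (of_real x + of_real e * \<i>)) \<longlongrightarrow> sqrt_up (of_real x)) (at_right 0)"
proof -
  let ?f = "\<lambda>e. of_real x + of_real e * \<i>"
  have lim: "(?f \<longlongrightarrow> of_real x + of_real 0 * \<i>) (at_right 0)"
    by (intro tendsto_intros)
  have csq: "((\<lambda>e. csqrt (?f e)) \<longlongrightarrow> csqrt (of_real x)) (at_right 0)"
  proof (cases "x = 0")
    case True
    have "((\<lambda>e. sqrt (norm (?f e))) \<longlongrightarrow> sqrt (norm (of_real x + of_real 0 * \<i>))) (at_right 0)"
      by (rule tendsto_real_sqrt[OF tendsto_norm[OF lim]])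
    then have "((\<lambda>e. norm (csqrt (?f e))) \<longlongrightarrow> 0) (at_right 0)"
      using True by simp
    then show ?thesis
      unfolding tendsto_norm_zero_iff using True by simp
  next
    case False
    with assms have "(of_real x :: complex) \<notin> \<real>\<^sub>\<le>\<^sub>0" by simp
    from isCont_tendsto_compose[OF continuous_at_csqrt[OF this]] lim show ?thesis by simp
  qed
  have "csqrt (?f e) = sqrt_up (?f e)" if "0 < e" for e
    using that complex_Re_le_cmod[of "?f e"] by (auto simp: sqrt_up_def)
  then have ev: "eventually (\<lambda>e. csqrt (?f e) = sqrt_up (?f e)) (at_right 0)"
    using eventually_at_right_less[of "0::real"] by (auto elim: eventually_mono)
  have "csqrt (of_real x) = sqrt_up (of_real x)"
    using assms by (simp only: sqrt_up_of_nonneg of_real_sqrt)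
  then show ?thesis
    using Lim_transform_eventually[OF csq ev] by (simp only:)
qed


section \<open>Resonator chains and the scattering problem\<close>

text \<open>The resonators are the intervals from \<open>left_end S j\<close> to \<open>right_end S j\<close> for
  \<open>1 \<le> j \<le> num_res S\<close>; the fields are irrelevant for other indices.\<close>

record resonator_chain =
  num_res :: nat
  left_end :: "nat \<Rightarrow> real"
  right_end :: "nat \<Rightarrow> real"
  gauge :: "nat \<Rightarrow> real"
  speed_out :: real
  speed_in :: real

text \<open>The gauge potential is nonzero on every resonator because the quantities \<open>theta\<close> below
  contain the quotient \<open>gauge / sinh (gauge * length / 2)\<close>.\<close>

definition chain :: "resonator_chain \<Rightarrow> bool" where
  "chain S \<longleftrightarrow> 1 \<le> num_res S
     \<and> (\<forall>j\<in>{1..num_res S}. left_end S j < right_end S j)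
     \<and> (\<forall>j\<in>{1..<num_res S}. right_end S j < left_end S (j + 1))
     \<and> (\<forall>j\<in>{1..num_res S}. gauge S j \<noteq> 0)
     \<and> 0 < speed_out S \<and> 0 < speed_in S"

definition res_len :: "resonator_chain \<Rightarrow> nat \<Rightarrow> real" where
  "res_len S j = right_end S j - left_end S j"

definition res_gap :: "resonator_chain \<Rightarrow> nat \<Rightarrow> real" where
  "res_gap S j = left_end S (j + 1) - right_end S j"

definition speed_ratio :: "resonator_chain \<Rightarrow> real" where
  "speed_ratio S = speed_out S / speed_in S"

definition resonators :: "resonator_chain \<Rightarrow> real set" where
  "resonators S = (\<Union>j\<in>{1..num_res S}. {left_end S j<..<right_end S j})"

definition interfaces :: "resonator_chain \<Rightarrow> real set" where
  "interfaces S = left_end S ` {1..num_res S} \<union> right_end S ` {1..num_res S}"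

abbreviation Dx :: "(real \<Rightarrow> complex) \<Rightarrow> real \<Rightarrow> complex" where
  "Dx u x \<equiv> vector_derivative u (at x)"

text \<open>The second-order equation \<open>u'' + c u' + q u = 0\<close> in the classical sense.\<close>

definition ode_on :: "real set \<Rightarrow> complex \<Rightarrow> complex \<Rightarrow> (real \<Rightarrow> complex) \<Rightarrow> bool" where
  "ode_on I c q u \<longleftrightarrow> (\<forall>x\<in>I. u differentiable (at x) \<and> Dx u differentiable (at x)
     \<and> Dx (Dx u) x + c * Dx u x + q * u x = 0)"

text \<open>\<open>f|\<^sub>R(x) = c f|\<^sub>L(x)\<close> for the limits from the right and from the left, both of which
  are required to exist.\<close>

definition transmit :: "(real \<Rightarrow> complex) \<Rightarrow> real \<Rightarrow> complex \<Rightarrow> complex \<Rightarrow> bool" where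
  "transmit f x cr cl \<longleftrightarrow> (\<exists>r l. (f \<longlongrightarrow> r) (at_right x) \<and> (f \<longlongrightarrow> l) (at_left x) \<and> cr * r = cl * l)"

text \<open>In the radiation condition, the derivative with respect to \<open>|x|\<close> is the derivative in the
  outward direction, hence minus the derivative on the left outer interval.\<close>

definition NR_solution ::
  "resonator_chain \<Rightarrow> complex \<Rightarrow> complex \<Rightarrow> (real \<Rightarrow> complex) \<Rightarrow> bool" where
  "NR_solution S \<delta> \<omega> u \<longleftrightarrow>
     (\<forall>i\<in>{1..num_res S}. ode_on {left_end S i<..<right_end S i}
        (of_real (gauge S i)) (\<omega>\<^sup>2 / of_real ((speed_in S)\<^sup>2)) u)
   \<and> ode_on (- (resonators S \<union> interfaces S)) 0 (\<omega>\<^sup>2 / of_real ((speed_out S)\<^sup>2)) u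
   \<and> (\<forall>i\<in>{1..num_res S}.
        transmit u (left_end S i) 1 1 \<and> transmit u (right_end S i) 1 1
      \<and> transmit (Dx u) (left_end S i) 1 \<delta> \<and> transmit (Dx u) (right_end S i) \<delta> 1)
   \<and> (\<forall>x<left_end S 1. - Dx u x - \<i> * \<omega> / of_real (speed_out S) * u x = 0)
   \<and> (\<forall>x>right_end S (num_res S). Dx u x - \<i> * \<omega> / of_real (speed_out S) * u x = 0)"

text \<open>\<open>NR_solution\<close> does not constrain the values of \<open>u\<close> at the finitely many interfaces, so
  these values cannot make a solution non-trivial.\<close>

definition eigenmode ::
  "resonator_chain \<Rightarrow> complex \<Rightarrow> complex \<Rightarrow> (real \<Rightarrow> complex) \<Rightarrow> bool" where
  "eigenmode S \<delta> \<omega> u \<longleftrightarrow> NR_solution S \<delta> \<omega> u \<and> (\<exists>x. x \<notin> interfaces S \<and> u x \<noteq> 0)"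

definition resonant_frequency :: "resonator_chain \<Rightarrow> complex \<Rightarrow> complex \<Rightarrow> bool" where
  "resonant_frequency S \<delta> \<omega> \<longleftrightarrow> (\<exists>u. eigenmode S \<delta> \<omega> u)"

text \<open>A subwavelength resonant frequency is a function of \<open>\<delta>\<close> near \<open>0\<close>. The branches that are
  analytic in \<open>\<delta> powr (1/2)\<close> are interchanged when \<open>\<delta>\<close> runs once around \<open>0\<close>, so no such branch is
  continuous on a full punctured disc. Continuity is therefore meant on the disc cut
  along the nonnegative reals, that is in the polar coordinates \<open>\<rho> > 0\<close> and
  \<open>0 \<le> \<phi> < 2 * pi\<close>: this is the cut of \<open>sqrt_up\<close>, and positive \<open>\<delta>\<close> belong to the upper side.\<close>

definition subwavelength :: "resonator_chain \<Rightarrow> (complex \<Rightarrow> complex) \<Rightarrow> bool" where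
  "subwavelength S \<omega> \<longleftrightarrow>
     (\<exists>\<epsilon>>0. (\<forall>\<delta>. 0 < norm \<delta> \<and> norm \<delta> < \<epsilon> \<longrightarrow> resonant_frequency S \<delta> (\<omega> \<delta>))
        \<and> continuous_on ({0<..<\<epsilon>} \<times> {0..<2 * pi}) (\<lambda>(\<rho>, \<phi>). \<omega> (of_real \<rho> * cis \<phi>)))
   \<and> (\<omega> \<longlongrightarrow> 0) (at 0)"

text \<open>Functions of \<open>\<delta>\<close> are identified, and counted, by their values for all small nonzero \<open>\<delta>\<close>.\<close>

definition germ_eq :: "(complex \<Rightarrow> complex) \<Rightarrow> (complex \<Rightarrow> complex) \<Rightarrow> bool" where
  "germ_eq f g \<longleftrightarrow> (\<forall>\<^sub>F \<delta> in at 0. f \<delta> = g \<delta>)"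

definition subwavelength_germs :: "resonator_chain \<Rightarrow> (complex \<Rightarrow> complex) set set" where
  "subwavelength_germs S = (\<lambda>\<omega>. {\<eta>. germ_eq \<omega> \<eta>}) ` {\<omega>. subwavelength S \<omega>}"


section \<open>The generalized capacitance matrix\<close>

definition tt :: "resonator_chain \<Rightarrow> nat \<Rightarrow> real" where
  "tt S j = (if j = 0 \<or> j = 2 * num_res S then 1
     else if odd j then speed_ratio S * res_len S ((j + 1) div 2)
     else res_gap S (j div 2))"

definition beta :: "resonator_chain \<Rightarrow> nat \<Rightarrow> real" where
  "beta S j = (if odd j then gauge S ((j + 1) div 2) / speed_ratio S else 0)"

definition theta :: "resonator_chain \<Rightarrow> nat \<Rightarrow> real" where
  "theta S j = (if odd j
     then beta S j * exp (beta S j * tt S j / 2)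
            / (2 * sinh (beta S j * tt S j / 2) * tt S (j + 1))
     else beta S (j + 1) * exp (- beta S (j + 1) * tt S (j + 1) / 2)
            / (2 * sinh (beta S (j + 1) * tt S (j + 1) / 2) * tt S j))"

text \<open>Rows and columns are numbered from 0, so row \<open>i\<close> belongs to resonator \<open>i + 1\<close>.\<close>

definition cap_mat :: "resonator_chain \<Rightarrow> real mat" where
  "cap_mat S = Matrix.mat (num_res S) (num_res S) (\<lambda>(i, j).
     if j = i then (if 0 < i then theta S (2 * i) else 0)
                 + (if i + 1 < num_res S then theta S (2 * i + 1) else 0)
     else if j = i + 1 then - theta S (2 * i + 1)
     else if j + 1 = i then - theta S (2 * i)
     else 0)"


section \<open>Leading-order coefficients\<close>

text \<open>The coefficient of \<open>\<delta>\<close> in the first eigenfrequency, obtained as follows. Put \<open>u = 1\<close> to leading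
  order, write \<open>k = \<omega> / v\<close>, let \<open>p\<^sub>j = exp (\<gamma>\<^sub>j l\<^sub>j / 2)\<close> and let \<open>F\<^sub>j\<close> be the derivative of \<open>u\<close> on
  the exterior interval to the right of resonator \<open>j\<close>. Integrating \<open>(exp (\<gamma>\<^sub>j x) u')'\<close> over
  resonator \<open>j\<close> gives
  \<open>\<delta> (p\<^sub>j F\<^sub>j - F\<^sub>j\<^sub>-\<^sub>1 / p\<^sub>j) = - (\<omega>\<^sup>2 / v\<^sub>b\<^sup>2) 2 sinh (\<gamma>\<^sub>j l\<^sub>j / 2) / \<gamma>\<^sub>j\<close>, and the radiation condition
  gives \<open>F\<^sub>0 = - \<i> k\<close> and \<open>F\<^sub>N = \<i> k\<close>. Eliminating the \<open>F\<^sub>j\<close> yields \<open>\<omega> = omega1_coeff * \<delta>\<close>.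
  In the literature this formula also appears with \<open>\<gamma>\<^sub>j r l\<^sub>j / 2\<close> in place of \<open>\<gamma>\<^sub>j l\<^sub>j / 2\<close> and, in
  the denominator, with \<open>\<gamma>\<^sub>j\<close> in place of \<open>\<gamma>\<^sub>j / 2\<close> and the two signs of the exponents exchanged.
  That version does not solve the problem \<open>NR_solution\<close>, except for a single resonator
  with \<open>r = 1\<close> and for other special parameters.\<close>

definition omega1_coeff :: "resonator_chain \<Rightarrow> complex" where
  "omega1_coeff S = (let N = num_res S; \<gamma> = gauge S; l = res_len S in
     - \<i> * of_real ((speed_in S)\<^sup>2
         * ((\<Prod>j=1..N. \<gamma> j / 2 * exp (\<gamma> j * l j / 2)) + (\<Prod>j=1..N. \<gamma> j / 2 * exp (- \<gamma> j * l j / 2)))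
       / (speed_out S * (\<Sum>i=1..N. sinh (\<gamma> i * l i / 2)
            * (\<Prod>j=1..<i. \<gamma> j / 2 * exp (\<gamma> j * l j / 2))
            * (\<Prod>j=i+1..N. \<gamma> j / 2 * exp (- \<gamma> j * l j / 2))))))"

text \<open>Here \<open>a\<close> and \<open>b\<close> are right and left eigenvectors of \<open>cap_mat S\<close>. The value does not change
  when they are rescaled.\<close>

definition damping_coeff :: "resonator_chain \<Rightarrow> real vec \<Rightarrow> real vec \<Rightarrow> complex" where
  "damping_coeff S a b = (let N = num_res S in
     - \<i> * of_real (speed_in S / 2
       * (theta S 0 * vec_index a 0 * vec_index b 0
          + theta S (2 * N - 1) * vec_index a (N - 1) * vec_index b (N - 1))
       / (\<Sum>j<N. vec_index a j * vec_index b j)))"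


section \<open>The form of the eigenmodes\<close>

definition ext_right :: "resonator_chain \<Rightarrow> real \<Rightarrow> nat \<Rightarrow> real" where
  "ext_right S M j = (if j = 0 then - M else right_end S j)"

definition ext_left :: "resonator_chain \<Rightarrow> real \<Rightarrow> nat \<Rightarrow> real" where
  "ext_left S M j = (if j = num_res S + 1 then M else left_end S j)"

text \<open>\<open>K\<close> is the constant of the \<open>O\<close>-terms, uniform in \<open>x\<close>.\<close>

definition mode_form :: "resonator_chain \<Rightarrow> real \<Rightarrow> real \<Rightarrow> (nat \<Rightarrow> complex) \<Rightarrow> (nat \<Rightarrow> complex)
    \<Rightarrow> complex \<Rightarrow> (real \<Rightarrow> complex) \<Rightarrow> bool" where
  "mode_form S M K a b \<delta> u \<longleftrightarrow>
     (\<forall>j\<in>{1..num_res S}. \<forall>x\<in>{left_end S j<..<right_end S j}.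
        norm (u x - a j) \<le> K * norm \<delta> powr (1/2) \<and> norm (Dx u x) \<le> K * norm \<delta>)
   \<and> (\<forall>j\<in>{0..num_res S}. \<forall>x\<in>{ext_right S M j<..<ext_left S M (j + 1)}.
        norm (u x - (a j + b j * of_real (x - ext_right S M j))) \<le> K * norm \<delta> powr (1/2)
      \<and> norm (Dx u x - b j) \<le> K * norm \<delta> powr (1/2))"

end

theory Submission
  imports Defs
begin

text \<open>On every interval a mode is a combination of two fundamental solutions that are entire in
  \<open>\<omega>\<^sup>2\<close>, so the problem becomes a transfer recursion along the chain whose end condition is one
  equation in \<open>\<omega>\<close> and \<open>\<delta>\<close>. With \<open>\<delta> = e\<^sup>2\<close> and \<open>\<omega> = e z\<close> and after division by \<open>z\<close> it reads
  \<open>H(z, e) = 0\<close>, jointly continuous and holomorphic along holomorphic curves, and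
  \<open>H(z, 0) = z Q(z\<^sup>2)\<close> with a real polynomial \<open>Q\<close> of degree \<open>N - 1\<close>: \<open>\<mu> Q(\<mu>)\<close> is the final flux of the
  recursion \<open>C a = l a\<close> at \<open>\<mu> = v v\<^sub>b l\<close>. A weighted Wronskian shows that the zeros of \<open>Q\<close> are
  positive and simple, so \<open>H\<close> has exactly \<open>2 N - 1\<close> holomorphic branches \<open>z(e)\<close>; the same Wronskian with an
  error of order \<open>e\<^sup>2\<close> gives \<open>z'(0)\<close>. The branch through \<open>z = 0\<close> is resolved by the
  scaling \<open>\<omega> = \<delta> x\<close>, and a rescaled recursion shows that \<open>\<omega>\<^sup>2 / \<delta>\<close> stays bounded
  along every resonance with \<open>\<omega> \<rightarrow> 0\<close>. Since the cut disc is connected, a continuous choice of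
  resonances follows a single branch.\<close>

text \<open>The gauge potential destroys symmetry; the integrating factor exp(integral of gamma)
  restores it. Its values \<open>pp\<close> and its integrals \<open>mm\<close> over the resonators
  make the discrete problem symmetric, so the spectrum behaves as for a vibrating string, and left
  eigenvectors are \<open>mm\<close> times right ones, which turns the damping formula into a
  quotient of Wronskian terms. The second obstacle is branching. Square roots of c^2/4 - q are
  avoided by treating cosh and sinh as entire functions of the squared argument. The square root of
  delta disappears with delta = e^2, but the branch at z = 0 is then known to be analytic only in e;
  a second solution with omega = delta x is analytic in delta, and local uniqueness identifies the
  two. The third obstacle is exhaustiveness: the implicit function theorem controls only
  neighbourhoods of the limit points of z. Compactness excludes the other bounded z, and for
  unbounded z the recursion is multiplied by powers of m = delta / omega^2, whose limit at m = 0
  does not vanish.\<close>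

section \<open>Entire fundamental solutions of y'' + c y' + q y = 0\<close>

definition cosh_series :: "complex \<Rightarrow> complex" where
  "cosh_series w = (\<Sum>n. w ^ n / fact (2 * n))"

definition sinh_series :: "complex \<Rightarrow> complex" where
  "sinh_series w = (\<Sum>n. w ^ n / fact (2 * n + 1))"

lemma fact_double_ge: "fact n \<le> (fact (2 * n) :: real)" "fact n \<le> (fact (2 * n + 1) :: real)"
  by (intro fact_mono; simp)+

lemma summable_exp_dominated:
  fixes w :: complex and f :: "nat \<Rightarrow> nat"
  assumes "\<And>n. fact n \<le> (fact (f n) :: real)"
  shows "summable (\<lambda>n. w ^ n / fact (f n))"
proof (rule summable_comparison_test)
  show "\<exists>N. \<forall>n\<ge>N. norm (w ^ n / fact (f n)) \<le> norm w ^ n /\<^sub>R fact n"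
    using assms by (auto simp: norm_divide norm_power divide_simps intro!: mult_left_mono)
  show "summable (\<lambda>n. norm w ^ n /\<^sub>R fact n)"
    by (rule summable_exp_generic)
qed

lemma cosh_series_sums: "(\<lambda>n. w ^ n / fact (2 * n)) sums cosh_series w"
  unfolding cosh_series_def
  by (intro summable_sums summable_exp_dominated) (rule fact_double_ge)

lemma sinh_series_sums: "(\<lambda>n. w ^ n / fact (2 * n + 1)) sums sinh_series w"
  unfolding sinh_series_def
  by (intro summable_sums summable_exp_dominated) (rule fact_double_ge)

text \<open>The even power series of cosh is a power series in t^2. Hence any square root of a
  parameter may be inserted for t without choosing a branch.\<close>

lemma cosh_series_square: "cosh_series (t\<^sup>2) = cosh t"
proof -
  \<comment> \<open>The series of cosh is given over all indices with zeros at the odd ones;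
    reindexing by 2 * n removes them.\<close>
  have "(\<lambda>n. (\<lambda>n. if even n then t ^ n /\<^sub>R fact n else 0) (2 * n)) sums cosh t"
    using cosh_converges[of t]
    by (subst sums_mono_reindex) (auto simp: strict_mono_def elim!: evenE)
  then have "(\<lambda>n. (t\<^sup>2) ^ n / fact (2 * n)) sums cosh t"
    by (simp add: scaleR_conv_of_real divide_inverse_commute flip: power_mult)
  then show ?thesis using cosh_series_sums sums_unique2 by blast
qed

lemma sinh_series_square: "t * sinh_series (t\<^sup>2) = sinh t"
proof -
  have "(\<lambda>n. (\<lambda>n. if even n then 0 else t ^ n /\<^sub>R fact n) (2 * n + 1)) sums sinh t"
    using sinh_converges[of t]
    by (subst sums_mono_reindex) (auto simp: strict_mono_def elim!: oddE)
  then have "(\<lambda>n. t * ((t\<^sup>2) ^ n / fact (2 * n + 1))) sums sinh t"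
    by (simp add: scaleR_conv_of_real divide_inverse_commute mult.left_commute del: fact_Suc
        flip: power_mult)
  then show ?thesis using sums_mult[OF sinh_series_sums, of t "t\<^sup>2"] sums_unique2 by blast
qed

lemma holomorphic_cosh_series: "cosh_series holomorphic_on UNIV"
  and holomorphic_sinh_series: "sinh_series holomorphic_on UNIV"
proof -
  have "cosh_series holomorphic_on ball 0 r" "sinh_series holomorphic_on ball 0 r" for r
    using cosh_series_sums sinh_series_sums
    by (simp_all add: power_series_holomorphic[where a = "\<lambda>n. 1 / fact (2 * n)"]
        power_series_holomorphic[where a = "\<lambda>n. 1 / fact (2 * n + 1)"] del: fact_Suc)
  then show "cosh_series holomorphic_on UNIV" "sinh_series holomorphic_on UNIV"
    by (auto simp: holomorphic_on_open field_differentiable_def)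
      (meson centre_in_ball field_differentiable_def holomorphic_on_imp_differentiable_at mem_ball_0
        open_ball gt_ex)+
qed

lemma holomorphic_cosh_series' [holomorphic_intros]:
  "f holomorphic_on A \<Longrightarrow> (\<lambda>x. cosh_series (f x)) holomorphic_on A"
  using holomorphic_on_compose[of f A cosh_series] holomorphic_cosh_series
    holomorphic_on_subset by (auto simp: o_def)

lemma holomorphic_sinh_series' [holomorphic_intros]:
  "f holomorphic_on A \<Longrightarrow> (\<lambda>x. sinh_series (f x)) holomorphic_on A"
  using holomorphic_on_compose[of f A sinh_series] holomorphic_sinh_series
    holomorphic_on_subset by (auto simp: o_def)

lemma continuous_on_cosh_series [continuous_intros]:
  "continuous_on A f \<Longrightarrow> continuous_on A (\<lambda>x. cosh_series (f x))"
  using continuous_on_compose2[OF holomorphic_on_imp_continuous_on[OF holomorphic_cosh_series]]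
  by blast

lemma continuous_on_sinh_series [continuous_intros]:
  "continuous_on A f \<Longrightarrow> continuous_on A (\<lambda>x. sinh_series (f x))"
  using continuous_on_compose2[OF holomorphic_on_imp_continuous_on[OF holomorphic_sinh_series]]
  by blast

text \<open>\<open>sol c q\<close> is the solution of \<open>y'' + c y' + q y = 0\<close> with \<open>y(0) = 0\<close>, \<open>y'(0) = 1\<close>, and
  \<open>dsol c q\<close> is its derivative. The solution with \<open>y(0) = 1\<close>, \<open>y'(0) = 0\<close> is
  \<open>dsol c q + c * sol c q\<close>.\<close>

definition sol :: "real \<Rightarrow> complex \<Rightarrow> real \<Rightarrow> complex" where
  "sol c q x = exp (- of_real (c * x / 2)) *
     (of_real x * sinh_series ((of_real (c\<^sup>2 / 4) - q) * of_real (x\<^sup>2)))"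

definition dsol :: "real \<Rightarrow> complex \<Rightarrow> real \<Rightarrow> complex" where
  "dsol c q x = exp (- of_real (c * x / 2)) *
     cosh_series ((of_real (c\<^sup>2 / 4) - q) * of_real (x\<^sup>2)) - of_real (c / 2) * sol c q x"

lemma sol_0 [simp]: "sol c q 0 = 0"
  by (simp add: sol_def)

lemma dsol_0 [simp]: "dsol c q 0 = 1"
  using cosh_series_square[of 0] by (simp add: dsol_def)

lemma sinh_series_0 [simp]: "sinh_series 0 = 1"
proof -
  have "(\<lambda>n. 1 / fact (2 * n + 1) * 0 ^ n) sums (1 / fact (2 * 0 + 1) :: complex)"
    by (rule powser_sums_zero)
  then show ?thesis using sums_unique2[OF sinh_series_sums[of 0]] by simp
qed

lemma holomorphic_sol [holomorphic_intros]:
  "f holomorphic_on A \<Longrightarrow> (\<lambda>z. sol c (f z) x) holomorphic_on A"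
  unfolding sol_def by (intro holomorphic_intros)

lemma holomorphic_dsol [holomorphic_intros]:
  "f holomorphic_on A \<Longrightarrow> (\<lambda>z. dsol c (f z) x) holomorphic_on A"
  unfolding dsol_def by (intro holomorphic_intros)

lemma continuous_on_sol [continuous_intros]:
  "continuous_on A f \<Longrightarrow> continuous_on A g \<Longrightarrow> continuous_on A (\<lambda>z. sol c (f z) (g z))"
  unfolding sol_def by (intro continuous_intros) auto

lemma continuous_on_dsol [continuous_intros]:
  "continuous_on A f \<Longrightarrow> continuous_on A g \<Longrightarrow> continuous_on A (\<lambda>z. dsol c (f z) (g z))"
  unfolding dsol_def by (intro continuous_intros) auto

text \<open>These are the classical formulas for an arbitrary root t of the discriminant. The first
  keeps the factor t on the left, so that it remains true at t = 0.\<close>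

lemma sol_eq:
  assumes "t\<^sup>2 = of_real (c\<^sup>2 / 4) - q"
  shows "t * sol c q x = exp (- of_real (c * x / 2)) * sinh (t * of_real x)"
    and "dsol c q x = exp (- of_real (c * x / 2)) * cosh (t * of_real x) - of_real (c / 2) * sol c q x"
proof -
  have e: "(of_real (c\<^sup>2 / 4) - q) * of_real (x\<^sup>2) = (t * of_real x)\<^sup>2"
    using assms by (simp add: power_mult_distrib)
  show "t * sol c q x = exp (- of_real (c * x / 2)) * sinh (t * of_real x)"
    unfolding sol_def e sinh_series_square[symmetric] by (simp add: mult_ac)
  show "dsol c q x = exp (- of_real (c * x / 2)) * cosh (t * of_real x) - of_real (c / 2) * sol c q x"
    unfolding dsol_def e cosh_series_square ..
qed

text \<open>Division by t gives \<open>sol\<close> explicitly except at a double characteristic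
  root, where it is x exp(-c x / 2). The derivative of \<open>dsol\<close> needs no such
  distinction, because t sinh(t x) enters only through t * (t * \<open>sol\<close>).\<close>

lemma sol_derivs:
  "(sol c q has_vector_derivative dsol c q x) (at x within X)"
  "(dsol c q has_vector_derivative - of_real c * dsol c q x - q * sol c q x) (at x within X)"
proof -
  define t where "t = csqrt (of_real (c\<^sup>2 / 4) - q)"
  have t: "t\<^sup>2 = of_real (c\<^sup>2 / 4) - q" by (simp add: t_def)
  have q: "q = of_real c ^ 2 / 4 - t\<^sup>2" by (simp add: t)
  note E = sol_eq[OF t]
  have D: "((\<lambda>x. exp (- of_real (c * x / 2)) * cosh (t * of_real x)) has_vector_derivative
      exp (- of_real (c * x / 2)) * (t * sinh (t * of_real x) - of_real (c / 2) * cosh (t * of_real x)))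
      (at x within X)"
    "((\<lambda>x. exp (- of_real (c * x / 2)) * sinh (t * of_real x)) has_vector_derivative
      exp (- of_real (c * x / 2)) * (t * cosh (t * of_real x) - of_real (c / 2) * sinh (t * of_real x)))
      (at x within X)"
  proof -
    have "((\<lambda>z. exp (- (of_real c * z / 2)) * cosh (t * z)) has_field_derivative
        exp (- of_real (c * x / 2)) * (t * sinh (t * of_real x) - of_real (c / 2) * cosh (t * of_real x)))
        (at (of_real x))"
      "((\<lambda>z. exp (- (of_real c * z / 2)) * sinh (t * z)) has_field_derivative
        exp (- of_real (c * x / 2)) * (t * cosh (t * of_real x) - of_real (c / 2) * sinh (t * of_real x)))
        (at (of_real x))"
      by (auto intro!: derivative_eq_intros simp: algebra_simps)
    from this[THEN has_vector_derivative_real_field]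
    show "((\<lambda>x. exp (- of_real (c * x / 2)) * cosh (t * of_real x)) has_vector_derivative
      exp (- of_real (c * x / 2)) * (t * sinh (t * of_real x) - of_real (c / 2) * cosh (t * of_real x)))
      (at x within X)"
    "((\<lambda>x. exp (- of_real (c * x / 2)) * sinh (t * of_real x)) has_vector_derivative
      exp (- of_real (c * x / 2)) * (t * cosh (t * of_real x) - of_real (c / 2) * sinh (t * of_real x)))
      (at x within X)" by simp_all
  qed
  show S: "(sol c q has_vector_derivative dsol c q x) (at x within X)"
  proof (cases "t = 0")
    case False
    then have s: "sol c q = (\<lambda>x. exp (- of_real (c * x / 2)) * sinh (t * of_real x) / t)"
      using E(1) by (auto simp: field_simps)
    moreover have "((\<lambda>x. exp (- of_real (c * x / 2)) * sinh (t * of_real x) / t) has_vector_derivative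
       dsol c q x) (at x within X)"
      by (rule has_vector_derivative_eq_rhs[OF has_vector_derivative_divide[OF D(2), of t]])
        (use False in \<open>simp add: E(2) fun_cong[OF s] field_simps\<close>)
    ultimately show ?thesis by (simp flip: s)
  next
    case True
    then have "of_real (c\<^sup>2 / 4) - q = 0" using t by simp
    then have "sol c q = (\<lambda>x. exp (- of_real (c * x / 2)) * of_real x)"
      by (auto simp: sol_def)
    moreover have "((\<lambda>x. exp (- of_real (c * x / 2)) * of_real x) has_vector_derivative
       dsol c q x) (at x within X)"
    proof -
      have "((\<lambda>z. exp (- (of_real c * z / 2)) * z) has_field_derivative dsol c q x) (at (of_real x))"
        by (auto intro!: derivative_eq_intros simp: algebra_simps E(2) calculation True)
      from has_vector_derivative_real_field[OF this] show ?thesis by simp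
    qed
    ultimately show ?thesis by simp
  qed
  have e1: "exp (- of_real (c * x / 2)) * (t * sinh (t * of_real x) - of_real (c / 2) * cosh (t * of_real x))
      = t * (t * sol c q x) - of_real (c / 2) * (dsol c q x + of_real (c / 2) * sol c q x)"
    unfolding E(2) E(1)[of x] by (simp add: algebra_simps)
  have "dsol c q = (\<lambda>x. exp (- of_real (c * x / 2)) * cosh (t * of_real x) - of_real (c / 2) * sol c q x)"
    using E(2) by auto
  moreover have "((\<lambda>x. exp (- of_real (c * x / 2)) * cosh (t * of_real x) - of_real (c / 2) * sol c q x)
      has_vector_derivative - of_real c * dsol c q x - q * sol c q x) (at x within X)"
    by (rule has_vector_derivative_eq_rhs[OF has_vector_derivative_diff[OF D(1)
          has_vector_derivative_mult_right[OF S]]])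
      (subst e1, simp add: q field_simps power2_eq_square)
  ultimately show "(dsol c q has_vector_derivative - of_real c * dsol c q x - q * sol c q x) (at x within X)"
    by simp
qed

text \<open>The left side is the Wronskian of the two fundamental solutions, since the derivative of
  \<open>dsol + c * sol\<close> is \<open>- q * sol\<close>. Completing the square reduces Abel's
  formula to cosh^2 - sinh^2 = 1.\<close>

lemma sol_wronskian:
  "(dsol c q x + of_real c * sol c q x) * dsol c q x + q * (sol c q x)\<^sup>2 = exp (- of_real (c * x))"
proof -
  define t where "t = csqrt (of_real (c\<^sup>2 / 4) - q)"
  have t: "t\<^sup>2 = of_real (c\<^sup>2 / 4) - q" by (simp add: t_def)
  let ?e = "exp (- of_real (c * x / 2)) :: complex"
  have "(dsol c q x + of_real c * sol c q x) * dsol c q x + q * (sol c q x)\<^sup>2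
    = (?e * cosh (t * of_real x))\<^sup>2 - (t * sol c q x)\<^sup>2"
  proof -
    have q: "4 * q = of_real c ^ 2 - 4 * t\<^sup>2" by (simp add: t)
    have "4 * ((dsol c q x + of_real c * sol c q x) * dsol c q x + q * (sol c q x)\<^sup>2)
      = (2 * dsol c q x + of_real c * sol c q x)\<^sup>2 + (4 * q - of_real c ^ 2) * (sol c q x)\<^sup>2"
      by (simp add: power2_eq_square algebra_simps)
    also have "2 * dsol c q x + of_real c * sol c q x = 2 * (?e * cosh (t * of_real x))"
      unfolding sol_eq(2)[OF t] by simp
    finally have "4 * ((dsol c q x + of_real c * sol c q x) * dsol c q x + q * (sol c q x)\<^sup>2)
      = 4 * ((?e * cosh (t * of_real x))\<^sup>2 - (t * sol c q x)\<^sup>2)"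
      unfolding q by (simp add: power_mult_distrib algebra_simps)
    then show ?thesis by (subst (asm) mult_cancel_left) simp
  qed
  also have "\<dots> = ?e\<^sup>2 * (cosh (t * of_real x) ^ 2 - sinh (t * of_real x) ^ 2)"
    unfolding sol_eq(1)[OF t] by (simp add: power_mult_distrib algebra_simps)
  also have "\<dots> = exp (- of_real (c * x))"
    by (simp add: cosh_square_eq flip: exp_double)
  finally show ?thesis .
qed

lemma sol_at_0:
  "dsol c 0 x = of_real (exp (- c * x))"
  "of_real c * sol c 0 x = of_real (1 - exp (- c * x))"
  "sol 0 0 x = of_real x"
proof -
  have t: "(of_real (c / 2) :: complex)\<^sup>2 = of_real (c\<^sup>2 / 4) - 0"
    by (simp add: power2_eq_square)
  have e: "exp (- of_real (c * x / 2)) * cosh (of_real (c / 2) * of_real x)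
      = (1 + of_real (exp (- c * x)) :: complex) / 2"
    "exp (- of_real (c * x / 2)) * sinh (of_real (c / 2) * of_real x)
      = (1 - of_real (exp (- c * x)) :: complex) / 2"
    by (simp_all add: cosh_def sinh_def field_simps scaleR_conv_of_real exp_of_real[symmetric]
        exp_minus flip: exp_add)
  show 2: "of_real c * sol c 0 x = of_real (1 - exp (- c * x))"
    using sol_eq(1)[OF t, of x] unfolding e by simp
  show "dsol c 0 x = of_real (exp (- c * x))"
    using sol_eq(2)[OF t, of x] 2 unfolding e by (simp add: field_simps)
  show "sol 0 0 x = of_real x" by (simp add: sol_def)
qed


text \<open>The coefficients of u in the fundamental system have derivative zero and are therefore
  constant on the connected set I. The base point x0 is free, so it can be an interface outside the
  open interval.\<close>

lemma ode_on_representation: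
  assumes ode: "ode_on I (of_real c) q u" and I: "open I" "connected I"
  shows "\<exists>d0 d1. \<forall>x\<in>I. u x = d0 * (dsol c q (x - x0) + of_real c * sol c q (x - x0)) + d1 * sol c q (x - x0)
     \<and> Dx u x = - q * d0 * sol c q (x - x0) + d1 * dsol c q (x - x0)"
proof -
  define E where "E x = (exp (of_real (c * (x - x0))) :: complex)" for x :: real
  define s d where "s x = sol c q (x - x0)" and "d x = dsol c q (x - x0)" for x
  \<comment> \<open>Cramer's rule for the two coefficients; by Abel's formula \<open>E\<close> is
    the reciprocal of the Wronskian.\<close>
  define W0 W1 where "W0 x = E x * (d x * u x - s x * Dx u x)"
    and "W1 x = E x * ((d x + of_real c * s x) * Dx u x + q * s x * u x)" for x
  have shift: "((\<lambda>x. x - x0) has_vector_derivative 1) (at x)" for x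
    by (auto intro!: derivative_eq_intros)
  have ds: "(s has_vector_derivative d x) (at x)"
    "(d has_vector_derivative - of_real c * d x - q * s x) (at x)" for x
    using vector_diff_chain_at[OF shift sol_derivs(1)] vector_diff_chain_at[OF shift sol_derivs(2)]
    by (simp_all add: s_def[abs_def] d_def[abs_def] o_def)
  have dE: "(E has_vector_derivative of_real c * E x) (at x)" for x
  proof -
    have "((\<lambda>z. exp (of_real c * (z - of_real x0))) has_field_derivative of_real c * E x) (at (of_real x))"
      by (auto intro!: derivative_eq_intros simp: E_def)
    from has_vector_derivative_real_field[OF this] show ?thesis by (simp add: E_def[abs_def])
  qed
  have der: "(u has_vector_derivative Dx u x) (at x)"
    "(Dx u has_vector_derivative - of_real c * Dx u x - q * u x) (at x)" if "x \<in> I" for x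
  proof -
    have *: "u differentiable (at x)" "Dx u differentiable (at x)"
      "Dx (Dx u) x + of_real c * Dx u x + q * u x = 0"
      using ode that by (auto simp: ode_on_def)
    show "(u has_vector_derivative Dx u x) (at x)"
      using *(1) by (simp add: vector_derivative_works)
    have "Dx (Dx u) x = - of_real c * Dx u x - q * u x"
    proof -
      have "Dx (Dx u) x = (Dx (Dx u) x + of_real c * Dx u x + q * u x) - of_real c * Dx u x - q * u x"
        by simp
      then show ?thesis using *(3) by simp
    qed
    then show "(Dx u has_vector_derivative - of_real c * Dx u x - q * u x) (at x)"
      using *(2) by (simp add: vector_derivative_works)
  qed
  have W: "(W0 has_vector_derivative 0) (at x)" "(W1 has_vector_derivative 0) (at x)" if "x \<in> I" for x
    unfolding W0_def W1_def
    by (rule has_vector_derivative_eq_rhs, (rule has_vector_derivative_mult has_vector_derivative_diff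
          has_vector_derivative_add has_vector_derivative_mult_right ds dE der that)+,
        simp add: algebra_simps)+
  have const: "\<exists>k. \<forall>x\<in>I. W x = k"
    if "\<And>x. x \<in> I \<Longrightarrow> (W has_vector_derivative 0) (at x)" for W :: "real \<Rightarrow> complex"
  proof -
    have W: "(W has_derivative (\<lambda>_. 0)) (at x)" if "x \<in> I" for x
      using \<open>\<And>x. x \<in> I \<Longrightarrow> (W has_vector_derivative 0) (at x)\<close>[OF that]
      by (simp add: has_vector_derivative_def)
    have "continuous_on I W"
      using W by (meson continuous_at_imp_continuous_on has_derivative_continuous)
    then have "W constant_on I"
      using W I by (intro has_derivative_zero_connected_constant_on[of I "{}"]) 
        (auto intro: has_derivative_at_withinI)
    then show ?thesis by (auto simp: constant_on_def)
  qed
  from const[OF W(1)] obtain d0 where d0: "\<And>x. x \<in> I \<Longrightarrow> W0 x = d0" by blast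
  from const[OF W(2)] obtain d1 where d1: "\<And>x. x \<in> I \<Longrightarrow> W1 x = d1" by blast
  have wr: "E x * ((d x + of_real c * s x) * d x + q * (s x)\<^sup>2) = 1" for x
    unfolding s_def d_def sol_wronskian E_def by (simp flip: exp_add)
  show ?thesis
  proof (intro exI ballI conjI)
    fix x assume x: "x \<in> I"
    have "d0 * (d x + of_real c * s x) + d1 * s x
        = (E x * ((d x + of_real c * s x) * d x + q * (s x)\<^sup>2)) * u x"
      "- q * d0 * s x + d1 * d x
        = (E x * ((d x + of_real c * s x) * d x + q * (s x)\<^sup>2)) * Dx u x"
      unfolding d0[OF x, symmetric] d1[OF x, symmetric] W0_def W1_def
      by (simp_all add: algebra_simps power2_eq_square)
    then show "u x = d0 * (dsol c q (x - x0) + of_real c * sol c q (x - x0)) + d1 * sol c q (x - x0)"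
      "Dx u x = - q * d0 * sol c q (x - x0) + d1 * dsol c q (x - x0)"
      unfolding wr by (simp_all add: s_def d_def)
  qed
qed

section \<open>An implicit function theorem along holomorphic curves\<close>

text \<open>Every disc of radius r around a point of the inner disc lies in the disc of radius 2 r,
  where f is at most r/2. Cauchy's inequality bounds the derivative by 1/2, and convexity of the
  inner disc gives the Lipschitz bound.\<close>

lemma contraction_bound:
  fixes f :: "complex \<Rightarrow> complex"
  assumes f: "f holomorphic_on ball z0 R" and r: "0 < r" "2 * r < R"
    and close: "\<And>z. z \<in> cball z0 (2 * r) \<Longrightarrow> norm (f z) \<le> r / 2"
    and z: "z \<in> cball z0 r" "z' \<in> cball z0 r"
  shows "norm (f z - f z') \<le> 1/2 * norm (z - z')"
proof (rule field_differentiable_bound[OF _ _ _ z])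
  show "convex (cball z0 r)" by simp
  fix w assume w: "w \<in> cball z0 r"
  have "dist z0 y \<le> 2 * r" if "dist w y \<le> r" for y
    using dist_triangle[of z0 y w] that w by simp
  then have sub: "cball w r \<subseteq> cball z0 (2 * r)" "cball z0 (2 * r) \<subseteq> ball z0 R"
    using r by auto
  have wb: "w \<in> ball z0 R" using w r by auto
  show "(f has_field_derivative deriv f w) (at w within cball z0 r)"
    using f wb by (auto intro: holomorphic_derivI has_field_derivative_at_within)
  have "norm ((deriv ^^ 1) f w) \<le> fact 1 * (r / 2) / r ^ 1"
  proof (rule Cauchy_inequality)
    show "f holomorphic_on ball w r" "continuous_on (cball w r) f"
      using sub ball_subset_cball[of w r]
      by (blast intro: holomorphic_on_subset[OF f]
          continuous_on_subset[OF holomorphic_on_imp_continuous_on[OF f]])+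
    show "norm (f x) \<le> r / 2" if "norm (w - x) = r" for x
      using that sub by (intro close) (auto simp: dist_norm)
  qed (use r in simp)
  then show "norm (deriv f w) \<le> 1/2" using r by simp
qed

text \<open>The solution is the limit of the Newton-type iteration with the slope frozen at \<open>(z0, 0)\<close>.
  The hypothesis \<open>curve\<close> replaces joint holomorphy: it makes all iterates holomorphic.\<close>

lemma holomorphic_implicit_function:
  fixes H :: "complex \<Rightarrow> complex \<Rightarrow> complex"
  assumes cont: "continuous_on UNIV (\<lambda>(z, e). H z e)"
    and curve: "\<And>f X. f holomorphic_on X \<Longrightarrow> (\<lambda>e. H (f e) e) holomorphic_on X"
    and hol: "\<And>e. (\<lambda>z. H z e) holomorphic_on UNIV"
    and zero: "H z0 0 = 0" and h: "h \<noteq> 0" "((\<lambda>z. H z 0) has_field_derivative h) (at z0)"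
  obtains g \<rho> \<eta> where "0 < \<rho>" "0 < \<eta>" "g holomorphic_on ball 0 \<rho>" "g 0 = z0"
    "\<And>e. norm e < \<rho> \<Longrightarrow> H (g e) e = 0"
    "\<And>e z. norm e < \<rho> \<Longrightarrow> norm (z - z0) < \<eta> \<Longrightarrow> H z e = 0 \<Longrightarrow> z = g e"
proof -
  define \<Phi> where "\<Phi> e z = z - z0 - H z e / h" for e z
  have \<Phi>hol: "\<Phi> e holomorphic_on X" for e X
    unfolding \<Phi>_def using h hol[of e] by (intro holomorphic_intros) (auto intro: holomorphic_on_subset)
  have "((\<lambda>z. \<Phi> 0 z) has_field_derivative 0) (at z0)"
    unfolding \<Phi>_def using h by (auto intro!: derivative_eq_intros)
  then have "(\<lambda>z. (\<Phi> 0 z - \<Phi> 0 z0) / (z - z0)) \<midarrow>z0\<rightarrow> 0"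
    by (simp add: has_field_derivative_iff)
  \<comment> \<open>The constant 1/8 makes \<open>\<Phi> 0\<close> at most 2 r / 8 = r/4 on the disc
    of radius 2 r. The remaining r/4 is left for the change in e, so that
    \<open>contraction_bound\<close> applies with r/2.\<close>
  then have "eventually (\<lambda>z. dist ((\<Phi> 0 z - \<Phi> 0 z0) / (z - z0)) 0 < 1/8) (at z0)"
    by (intro tendstoD) auto
  then obtain d where d: "d > 0"
    "\<And>z. z \<noteq> z0 \<Longrightarrow> dist z z0 < d \<Longrightarrow> norm (\<Phi> 0 z) / norm (z - z0) < 1/8"
    unfolding eventually_at by (auto simp: \<Phi>_def zero norm_divide)
  define r where "r = d / 3"
  have r: "r > 0" "2 * r < d" using d by (auto simp: r_def)
  have b0: "norm (\<Phi> 0 z) \<le> r / 4" if "z \<in> cball z0 (2 * r)" for z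
  proof (cases "z = z0")
    case False
    then have "norm (\<Phi> 0 z) \<le> norm (z - z0) / 8"
      using d(2)[of z] that r by (auto simp: field_simps dist_commute)
    then show ?thesis using that by (simp add: dist_norm norm_minus_commute)
  qed (use r in \<open>simp add: \<Phi>_def zero\<close>)
  \<comment> \<open>Uniform continuity on a compact product yields one radius in e that serves all z
    simultaneously.\<close>
  have uc: "uniformly_continuous_on (cball z0 (2 * r) \<times> cball 0 1) (\<lambda>(z, e). H z e / h)"
    using h by (intro compact_uniformly_continuous continuous_on_subset[OF cont] compact_Times)
      (auto simp: case_prod_unfold intro!: continuous_intros continuous_on_subset[OF cont[unfolded case_prod_unfold]])
  have "\<exists>d>0. \<forall>x\<in>cball z0 (2 * r) \<times> cball 0 1. \<forall>y\<in>cball z0 (2 * r) \<times> cball 0 1. dist y x < d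
      \<longrightarrow> dist ((\<lambda>(z, e). H z e / h) y) ((\<lambda>(z, e). H z e / h) x) < r / 4"
    using r by (intro uc[unfolded uniformly_continuous_on_def, rule_format]) simp
  then obtain \<rho>' where \<rho>': "\<rho>' > 0"
    "\<And>x y. x \<in> cball z0 (2 * r) \<times> cball 0 1 \<Longrightarrow> y \<in> cball z0 (2 * r) \<times> cball 0 1 \<Longrightarrow> dist y x < \<rho>'
      \<Longrightarrow> dist ((\<lambda>(z, e). H z e / h) y) ((\<lambda>(z, e). H z e / h) x) < r / 4"
    by blast
  define \<rho> where "\<rho> = min 1 \<rho>'"
  have \<rho>: "\<rho> > 0" using \<rho>' by (simp add: \<rho>_def)
  have b: "norm (\<Phi> e z) \<le> r / 2" if "z \<in> cball z0 (2 * r)" "norm e < \<rho>" for e z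
  proof -
    have "dist (z, e) (z, 0) < \<rho>'" using that by (simp add: \<rho>_def dist_prod_def)
    then have "dist (H z e / h) (H z 0 / h) < r / 4"
      using \<rho>'(2)[of "(z, 0)" "(z, e)"] that by (simp add: \<rho>_def)
    moreover have "\<Phi> e z = \<Phi> 0 z + (H z 0 / h - H z e / h)" by (simp add: \<Phi>_def)
    then have "norm (\<Phi> e z) \<le> norm (\<Phi> 0 z) + dist (H z e / h) (H z 0 / h)"
      by (metis dist_commute dist_norm norm_triangle_ineq)
    ultimately show ?thesis using b0[OF that(1)] by simp
  qed
  have lip: "norm (\<Phi> e z - \<Phi> e z') \<le> 1/2 * norm (z - z')"
    if "norm e < \<rho>" "z \<in> cball z0 r" "z' \<in> cball z0 r" for e z z'
    using that b r by (intro contraction_bound[of "\<Phi> e" z0 "3 * r" r] \<Phi>hol) auto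
  define f where "f n e = ((\<lambda>z. z0 + \<Phi> e z) ^^ n) z0" for n e
  have fS: "f (Suc n) e = z0 + \<Phi> e (f n e)" "f 0 e = z0" for n e
    by (simp_all add: f_def)
  have fin: "f n e \<in> cball z0 (r / 2)" if "norm e < \<rho>" for n e
  proof (induction n)
    case (Suc n)
    then have "f n e \<in> cball z0 (2 * r)" using r by auto
    from b[OF this that] show ?case by (simp add: fS dist_norm)
  qed (use r in \<open>simp add: fS\<close>)
  have fin': "f n e \<in> cball z0 r" if "norm e < \<rho>" for n e
    using fin[OF that, of n] r by auto
  \<comment> \<open>Each iterate is itself a holomorphic curve, so \<open>curve\<close> makes the
    next one holomorphic.\<close>
  have fhol: "f n holomorphic_on ball 0 \<rho>" for n
  proof (induction n)
    case (Suc n)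
    have "(\<lambda>e. z0 + (f n e - z0 - H (f n e) e / h)) holomorphic_on ball 0 \<rho>"
      using Suc h by (intro holomorphic_intros curve) auto
    then show ?case by (simp add: fS[abs_def] \<Phi>_def)
  qed (simp add: fS[abs_def])
  have step: "norm (f (Suc n) e - f n e) \<le> (r / 2) * (1/2) ^ n" if "norm e < \<rho>" for n e
  proof (induction n)
    case 0
    show ?case using fin[OF that, of 1] by (simp add: fS dist_norm norm_minus_commute)
  next
    case (Suc n)
    have "norm (f (Suc (Suc n)) e - f (Suc n) e) = norm (\<Phi> e (f (Suc n) e) - \<Phi> e (f n e))"
      by (simp add: fS(1))
    also have "\<dots> \<le> 1/2 * norm (f (Suc n) e - f n e)"
      by (rule lip[OF that fin'[OF that] fin'[OF that]])
    finally show ?case using Suc by simp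
  qed
  define g where "g e = z0 + (\<Sum>n. f (Suc n) e - f n e)" for e
  have part: "z0 + (\<Sum>i<n. f (Suc i) e - f i e) = f n e" for n e
    using sum_lessThan_telescope[of "\<lambda>i. f i e" n] by (simp add: fS(2))
  \<comment> \<open>The increments halve at every step, so the telescoping series converges
    uniformly and the limit is holomorphic.\<close>
  have "uniform_limit (ball 0 \<rho>) (\<lambda>n e. \<Sum>i<n. f (Suc i) e - f i e) (\<lambda>e. \<Sum>i. f (Suc i) e - f i e) sequentially"
    by (rule Weierstrass_m_test[where M = "\<lambda>n. (r / 2) * (1/2) ^ n"])
      (use step in \<open>auto intro!: summable_mult summable_geometric\<close>)
  then have "uniform_limit (ball 0 \<rho>) (\<lambda>n e. z0 + (\<Sum>i<n. f (Suc i) e - f i e)) g sequentially"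
    unfolding g_def by (intro uniform_limit_intros)
  then have ul: "uniform_limit (ball 0 \<rho>) f g sequentially"
    by (simp only: part)
  have ghol: "g holomorphic_on ball 0 \<rho>"
  proof (rule holomorphic_uniform_sequence[OF open_ball fhol])
    fix x :: complex assume "x \<in> ball 0 \<rho>"
    then obtain e where "e > 0" "cball x e \<subseteq> ball 0 \<rho>"
      using open_contains_cball[of "ball 0 \<rho>"] by blast
    then show "\<exists>d>0. cball x d \<subseteq> ball 0 \<rho> \<and> uniform_limit (cball x d) f g sequentially"
      using uniform_limit_on_subset[OF ul] by blast
  qed
  have glim: "(\<lambda>n. f n e) \<longlonglongrightarrow> g e" if "norm e < \<rho>" for e
    using tendsto_uniform_limitI[OF ul] that by simp
  have gin: "g e \<in> cball z0 r" if "norm e < \<rho>" for e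
    by (rule closed_sequentially[OF closed_cball _ glim[OF that]]) (rule fin'[OF that])
  have gfix: "g e = z0 + \<Phi> e (g e)" if "norm e < \<rho>" for e
  proof -
    have "isCont (\<Phi> e) (g e)"
      using holomorphic_on_imp_continuous_on[OF \<Phi>hol[of e UNIV]] by (simp add: continuous_on_eq_continuous_at)
    then have "(\<lambda>n. z0 + \<Phi> e (f n e)) \<longlonglongrightarrow> z0 + \<Phi> e (g e)"
      by (intro tendsto_intros isCont_tendsto_compose[OF _ glim[OF that]])
    moreover have "(\<lambda>n. z0 + \<Phi> e (f n e)) \<longlonglongrightarrow> g e"
      using LIMSEQ_Suc[OF glim[OF that]] by (simp add: fS)
    ultimately show ?thesis using LIMSEQ_unique by blast
  qed
  have fixH: "z = z0 + \<Phi> e z \<longleftrightarrow> H z e = 0" for z e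
    using h by (auto simp: \<Phi>_def)
  \<comment> \<open>Zeros of H are fixed points of z0 + \<open>\<Phi> e\<close>, and a contraction
    has at most one.\<close>
  have uniq: "z = g e" if "norm e < \<rho>" "z \<in> cball z0 r" "H z e = 0" for z e
  proof -
    have "norm (z - g e) = norm (\<Phi> e z - \<Phi> e (g e))"
      using fixH[of z e] that(3) gfix[OF that(1)] by (metis add_diff_cancel_left)
    also have "\<dots> \<le> 1/2 * norm (z - g e)"
      by (rule lip[OF that(1,2) gin[OF that(1)]])
    finally show ?thesis by simp
  qed
  show ?thesis
  proof (rule that[OF \<rho> r(1) ghol])
    show "g 0 = z0" using uniq[of 0 z0] \<rho> r zero by simp
    show "H (g e) e = 0" if "norm e < \<rho>" for e
      using gfix[OF that] fixH[of "g e" e] by simp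
    show "z = g e" if "norm e < \<rho>" "norm (z - z0) < r" "H z e = 0" for e z
      using that by (intro uniq) (auto simp: dist_norm norm_minus_commute)
  qed
qed

section \<open>Solutions with prescribed Cauchy data, and one-sided limits\<close>

definition gen_sol :: "real \<Rightarrow> complex \<Rightarrow> complex \<Rightarrow> complex \<Rightarrow> real \<Rightarrow> complex" where
  "gen_sol c q d0 d1 y = d0 * (dsol c q y + of_real c * sol c q y) + d1 * sol c q y"

definition dgen_sol :: "real \<Rightarrow> complex \<Rightarrow> complex \<Rightarrow> complex \<Rightarrow> real \<Rightarrow> complex" where
  "dgen_sol c q d0 d1 y = - q * d0 * sol c q y + d1 * dsol c q y"

lemma gen_sol_0 [simp]: "gen_sol c q d0 d1 0 = d0" "dgen_sol c q d0 d1 0 = d1"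
  by (simp_all add: gen_sol_def dgen_sol_def)

lemma gen_sol_scale: "gen_sol c q (k * d0) (k * d1) y = k * gen_sol c q d0 d1 y"
  "dgen_sol c q (k * d0) (k * d1) y = k * dgen_sol c q d0 d1 y"
  by (simp_all add: gen_sol_def dgen_sol_def algebra_simps)

lemma gen_sol_derivs:
  "(gen_sol c q d0 d1 has_vector_derivative dgen_sol c q d0 d1 y) (at y within X)"
  "(dgen_sol c q d0 d1 has_vector_derivative - of_real c * dgen_sol c q d0 d1 y - q * gen_sol c q d0 d1 y)
    (at y within X)"
  unfolding gen_sol_def[abs_def] dgen_sol_def[abs_def]
  by (rule has_vector_derivative_eq_rhs, (rule has_vector_derivative_diff
        has_vector_derivative_add has_vector_derivative_mult_right sol_derivs)+,
      simp add: algebra_simps)+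

lemma gen_sol_shift_derivs:
  "((\<lambda>x. gen_sol c q d0 d1 (x - x0)) has_vector_derivative dgen_sol c q d0 d1 (x - x0)) (at x)"
  "((\<lambda>x. dgen_sol c q d0 d1 (x - x0)) has_vector_derivative
     - of_real c * dgen_sol c q d0 d1 (x - x0) - q * gen_sol c q d0 d1 (x - x0)) (at x)"
proof -
  have shift: "((\<lambda>x. x - x0) has_vector_derivative 1) (at x)"
    by (auto intro!: derivative_eq_intros)
  show "((\<lambda>x. gen_sol c q d0 d1 (x - x0)) has_vector_derivative dgen_sol c q d0 d1 (x - x0)) (at x)"
    "((\<lambda>x. dgen_sol c q d0 d1 (x - x0)) has_vector_derivative
     - of_real c * dgen_sol c q d0 d1 (x - x0) - q * gen_sol c q d0 d1 (x - x0)) (at x)"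
    using vector_diff_chain_at[OF shift gen_sol_derivs(1)] vector_diff_chain_at[OF shift gen_sol_derivs(2)]
    by (simp_all add: o_def)
qed

lemma gen_sol_tendsto:
  "((\<lambda>x. gen_sol c q d0 d1 (x - x0)) \<longlongrightarrow> gen_sol c q d0 d1 (x - x0)) (at x within X)"
  "((\<lambda>x. dgen_sol c q d0 d1 (x - x0)) \<longlongrightarrow> dgen_sol c q d0 d1 (x - x0)) (at x within X)"
proof -
  have "isCont (\<lambda>x. gen_sol c q d0 d1 (x - x0)) x" "isCont (\<lambda>x. dgen_sol c q d0 d1 (x - x0)) x"
    by (rule has_vector_derivative_continuous, rule gen_sol_shift_derivs)+
  then show "((\<lambda>x. gen_sol c q d0 d1 (x - x0)) \<longlongrightarrow> gen_sol c q d0 d1 (x - x0)) (at x within X)"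
    "((\<lambda>x. dgen_sol c q d0 d1 (x - x0)) \<longlongrightarrow> dgen_sol c q d0 d1 (x - x0)) (at x within X)"
    unfolding continuous_within by (auto intro: tendsto_within_subset[OF _ subset_UNIV])
qed

lemma ode_on_gen_sol:
  assumes u: "\<And>x. x \<in> I \<Longrightarrow> u x = gen_sol c q d0 d1 (x - x0)" and I: "open I"
  shows "ode_on I (of_real c) q u" "x \<in> I \<Longrightarrow> Dx u x = dgen_sol c q d0 d1 (x - x0)"
proof -
  have 1: "(u has_vector_derivative dgen_sol c q d0 d1 (x - x0)) (at x)" if "x \<in> I" for x
    by (rule has_vector_derivative_transform_within_open[OF gen_sol_shift_derivs(1) I that])
      (simp add: u)
  then have D: "Dx u x = dgen_sol c q d0 d1 (x - x0)" if "x \<in> I" for x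
    using that vector_derivative_at by blast
  then show "x \<in> I \<Longrightarrow> Dx u x = dgen_sol c q d0 d1 (x - x0)" .
  have 2: "(Dx u has_vector_derivative
      - of_real c * dgen_sol c q d0 d1 (x - x0) - q * gen_sol c q d0 d1 (x - x0)) (at x)" if "x \<in> I" for x
    by (rule has_vector_derivative_transform_within_open[OF gen_sol_shift_derivs(2) I that])
      (simp add: D)
  show "ode_on I (of_real c) q u"
    unfolding ode_on_def
  proof (intro ballI conjI)
    fix x assume x: "x \<in> I"
    show "u differentiable at x" "Dx u differentiable at x"
      using 1[OF x] 2[OF x] by (auto simp: differentiableI_vector)
    show "Dx (Dx u) x + of_real c * Dx u x + q * u x = 0"
      using vector_derivative_at[OF 2[OF x]] D[OF x] u[OF x] by simp
  qed
qed

lemma ode_on_gen_sol_ex: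
  assumes "ode_on I (of_real c) q u" "open I" "connected I"
  obtains d0 d1 where "\<And>x. x \<in> I \<Longrightarrow> u x = gen_sol c q d0 d1 (x - x0)"
    "\<And>x. x \<in> I \<Longrightarrow> Dx u x = dgen_sol c q d0 d1 (x - x0)"
  using ode_on_representation[OF assms, of x0] unfolding gen_sol_def dgen_sol_def by blast

lemma ode_on_subset: "ode_on J c q u \<Longrightarrow> I \<subseteq> J \<Longrightarrow> ode_on I c q u"
  unfolding ode_on_def by blast

lemma tendsto_left_eq:
  fixes f :: "real \<Rightarrow> complex"
  assumes "(g \<longlongrightarrow> l) (at_left b)" "a < b" "\<And>x. a < x \<Longrightarrow> x < b \<Longrightarrow> f x = g x"
  shows "(f \<longlongrightarrow> l) (at_left b)"
  using Lim_transform_eventually[OF assms(1)] eventually_at_left[OF assms(2)] assms(2,3)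
  by (metis (mono_tags, lifting))

lemma tendsto_right_eq:
  fixes f :: "real \<Rightarrow> complex"
  assumes "(g \<longlongrightarrow> l) (at_right a)" "a < b" "\<And>x. a < x \<Longrightarrow> x < b \<Longrightarrow> f x = g x"
  shows "(f \<longlongrightarrow> l) (at_right a)"
  using Lim_transform_eventually[OF assms(1)] eventually_at_right[OF assms(2)] assms(2,3)
  by (metis (mono_tags, lifting))

text \<open>Left limits are unique, so a limit already computed on the left component must be the
  one inside \<open>transmit\<close>; this carries Cauchy data across an interface from left to
  right.\<close>

lemma transmit_left_limit:
  assumes "transmit f x cr cl" "(f \<longlongrightarrow> l) (at_left x)"
  obtains r where "(f \<longlongrightarrow> r) (at_right x)" "cr * r = cl * l"
  using assms tendsto_unique[OF trivial_limit_at_left_real] unfolding transmit_def by blast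

section \<open>The chain, its geometry and the transfer recursion\<close>

locale resonators =
  fixes S :: resonator_chain
  assumes chain: "chain S"
begin

abbreviation N where "N \<equiv> num_res S"
abbreviation lf where "lf i \<equiv> left_end S (Suc i)"
abbreviation rg where "rg i \<equiv> right_end S (Suc i)"
abbreviation gm where "gm i \<equiv> gauge S (Suc i)"
abbreviation len where "len i \<equiv> right_end S (Suc i) - left_end S (Suc i)"
abbreviation gp where "gp i \<equiv> left_end S (Suc (Suc i)) - right_end S (Suc i)"
abbreviation v where "v \<equiv> speed_out S"
abbreviation vb where "vb \<equiv> speed_in S"

lemma N_pos: "0 < N" and v_pos: "0 < v" and vb_pos: "0 < vb"
  using chain by (auto simp: chain_def)

lemma lf_less_rg: "i < N \<Longrightarrow> lf i < rg i"
  and rg_less_lf: "Suc i < N \<Longrightarrow> rg i < lf (Suc i)"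
  and gm_nonzero: "i < N \<Longrightarrow> gm i \<noteq> 0"
  using chain by (auto simp: chain_def)

lemma rg_less_lf_mono: "i < j \<Longrightarrow> j < N \<Longrightarrow> rg i < lf j"
proof (induction j)
  case (Suc j)
  then show ?case
    using rg_less_lf[of j] lf_less_rg[of j] by (cases "i = j") (auto simp: less_Suc_eq)
qed simp

definition qi :: "complex \<Rightarrow> complex" where "qi w = w\<^sup>2 / of_real (vb\<^sup>2)"
definition qo :: "complex \<Rightarrow> complex" where "qo w = w\<^sup>2 / of_real (v\<^sup>2)"

text \<open>A state \<open>(u, A, B)\<close> encodes the value \<open>u\<close> and the exterior derivative \<open>w * A + n * B\<close>. For
  frequency \<open>w\<close> and contrast \<open>d\<close> the scattering problem is the case \<open>m = 1\<close>, \<open>n = w\<^sup>2 / d\<close>. The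
  splitting makes the factor \<open>w\<close> of the characteristic equation explicit, and the case \<open>n = 1\<close>,
  \<open>m = d / w\<^sup>2\<close> is the rescaling needed where \<open>w\<^sup>2 / d\<close> is large.\<close>

fun res_step :: "complex \<Rightarrow> complex \<Rightarrow> complex \<Rightarrow> complex \<Rightarrow> nat \<Rightarrow> complex \<times> complex \<times> complex
    \<Rightarrow> complex \<times> complex \<times> complex" where
  "res_step w d m n i (u, A, B) =
    ((dsol (gm i) (qi w) (len i) + of_real (gm i) * sol (gm i) (qi w) (len i)) * u
        + d * sol (gm i) (qi w) (len i) * (w * A + n * B),
      m * dsol (gm i) (qi w) (len i) * A,
      m * dsol (gm i) (qi w) (len i) * B - sol (gm i) (qi w) (len i) * u / of_real (vb\<^sup>2))"

fun gap_step :: "complex \<Rightarrow> complex \<Rightarrow> complex \<Rightarrow> nat \<Rightarrow> complex \<times> complex \<times> complex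
    \<Rightarrow> complex \<times> complex \<times> complex" where
  "gap_step w m n i (u, A, B) =
    (m * dsol 0 (qo w) (gp i) * u + sol 0 (qo w) (gp i) * (w * A + n * B),
      dsol 0 (qo w) (gp i) * A - m * (w / of_real (v\<^sup>2)) * sol 0 (qo w) (gp i) * u,
      dsol 0 (qo w) (gp i) * B)"

text \<open>The start is the value 1 with flux - i w / v at the left end of the chain: the radiation
  condition on the left, normalized. States are taken at the left ends of the resonators; the
  quantities named with R are those after \<open>res_step\<close>.\<close>

primrec state :: "complex \<Rightarrow> complex \<Rightarrow> complex \<Rightarrow> complex \<Rightarrow> nat \<Rightarrow> complex \<times> complex \<times> complex" where
  "state w d m n 0 = (1, - \<i> / of_real v, 0)"
| "state w d m n (Suc i) = gap_step w m n i (res_step w d m n i (state w d m n i))"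

definition "uL w d m n i = fst (state w d m n i)"
definition "aL w d m n i = fst (snd (state w d m n i))"
definition "bL w d m n i = snd (snd (state w d m n i))"
definition "uR w d m n i = fst (res_step w d m n i (state w d m n i))"
definition "aR w d m n i = fst (snd (res_step w d m n i (state w d m n i)))"
definition "bR w d m n i = snd (snd (res_step w d m n i (state w d m n i)))"
definition "FL w d m n i = w * aL w d m n i + n * bL w d m n i"
definition "FR w d m n i = w * aR w d m n i + n * bR w d m n i"

lemma state_0 [simp]: "uL w d m n 0 = 1" "aL w d m n 0 = - \<i> / of_real v" "bL w d m n 0 = 0"
  "FL w d m n 0 = - \<i> * w / of_real v"
  by (simp_all add: uL_def aL_def bL_def FL_def)

lemma state_right:
  "uR w d m n i = (dsol (gm i) (qi w) (len i) + of_real (gm i) * sol (gm i) (qi w) (len i)) * uL w d m n i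
     + d * sol (gm i) (qi w) (len i) * FL w d m n i"
  "aR w d m n i = m * dsol (gm i) (qi w) (len i) * aL w d m n i"
  "bR w d m n i = m * dsol (gm i) (qi w) (len i) * bL w d m n i
     - sol (gm i) (qi w) (len i) * uL w d m n i / of_real (vb\<^sup>2)"
  by (cases "state w d m n i"; simp add: uL_def aL_def bL_def FL_def uR_def aR_def bR_def)+

lemma state_Suc:
  "uL w d m n (Suc i) = m * dsol 0 (qo w) (gp i) * uR w d m n i + sol 0 (qo w) (gp i) * FR w d m n i"
  "aL w d m n (Suc i) = dsol 0 (qo w) (gp i) * aR w d m n i
     - m * (w / of_real (v\<^sup>2)) * sol 0 (qo w) (gp i) * uR w d m n i"
  "bL w d m n (Suc i) = dsol 0 (qo w) (gp i) * bR w d m n i"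
  unfolding uL_def aL_def bL_def FR_def uR_def aR_def bR_def state.simps
  by (cases "res_step w d m n i (state w d m n i)"; simp)+

lemma flux_right: "FR w d m n i = m * dsol (gm i) (qi w) (len i) * FL w d m n i
     - n * sol (gm i) (qi w) (len i) * uL w d m n i / of_real (vb\<^sup>2)"
  by (simp add: FR_def FL_def state_right algebra_simps)

lemma flux_Suc: "FL w d m n (Suc i) = dsol 0 (qo w) (gp i) * FR w d m n i
     - m * qo w * sol 0 (qo w) (gp i) * uR w d m n i"
  by (simp add: FR_def FL_def state_Suc qo_def power2_eq_square algebra_simps)

subsection \<open>Eigenmodes and the transfer recursion\<close>

abbreviation "UL w d \<equiv> uL w d 1 (w\<^sup>2 / d)"
abbreviation "UR w d \<equiv> uR w d 1 (w\<^sup>2 / d)"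
abbreviation "GL w d \<equiv> FL w d 1 (w\<^sup>2 / d)"
abbreviation "GR w d \<equiv> FR w d 1 (w\<^sup>2 / d)"

text \<open>By transmission the interior slope is d times the exterior flux at both ends of a
  resonator. Multiplying the flux recursion by d turns n = w^2 / d into w^2 and thus n / vb^2 into
  \<open>qi w\<close>.\<close>

lemma genuine_right:
  assumes "d \<noteq> 0"
  shows "UR w d i = gen_sol (gm i) (qi w) (UL w d i) (d * GL w d i) (len i)"
    and "d * GR w d i = dgen_sol (gm i) (qi w) (UL w d i) (d * GL w d i) (len i)"
  using assms vb_pos
  by (simp_all add: state_right flux_right gen_sol_def dgen_sol_def qi_def field_simps)

lemma genuine_Suc:
  shows "UL w d (Suc i) = gen_sol 0 (qo w) (UR w d i) (GR w d i) (gp i)"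
    and "GL w d (Suc i) = dgen_sol 0 (qo w) (UR w d i) (GR w d i) (gp i)"
  by (simp_all add: state_Suc flux_Suc gen_sol_def dgen_sol_def algebra_simps)

definition res_mode :: "complex \<Rightarrow> complex \<Rightarrow> nat \<Rightarrow> real \<Rightarrow> complex" where
  "res_mode w d i x = gen_sol (gm i) (qi w) (UL w d i) (d * GL w d i) (x - lf i)"
definition dres_mode :: "complex \<Rightarrow> complex \<Rightarrow> nat \<Rightarrow> real \<Rightarrow> complex" where
  "dres_mode w d i x = dgen_sol (gm i) (qi w) (UL w d i) (d * GL w d i) (x - lf i)"

text \<open>The exterior components are numbered by the number of resonators on their left.\<close>

definition ext_comp :: "nat \<Rightarrow> real set" where
  "ext_comp i = {x. (i = 0 \<or> right_end S i < x) \<and> (i = N \<or> x < lf i)}"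

text \<open>For i > 0 the base point is the right end of the preceding resonator, that is
  \<open>rg (i - 1)\<close>. Component 0 has no resonator on its left and is based at its right
  boundary \<open>lf 0\<close>, where the recursion starts.\<close>

definition ext_base :: "nat \<Rightarrow> real" where
  "ext_base i = (if i = 0 then lf 0 else right_end S i)"
definition ext_val :: "complex \<Rightarrow> complex \<Rightarrow> nat \<Rightarrow> complex" where
  "ext_val w d i = (if i = 0 then 1 else UR w d (i - 1))"
definition ext_flux :: "complex \<Rightarrow> complex \<Rightarrow> nat \<Rightarrow> complex" where
  "ext_flux w d i = (if i = 0 then - \<i> * w / of_real v else GR w d (i - 1))"

definition ext_mode :: "complex \<Rightarrow> complex \<Rightarrow> nat \<Rightarrow> real \<Rightarrow> complex" where
  "ext_mode w d i x = gen_sol 0 (qo w) (ext_val w d i) (ext_flux w d i) (x - ext_base i)"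
definition dext_mode :: "complex \<Rightarrow> complex \<Rightarrow> nat \<Rightarrow> real \<Rightarrow> complex" where
  "dext_mode w d i x = dgen_sol 0 (qo w) (ext_val w d i) (ext_flux w d i) (x - ext_base i)"

lemma open_ext_comp: "open (ext_comp i)" and connected_ext_comp: "connected (ext_comp i)"
proof -
  have "ext_comp i = (if i = 0 then UNIV else {right_end S i<..}) \<inter> (if i = N then UNIV else {..<lf i})"
    by (auto simp: ext_comp_def)
  then show "open (ext_comp i)" by auto
  have "is_interval (ext_comp i)" by (auto simp: is_interval_1 ext_comp_def)
  then show "connected (ext_comp i)" by (simp add: is_interval_connected)
qed

lemma image_1_upto: "f ` {1..N} = (\<lambda>i. f (Suc i)) ` {..<N}"
  using image_comp[of f Suc "{..<N}"] by (simp add: o_def image_Suc_lessThan)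

lemma resonators_eq: "Defs.resonators S = (\<Union>i<N. {lf i<..<rg i})"
  unfolding Defs.resonators_def image_1_upto by simp

lemma interfaces_eq: "interfaces S = lf ` {..<N} \<union> rg ` {..<N}"
  unfolding interfaces_def image_1_upto ..

lemma ext_comp_le:
  assumes "x \<in> ext_comp i" "i \<le> N" "j < N"
  shows "j < i \<Longrightarrow> rg j < x" and "i \<le> j \<Longrightarrow> x < lf j"
proof -
  show "rg j < x" if "j < i"
  proof (cases i)
    case (Suc k)
    then show ?thesis using assms that rg_less_lf_mono[of j k] lf_less_rg[of k]
      by (cases "j = k") (auto simp: ext_comp_def)
  qed (use that in simp)
  show "x < lf j" if "i \<le> j"
    using assms that rg_less_lf_mono[of i j] lf_less_rg[of i]
    by (cases "j = i") (auto simp: ext_comp_def)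
qed

lemma ext_comp_exterior:
  assumes "i \<le> N" "x \<in> ext_comp i"
  shows "x \<notin> interfaces S" "x \<notin> Defs.resonators S"
proof -
  have "x < lf j \<or> rg j < x" if "j < N" for j
    using ext_comp_le[OF assms(2,1) that] by (cases "j < i") auto
  then show "x \<notin> interfaces S" "x \<notin> Defs.resonators S"
    using lf_less_rg unfolding interfaces_eq resonators_eq by (fastforce+)
qed

lemma position_cases:
  assumes "x \<notin> interfaces S"
  obtains (res) i where "i < N" "lf i < x" "x < rg i" | (ext) i where "i \<le> N" "x \<in> ext_comp i"
proof -
  \<comment> \<open>The first resonator whose left end is to the right of x, or N if there is none.
    Then x lies in exterior component i or in the resonator just before it.\<close>
  define i where "i = (LEAST i. i = N \<or> x < lf i)"
  have i: "i = N \<or> x < lf i" unfolding i_def by (rule LeastI[of _ N]) simp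
  have iN: "i \<le> N" unfolding i_def by (rule Least_le) simp
  have nj: "\<not> x < lf j" if "j < i" for j
    using not_less_Least[of j "\<lambda>i. i = N \<or> x < lf i"] that unfolding i_def by blast
  show thesis
  proof (cases "i = 0 \<or> right_end S i < x")
    case True
    then show thesis using i iN by (intro ext[of i]) (auto simp: ext_comp_def)
  next
    case False
    then obtain k where k: "i = Suc k" by (cases i) auto
    have "x \<noteq> lf k" "x \<noteq> rg k" using assms k iN by (auto simp: interfaces_eq)
    then show thesis using False nj[of k] k iN by (intro res[of k]) auto
  qed
qed

lemma position_unique:
  assumes "lf i < x" "x < rg i" "i < N" "lf j < x" "x < rg j" "j < N"
  shows "i = j"
  using assms rg_less_lf_mono[of i j] rg_less_lf_mono[of j i] by (cases i j rule: linorder_cases) auto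

lemma ext_comp_unique:
  assumes "x \<in> ext_comp i" "i \<le> N" "x \<in> ext_comp j" "j \<le> N"
  shows "i = j"
proof (cases i j rule: linorder_cases)
  case less
  then show ?thesis using assms ext_comp_le(1)[OF assms(3,4), of i] ext_comp_le(2)[OF assms(1,2), of i]
      lf_less_rg[of i] by simp
next
  case greater
  then show ?thesis using assms ext_comp_le(1)[OF assms(1,2), of j] ext_comp_le(2)[OF assms(3,4), of j]
      lf_less_rg[of j] by simp
qed

lemma ext_comp_left_of: 
  assumes "i < N"
  obtains a where "a < lf i" "\<And>x. a < x \<Longrightarrow> x < lf i \<Longrightarrow> x \<in> ext_comp i"
proof (cases i)
  case 0
  show thesis by (rule that[of "lf i - 1"]) (auto simp: ext_comp_def 0)
next
  case (Suc k)
  show thesis by (rule that[of "rg k"]) (use assms Suc rg_less_lf[of k] in \<open>auto simp: ext_comp_def\<close>)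
qed

lemma ext_comp_right_of:
  assumes "i < N"
  obtains b where "rg i < b" "\<And>x. rg i < x \<Longrightarrow> x < b \<Longrightarrow> x \<in> ext_comp (Suc i)"
proof (cases "Suc i = N")
  case True
  show thesis by (rule that[of "rg i + 1"]) (auto simp: ext_comp_def True)
next
  case False
  then have "Suc i < N" using assms by simp
  show thesis by (rule that[of "lf (Suc i)"]) (use rg_less_lf[OF \<open>Suc i < N\<close>] in \<open>auto simp: ext_comp_def\<close>)
qed

lemma ext_mode_at_lf: "ext_mode w d i (lf i) = UL w d i" "dext_mode w d i (lf i) = GL w d i"
  by (cases i; simp add: ext_mode_def dext_mode_def ext_val_def ext_flux_def ext_base_def genuine_Suc)+

lemma ext_mode_limits:
  fixes f g :: "real \<Rightarrow> complex"
  assumes i: "i < N"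
  shows "(\<And>x. x \<in> ext_comp i \<Longrightarrow> f x = c * ext_mode w d i x) \<Longrightarrow> (f \<longlongrightarrow> c * UL w d i) (at_left (lf i))"
    and "(\<And>x. x \<in> ext_comp i \<Longrightarrow> g x = c * dext_mode w d i x) \<Longrightarrow> (g \<longlongrightarrow> c * GL w d i) (at_left (lf i))"
    and "(\<And>x. x \<in> ext_comp (Suc i) \<Longrightarrow> f x = c * ext_mode w d (Suc i) x) \<Longrightarrow> (f \<longlongrightarrow> c * UR w d i) (at_right (rg i))"
    and "(\<And>x. x \<in> ext_comp (Suc i) \<Longrightarrow> g x = c * dext_mode w d (Suc i) x) \<Longrightarrow> (g \<longlongrightarrow> c * GR w d i) (at_right (rg i))"
proof -
  obtain a where a: "a < lf i" "\<And>x. a < x \<Longrightarrow> x < lf i \<Longrightarrow> x \<in> ext_comp i"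
    by (rule ext_comp_left_of[OF i]) blast
  obtain b where b: "rg i < b" "\<And>x. rg i < x \<Longrightarrow> x < b \<Longrightarrow> x \<in> ext_comp (Suc i)"
    by (rule ext_comp_right_of[OF i]) blast
  have e: "ext_mode w d (Suc i) (rg i) = UR w d i" "dext_mode w d (Suc i) (rg i) = GR w d i"
    by (simp_all add: ext_mode_def dext_mode_def ext_val_def ext_flux_def ext_base_def)
  have L: "((\<lambda>x. c * ext_mode w d j x) \<longlongrightarrow> c * ext_mode w d j y) (at y within X)"
    "((\<lambda>x. c * dext_mode w d j x) \<longlongrightarrow> c * dext_mode w d j y) (at y within X)" for j y X
    unfolding ext_mode_def dext_mode_def by (intro tendsto_intros gen_sol_tendsto)+
  show "(f \<longlongrightarrow> c * UL w d i) (at_left (lf i))" if "\<And>x. x \<in> ext_comp i \<Longrightarrow> f x = c * ext_mode w d i x"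
    unfolding ext_mode_at_lf[symmetric] using that a(2) by (intro tendsto_left_eq[OF L(1) a(1)]) blast
  show "(g \<longlongrightarrow> c * GL w d i) (at_left (lf i))" if "\<And>x. x \<in> ext_comp i \<Longrightarrow> g x = c * dext_mode w d i x"
    unfolding ext_mode_at_lf[symmetric] using that a(2) by (intro tendsto_left_eq[OF L(2) a(1)]) blast
  show "(f \<longlongrightarrow> c * UR w d i) (at_right (rg i))"
    if "\<And>x. x \<in> ext_comp (Suc i) \<Longrightarrow> f x = c * ext_mode w d (Suc i) x"
    unfolding e[symmetric] using that b(2) by (intro tendsto_right_eq[OF L(1) b(1)]) blast
  show "(g \<longlongrightarrow> c * GR w d i) (at_right (rg i))"
    if "\<And>x. x \<in> ext_comp (Suc i) \<Longrightarrow> g x = c * dext_mode w d (Suc i) x"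
    unfolding e[symmetric] using that b(2) by (intro tendsto_right_eq[OF L(2) b(1)]) blast
qed

lemma res_mode_limits:
  fixes f g :: "real \<Rightarrow> complex"
  assumes i: "i < N" and d: "d \<noteq> 0"
    and f: "\<And>x. lf i < x \<Longrightarrow> x < rg i \<Longrightarrow> f x = c * res_mode w d i x"
    and g: "\<And>x. lf i < x \<Longrightarrow> x < rg i \<Longrightarrow> g x = c * dres_mode w d i x"
  shows "(f \<longlongrightarrow> c * UL w d i) (at_right (lf i))" "(g \<longlongrightarrow> c * (d * GL w d i)) (at_right (lf i))"
    and "(f \<longlongrightarrow> c * UR w d i) (at_left (rg i))" "(g \<longlongrightarrow> c * (d * GR w d i)) (at_left (rg i))"
proof -
  have e: "res_mode w d i (lf i) = UL w d i" "dres_mode w d i (lf i) = d * GL w d i"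
    "res_mode w d i (rg i) = UR w d i" "dres_mode w d i (rg i) = d * GR w d i"
    by (simp_all add: res_mode_def dres_mode_def genuine_right[OF d])
  have L: "((\<lambda>x. c * res_mode w d i x) \<longlongrightarrow> c * res_mode w d i y) (at y within X)"
    "((\<lambda>x. c * dres_mode w d i x) \<longlongrightarrow> c * dres_mode w d i y) (at y within X)" for y X
    unfolding res_mode_def dres_mode_def by (intro tendsto_intros gen_sol_tendsto)+
  note lt = lf_less_rg[OF i]
  show "(f \<longlongrightarrow> c * UL w d i) (at_right (lf i))" "(g \<longlongrightarrow> c * (d * GL w d i)) (at_right (lf i))"
    "(f \<longlongrightarrow> c * UR w d i) (at_left (rg i))" "(g \<longlongrightarrow> c * (d * GR w d i)) (at_left (rg i))"
    unfolding e[symmetric]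
    by (rule tendsto_right_eq[OF L(1) lt] tendsto_left_eq[OF L(1) lt], erule (1) f)
      (rule tendsto_right_eq[OF L(2) lt] tendsto_left_eq[OF L(2) lt], erule (1) g,
       rule tendsto_left_eq[OF L(1) lt], erule (1) f,
       rule tendsto_left_eq[OF L(2) lt], erule (1) g)
qed

text \<open>The left radiation condition leaves one free constant c. Transmission propagates it
  through all components, so the right radiation condition becomes a single scalar equation.\<close>

lemma NR_solution_shape:
  assumes sol: "NR_solution S d w u" and d: "d \<noteq> 0"
  obtains c where
    "\<And>i x. i < N \<Longrightarrow> lf i < x \<Longrightarrow> x < rg i \<Longrightarrow> u x = c * res_mode w d i x \<and> Dx u x = c * dres_mode w d i x"
    "\<And>i x. i \<le> N \<Longrightarrow> x \<in> ext_comp i \<Longrightarrow> u x = c * ext_mode w d i x \<and> Dx u x = c * dext_mode w d i x"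
    "c * (GR w d (N - 1) - \<i> * w / of_real v * UR w d (N - 1)) = 0"
proof -
  have ode_res: "ode_on {lf i<..<rg i} (of_real (gm i)) (qi w) u" if "i < N" for i
    using sol that unfolding NR_solution_def qi_def by auto
  have "ode_on (- (Defs.resonators S \<union> interfaces S)) 0 (qo w) u"
    using sol unfolding NR_solution_def qo_def by blast
  then have ode_ext: "ode_on (ext_comp i) (of_real 0) (qo w) u" if "i \<le> N" for i
    using ext_comp_exterior[OF that] by (auto intro: ode_on_subset)
  have tr: "transmit u (lf i) 1 1" "transmit u (rg i) 1 1"
    "transmit (Dx u) (lf i) 1 d" "transmit (Dx u) (rg i) d 1" if "i < N" for i
    using sol that unfolding NR_solution_def by auto
  have rad: "\<And>x. x < lf 0 \<Longrightarrow> - Dx u x - \<i> * w / of_real v * u x = 0"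
    "\<And>x. x > rg (N - 1) \<Longrightarrow> Dx u x - \<i> * w / of_real v * u x = 0"
    using sol N_pos unfolding NR_solution_def by auto
  obtain c c1 where c: "\<And>x. x \<in> ext_comp 0 \<Longrightarrow> u x = gen_sol 0 (qo w) c c1 (x - lf 0)"
    "\<And>x. x \<in> ext_comp 0 \<Longrightarrow> Dx u x = dgen_sol 0 (qo w) c c1 (x - lf 0)"
    by (rule ode_on_gen_sol_ex[OF ode_ext open_ext_comp connected_ext_comp]) auto
  have m0: "x \<in> ext_comp 0" if "x < lf 0" for x using that by (simp add: ext_comp_def)
  have lim0: "(u \<longlongrightarrow> c) (at_left (lf 0))" "(Dx u \<longlongrightarrow> c1) (at_left (lf 0))"
    using gen_sol_tendsto[where x = "lf 0" and x0 = "lf 0"] m0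
    by (auto intro!: tendsto_left_eq[where a = "lf 0 - 1" and b = "lf 0", OF _ _ c(1)]
        tendsto_left_eq[where a = "lf 0 - 1" and b = "lf 0", OF _ _ c(2)])
      (metis gen_sol_0 diff_self)+
  \<comment> \<open>Letting x tend to \<open>lf 0\<close> in the radiation condition ties the slope
    c1 to the value c.\<close>
  have "((\<lambda>x. - Dx u x - \<i> * w / of_real v * u x) \<longlongrightarrow> - c1 - \<i> * w / of_real v * c) (at_left (lf 0))"
    by (intro tendsto_intros lim0)
  moreover have "((\<lambda>x. - Dx u x - \<i> * w / of_real v * u x) \<longlongrightarrow> 0) (at_left (lf 0))"
    by (rule tendsto_left_eq[where a = "lf 0 - 1", OF tendsto_const]) (use rad in auto)
  ultimately have "- c1 - \<i> * w / of_real v * c = 0"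
    using tendsto_unique[OF trivial_limit_at_left_real] by blast
  moreover have "c1 = - (- c1 - \<i> * w / of_real v * c) - \<i> * w / of_real v * c" by simp
  ultimately have c1: "c1 = c * (- \<i> * w / of_real v)" by simp
  define ok where "ok i \<longleftrightarrow> (\<forall>x\<in>ext_comp i. u x = c * ext_mode w d i x \<and> Dx u x = c * dext_mode w d i x)" for i
  have ok0: "ok 0"
    unfolding ok_def ext_mode_def dext_mode_def gen_sol_scale[symmetric]
    using c c1 by (simp add: ext_val_def ext_flux_def ext_base_def)
  have step: "(\<forall>x. lf i < x \<longrightarrow> x < rg i \<longrightarrow> u x = c * res_mode w d i x \<and> Dx u x = c * dres_mode w d i x)
      \<and> ok (Suc i)"
    if i: "i < N" and oki: "ok i" for i
  proof -
    have L: "(u \<longlongrightarrow> c * UL w d i) (at_left (lf i))" "(Dx u \<longlongrightarrow> c * GL w d i) (at_left (lf i))"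
      using oki by (auto simp: ok_def intro: ext_mode_limits[OF i])
    from transmit_left_limit[OF tr(1)[OF i] L(1)] transmit_left_limit[OF tr(3)[OF i] L(2)]
    have R: "(u \<longlongrightarrow> c * UL w d i) (at_right (lf i))" "(Dx u \<longlongrightarrow> c * (d * GL w d i)) (at_right (lf i))"
      by (auto simp: mult_ac)
    obtain d0 d1 where e: "\<And>x. x \<in> {lf i<..<rg i} \<Longrightarrow> u x = gen_sol (gm i) (qi w) d0 d1 (x - lf i)"
      "\<And>x. x \<in> {lf i<..<rg i} \<Longrightarrow> Dx u x = dgen_sol (gm i) (qi w) d0 d1 (x - lf i)"
      by (rule ode_on_gen_sol_ex[OF ode_res[OF i], of "lf i"]) auto
    have "(u \<longlongrightarrow> gen_sol (gm i) (qi w) d0 d1 (lf i - lf i)) (at_right (lf i))"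
      "(Dx u \<longlongrightarrow> dgen_sol (gm i) (qi w) d0 d1 (lf i - lf i)) (at_right (lf i))"
      by (rule tendsto_right_eq[OF gen_sol_tendsto(1) lf_less_rg[OF i]]
          tendsto_right_eq[OF gen_sol_tendsto(2) lf_less_rg[OF i]], use e in simp)+
    \<comment> \<open>The one-sided limits at \<open>lf i\<close> are the Cauchy data of the
      representation based there, which determines both coefficients.\<close>
    with R have "d0 = c * UL w d i" "d1 = c * (d * GL w d i)"
      using tendsto_unique[OF trivial_limit_at_right_real] by fastforce+
    then have res: "u x = c * res_mode w d i x" "Dx u x = c * dres_mode w d i x"
      if "lf i < x" "x < rg i" for x
      using e that by (simp_all add: res_mode_def dres_mode_def gen_sol_scale)
    have L': "(u \<longlongrightarrow> c * UR w d i) (at_left (rg i))" "(Dx u \<longlongrightarrow> c * (d * GR w d i)) (at_left (rg i))"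
      using res by (auto intro: res_mode_limits[OF i d])
    from transmit_left_limit[OF tr(2)[OF i] L'(1)] transmit_left_limit[OF tr(4)[OF i] L'(2)]
    have R': "(u \<longlongrightarrow> c * UR w d i) (at_right (rg i))" "(Dx u \<longlongrightarrow> c * GR w d i) (at_right (rg i))"
      using d by (auto simp: mult_ac)
    obtain e0 e1 where e: "\<And>x. x \<in> ext_comp (Suc i) \<Longrightarrow> u x = gen_sol 0 (qo w) e0 e1 (x - rg i)"
      "\<And>x. x \<in> ext_comp (Suc i) \<Longrightarrow> Dx u x = dgen_sol 0 (qo w) e0 e1 (x - rg i)"
      by (rule ode_on_gen_sol_ex[OF ode_ext open_ext_comp connected_ext_comp, of "Suc i" "rg i"])
        (use i in auto)
    obtain b where b: "rg i < b" "\<And>x. rg i < x \<Longrightarrow> x < b \<Longrightarrow> x \<in> ext_comp (Suc i)"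
      by (rule ext_comp_right_of[OF i]) blast
    have "(u \<longlongrightarrow> gen_sol 0 (qo w) e0 e1 (rg i - rg i)) (at_right (rg i))"
      "(Dx u \<longlongrightarrow> dgen_sol 0 (qo w) e0 e1 (rg i - rg i)) (at_right (rg i))"
      by (rule tendsto_right_eq[OF gen_sol_tendsto(1) b(1)]
          tendsto_right_eq[OF gen_sol_tendsto(2) b(1)], use e b(2) in simp)+
    with R' have "e0 = c * UR w d i" "e1 = c * GR w d i"
      using tendsto_unique[OF trivial_limit_at_right_real] by fastforce+
    then have "ok (Suc i)"
      using e by (simp add: ok_def ext_mode_def dext_mode_def gen_sol_scale ext_val_def ext_flux_def ext_base_def)
    with res show ?thesis by blast
  qed
  have ok: "ok i" if "i \<le> N" for i
    using that by (induction i) (use ok0 step in auto)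
  have "((\<lambda>x. Dx u x - \<i> * w / of_real v * u x) \<longlongrightarrow>
      c * GR w d (N - 1) - \<i> * w / of_real v * (c * UR w d (N - 1))) (at_right (rg (N - 1)))"
  proof (intro tendsto_intros)
    show "(u \<longlongrightarrow> c * UR w d (N - 1)) (at_right (rg (N - 1)))"
      "(Dx u \<longlongrightarrow> c * GR w d (N - 1)) (at_right (rg (N - 1)))"
      using ok[of N] N_pos ext_mode_limits(3)[of "N - 1" u c w d] ext_mode_limits(4)[of "N - 1" "Dx u" c w d]
      by (auto simp: ok_def)
  qed
  moreover have "((\<lambda>x. Dx u x - \<i> * w / of_real v * u x) \<longlongrightarrow> 0) (at_right (rg (N - 1)))"
    by (rule tendsto_right_eq[where b = "rg (N - 1) + 1", OF tendsto_const]) (use rad in auto)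
  ultimately have fin: "c * GR w d (N - 1) - \<i> * w / of_real v * (c * UR w d (N - 1)) = 0"
    using tendsto_unique[OF trivial_limit_at_right_real] by blast
  show thesis
  proof (rule that[of c])
    show "u x = c * res_mode w d i x \<and> Dx u x = c * dres_mode w d i x"
      if "i < N" "lf i < x" "x < rg i" for i x
      using step[OF that(1) ok] that by simp
    show "u x = c * ext_mode w d i x \<and> Dx u x = c * dext_mode w d i x"
      if "i \<le> N" "x \<in> ext_comp i" for i x
      using ok[OF that(1)] that(2) unfolding ok_def by blast
    show "c * (GR w d (N - 1) - \<i> * w / of_real v * UR w d (N - 1)) = 0"
      using fin by (simp add: algebra_simps)
  qed
qed

text \<open>One direction cancels the constant c of a nontrivial mode; the other glues the modes
  produced by the recursion into a solution.\<close>

lemma resonant_frequency_iff: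
  assumes d: "d \<noteq> 0"
  shows "resonant_frequency S d w \<longleftrightarrow> GR w d (N - 1) - \<i> * w / of_real v * UR w d (N - 1) = 0"
proof
  assume "resonant_frequency S d w"
  then obtain u x where u: "NR_solution S d w u" and x: "x \<notin> interfaces S" "u x \<noteq> 0"
    by (auto simp: resonant_frequency_def eigenmode_def)
  obtain c where c:
    "\<And>i x. i < N \<Longrightarrow> lf i < x \<Longrightarrow> x < rg i \<Longrightarrow> u x = c * res_mode w d i x \<and> Dx u x = c * dres_mode w d i x"
    "\<And>i x. i \<le> N \<Longrightarrow> x \<in> ext_comp i \<Longrightarrow> u x = c * ext_mode w d i x \<and> Dx u x = c * dext_mode w d i x"
    "c * (GR w d (N - 1) - \<i> * w / of_real v * UR w d (N - 1)) = 0"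
    by (rule NR_solution_shape[OF u d]) blast
  have "c \<noteq> 0"
    using x(2) by (cases rule: position_cases[OF x(1)]) (use c in auto)
  then show "GR w d (N - 1) - \<i> * w / of_real v * UR w d (N - 1) = 0" using c(3) by simp
next
  assume fin: "GR w d (N - 1) - \<i> * w / of_real v * UR w d (N - 1) = 0"
  \<comment> \<open>Off the interfaces exactly one description applies. At an interface the value is
    unspecified, which is harmless because only one-sided limits enter there.\<close>
  define u where "u x = (if \<exists>i<N. lf i < x \<and> x < rg i
     then res_mode w d (THE i. i < N \<and> lf i < x \<and> x < rg i) x
     else ext_mode w d (THE i. i \<le> N \<and> x \<in> ext_comp i) x)" for x
  have res: "u x = res_mode w d i x" if "i < N" "lf i < x" "x < rg i" for i x
  proof -
    have "(THE i. i < N \<and> lf i < x \<and> x < rg i) = i"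
      using that position_unique by blast
    then show ?thesis using that by (auto simp: u_def)
  qed
  have ext: "u x = ext_mode w d i x" if "i \<le> N" "x \<in> ext_comp i" for i x
  proof -
    have "(THE i. i \<le> N \<and> x \<in> ext_comp i) = i"
      using that ext_comp_unique by blast
    moreover have "\<not> (\<exists>i<N. lf i < x \<and> x < rg i)"
      using ext_comp_exterior[OF that] by (auto simp: resonators_eq)
    ultimately show ?thesis by (simp only: u_def if_False)
  qed
  have dres: "Dx u x = dres_mode w d i x" if "i < N" "lf i < x" "x < rg i" for i x
    unfolding dres_mode_def
    by (rule ode_on_gen_sol(2)[of "{lf i<..<rg i}"]) (use that res in \<open>auto simp: res_mode_def\<close>)
  have dext: "Dx u x = dext_mode w d i x" if "i \<le> N" "x \<in> ext_comp i" for i x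
    unfolding dext_mode_def
    by (rule ode_on_gen_sol(2)[OF _ open_ext_comp that(2)]) (use that ext in \<open>auto simp: ext_mode_def\<close>)
  have lims: "(u \<longlongrightarrow> UL w d i) (at_left (lf i))" "(Dx u \<longlongrightarrow> GL w d i) (at_left (lf i))"
    "(u \<longlongrightarrow> UL w d i) (at_right (lf i))" "(Dx u \<longlongrightarrow> d * GL w d i) (at_right (lf i))"
    "(u \<longlongrightarrow> UR w d i) (at_left (rg i))" "(Dx u \<longlongrightarrow> d * GR w d i) (at_left (rg i))"
    "(u \<longlongrightarrow> UR w d i) (at_right (rg i))" "(Dx u \<longlongrightarrow> GR w d i) (at_right (rg i))" if i: "i < N" for i
    using ext_mode_limits[OF i, of u 1 w d] ext_mode_limits[OF i, of "Dx u" 1 w d]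
      res_mode_limits[OF i d, of u 1 w "Dx u"] res[OF i] dres[OF i] ext dext i by simp_all
  have ode_ext: "ode_on (ext_comp i) (of_real 0) (qo w) u" if "i \<le> N" for i
    by (rule ode_on_gen_sol(1)[OF _ open_ext_comp]) (use that ext in \<open>auto simp: ext_mode_def\<close>)
  \<comment> \<open>With k = w / v the exterior coefficient is k^2, so a radiation relation between
    value and slope at the base point persists throughout an outer component.\<close>
  have qo: "qo w = - (\<i> * w / of_real v)\<^sup>2"
    by (simp add: qo_def power_divide power_mult_distrib)
  have "NR_solution S d w u"
    unfolding NR_solution_def
  proof (intro conjI ballI allI impI)
    fix i assume "i \<in> {1..N}"
    then obtain j where j: "i = Suc j" "j < N" by (cases i) auto
    show "ode_on {left_end S i<..<right_end S i} (of_real (gauge S i)) (w\<^sup>2 / of_real (vb\<^sup>2)) u"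
      unfolding j qi_def[symmetric]
      by (rule ode_on_gen_sol(1)) (use j res in \<open>auto simp: res_mode_def\<close>)
    show "transmit u (left_end S i) 1 1" "transmit u (right_end S i) 1 1"
      "transmit (Dx u) (left_end S i) 1 d" "transmit (Dx u) (right_end S i) d 1"
      unfolding transmit_def j using lims[OF j(2)] by force+
  next
    show "ode_on (- (Defs.resonators S \<union> interfaces S)) 0 (w\<^sup>2 / of_real (v\<^sup>2)) u"
      unfolding ode_on_def
    proof
      fix x assume x: "x \<in> - (Defs.resonators S \<union> interfaces S)"
      then have "x \<notin> interfaces S" by simp
      then obtain i where "i \<le> N" "x \<in> ext_comp i"
        by (cases rule: position_cases) (use x in \<open>auto simp: resonators_eq\<close>)
      then show "u differentiable at x \<and> Dx u differentiable at x
          \<and> Dx (Dx u) x + 0 * Dx u x + w\<^sup>2 / of_real (v\<^sup>2) * u x = 0"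
        using ode_ext[of i] unfolding ode_on_def qo_def by simp
    qed
  next
    fix x assume "x < left_end S 1"
    then have "x \<in> ext_comp 0" by (simp add: ext_comp_def)
    then show "- Dx u x - \<i> * w / of_real v * u x = 0"
      using ext[of 0 x] dext[of 0 x] \<open>x \<in> ext_comp 0\<close>
      unfolding ext_mode_def dext_mode_def ext_val_def ext_flux_def gen_sol_def dgen_sol_def qo
      by (simp only: if_True simp_thms le0, simp add: power2_eq_square algebra_simps)
  next
    fix x assume "right_end S N < x"
    then have "x \<in> ext_comp N" by (simp add: ext_comp_def)
    moreover have "GR w d (N - 1) = \<i> * w / of_real v * UR w d (N - 1)" using fin by simp
    ultimately show "Dx u x - \<i> * w / of_real v * u x = 0"
      using ext[of N x] dext[of N x] N_pos
      by (simp add: ext_mode_def dext_mode_def ext_val_def ext_flux_def gen_sol_def dgen_sol_def qo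
          power2_eq_square algebra_simps)
  qed
  \<comment> \<open>The limit of u at \<open>lf 0\<close> from the left is 1, so u cannot vanish on
    the left outer interval.\<close>
  moreover have "\<exists>x. x \<notin> interfaces S \<and> u x \<noteq> 0"
  proof (rule ccontr)
    assume neg: "\<not> (\<exists>x. x \<notin> interfaces S \<and> u x \<noteq> 0)"
    have "u x = 0" if "x < lf 0" for x
    proof -
      have "x \<notin> interfaces S" using that by (intro ext_comp_exterior[of 0]) (auto simp: ext_comp_def)
      then show ?thesis using neg by blast
    qed
    then have "(u \<longlongrightarrow> 0) (at_left (lf 0))"
      by (intro tendsto_left_eq[where a = "lf 0 - 1", OF tendsto_const]) auto
    then show False
      using lims(1)[OF N_pos] tendsto_unique[OF trivial_limit_at_left_real] by fastforce
  qed
  ultimately show "resonant_frequency S d w"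
    unfolding resonant_frequency_def eigenmode_def by blast
qed

end

section \<open>Holomorphic and continuous dependence of the recursion on its parameters\<close>

context resonators
begin

lemma holomorphic_qi [holomorphic_intros]: "f holomorphic_on X \<Longrightarrow> (\<lambda>z. qi (f z)) holomorphic_on X"
  and holomorphic_qo [holomorphic_intros]: "f holomorphic_on X \<Longrightarrow> (\<lambda>z. qo (f z)) holomorphic_on X"
  unfolding qi_def qo_def using v_pos vb_pos by (auto intro!: holomorphic_intros)

lemma continuous_qi [continuous_intros]: "continuous_on X f \<Longrightarrow> continuous_on X (\<lambda>z. qi (f z))"
  and continuous_qo [continuous_intros]: "continuous_on X f \<Longrightarrow> continuous_on X (\<lambda>z. qo (f z))"
  unfolding qi_def qo_def using v_pos vb_pos by (auto intro!: continuous_intros)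

text \<open>Dependence is stated along arbitrary one-parameter holomorphic families, which is the
  form required by \<open>holomorphic_implicit_function\<close> and involves functions of one
  variable only.\<close>

lemma holomorphic_left:
  assumes [holomorphic_intros]: "w holomorphic_on X" "d holomorphic_on X" "m holomorphic_on X" "n holomorphic_on X"
  shows "(\<lambda>e. uL (w e) (d e) (m e) (n e) i) holomorphic_on X \<and> (\<lambda>e. aL (w e) (d e) (m e) (n e) i) holomorphic_on X
    \<and> (\<lambda>e. bL (w e) (d e) (m e) (n e) i) holomorphic_on X"
proof (induction i)
  case (Suc i)
  then have [holomorphic_intros]: "(\<lambda>e. uL (w e) (d e) (m e) (n e) i) holomorphic_on X"
    "(\<lambda>e. aL (w e) (d e) (m e) (n e) i) holomorphic_on X"
    "(\<lambda>e. bL (w e) (d e) (m e) (n e) i) holomorphic_on X" by auto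
  show ?case
    unfolding state_Suc FR_def state_right FL_def using v_pos vb_pos
    by (intro conjI holomorphic_intros) auto
qed simp

lemma holomorphic_right:
  assumes *: "w holomorphic_on X" "d holomorphic_on X" "m holomorphic_on X" "n holomorphic_on X"
  shows "(\<lambda>e. uR (w e) (d e) (m e) (n e) i) holomorphic_on X" "(\<lambda>e. aR (w e) (d e) (m e) (n e) i) holomorphic_on X"
    "(\<lambda>e. bR (w e) (d e) (m e) (n e) i) holomorphic_on X"
proof -
  have [holomorphic_intros]: "(\<lambda>e. uL (w e) (d e) (m e) (n e) i) holomorphic_on X"
    "(\<lambda>e. aL (w e) (d e) (m e) (n e) i) holomorphic_on X"
    "(\<lambda>e. bL (w e) (d e) (m e) (n e) i) holomorphic_on X" using holomorphic_left[OF *] by auto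
  note [holomorphic_intros] = *
  show "(\<lambda>e. uR (w e) (d e) (m e) (n e) i) holomorphic_on X" "(\<lambda>e. aR (w e) (d e) (m e) (n e) i) holomorphic_on X"
    "(\<lambda>e. bR (w e) (d e) (m e) (n e) i) holomorphic_on X"
    unfolding state_right FL_def using v_pos vb_pos
    by (intro holomorphic_intros; simp)+
qed

lemma continuous_left:
  assumes [continuous_intros]: "continuous_on X w" "continuous_on X d" "continuous_on X m" "continuous_on X n"
  shows "continuous_on X (\<lambda>e. uL (w e) (d e) (m e) (n e) i) \<and> continuous_on X (\<lambda>e. aL (w e) (d e) (m e) (n e) i)
    \<and> continuous_on X (\<lambda>e. bL (w e) (d e) (m e) (n e) i)"
proof (induction i)
  case (Suc i)
  then have [continuous_intros]: "continuous_on X (\<lambda>e. uL (w e) (d e) (m e) (n e) i)"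
    "continuous_on X (\<lambda>e. aL (w e) (d e) (m e) (n e) i)"
    "continuous_on X (\<lambda>e. bL (w e) (d e) (m e) (n e) i)" by auto
  show ?case
    unfolding state_Suc FR_def state_right FL_def using v_pos vb_pos
    by (intro conjI continuous_intros) auto
qed simp

lemma continuous_right:
  assumes *: "continuous_on X w" "continuous_on X d" "continuous_on X m" "continuous_on X n"
  shows "continuous_on X (\<lambda>e. uR (w e) (d e) (m e) (n e) i)" "continuous_on X (\<lambda>e. aR (w e) (d e) (m e) (n e) i)"
    "continuous_on X (\<lambda>e. bR (w e) (d e) (m e) (n e) i)"
proof -
  have [continuous_intros]: "continuous_on X (\<lambda>e. uL (w e) (d e) (m e) (n e) i)"
    "continuous_on X (\<lambda>e. aL (w e) (d e) (m e) (n e) i)"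
    "continuous_on X (\<lambda>e. bL (w e) (d e) (m e) (n e) i)" using continuous_left[OF *] by auto
  note [continuous_intros] = *
  show "continuous_on X (\<lambda>e. uR (w e) (d e) (m e) (n e) i)" "continuous_on X (\<lambda>e. aR (w e) (d e) (m e) (n e) i)"
    "continuous_on X (\<lambda>e. bR (w e) (d e) (m e) (n e) i)"
    unfolding state_right FL_def using v_pos vb_pos
    by (intro continuous_intros; simp)+
qed

text \<open>For w = e f(e) and d = e^2 the quotient n = w^2 / d equals f(e)^2, so the recursion
  remains holomorphic at e = 0.\<close>

lemma holomorphic_curve:
  assumes f: "f holomorphic_on X"
  shows "(\<lambda>e. uL (e * f e) (e\<^sup>2) 1 ((f e)\<^sup>2) i) holomorphic_on X"
    and "(\<lambda>e. FL (e * f e) (e\<^sup>2) 1 ((f e)\<^sup>2) i) holomorphic_on X"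
    and "(\<lambda>e. uR (e * f e) (e\<^sup>2) 1 ((f e)\<^sup>2) i) holomorphic_on X"
    and "(\<lambda>e. FR (e * f e) (e\<^sup>2) 1 ((f e)\<^sup>2) i) holomorphic_on X"
proof -
  have w: "(\<lambda>e. e * f e) holomorphic_on X" "(\<lambda>e::complex. e\<^sup>2) holomorphic_on X"
    "(\<lambda>e. (f e)\<^sup>2) holomorphic_on X"
    by (intro holomorphic_intros f)+
  note L = holomorphic_left[OF w(1,2) holomorphic_on_const w(3), of 1 i]
  note R = holomorphic_right[OF w(1,2) holomorphic_on_const w(3), of 1 i]
  show "(\<lambda>e. uL (e * f e) (e\<^sup>2) 1 ((f e)\<^sup>2) i) holomorphic_on X"
    "(\<lambda>e. FL (e * f e) (e\<^sup>2) 1 ((f e)\<^sup>2) i) holomorphic_on X"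
    "(\<lambda>e. uR (e * f e) (e\<^sup>2) 1 ((f e)\<^sup>2) i) holomorphic_on X"
    "(\<lambda>e. FR (e * f e) (e\<^sup>2) 1 ((f e)\<^sup>2) i) holomorphic_on X"
    using L R w unfolding FL_def FR_def by (auto intro!: holomorphic_on_add holomorphic_on_mult)
qed

subsection \<open>The unperturbed recursion\<close>

text \<open>At \<open>\<omega> = \<delta> = 0\<close> the numbers \<open>cc i\<close> and \<open>ee i\<close> are the values of \<open>sol\<close> and \<open>dsol\<close> at the right end of
  the resonator.\<close>

definition cc :: "nat \<Rightarrow> real" where "cc i = (1 - exp (- gm i * len i)) / gm i"
definition ee :: "nat \<Rightarrow> real" where "ee i = exp (- gm i * len i)"
text \<open>The integrating factor exp(integral of gamma) accumulated over the first i
  resonators.\<close>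

definition pp :: "nat \<Rightarrow> real" where "pp i = (\<Prod>j<i. exp (gm j * len j))"
text \<open>This is \<open>pp i\<close> times (exp(gamma l) - 1) / gamma, the integral of the
  integrating factor over resonator i: the mass of that resonator in the symmetrized
  problem.\<close>

definition mm :: "nat \<Rightarrow> real" where "mm i = pp (Suc i) * cc i"

lemma cc_pos: "i < N \<Longrightarrow> 0 < cc i"
proof -
  assume i: "i < N"
  have l: "0 < len i" using lf_less_rg[OF i] by simp
  show ?thesis
  proof (cases "0 < gm i")
    case True
    then show ?thesis using l by (simp add: cc_def)
  next
    case False
    then have "gm i < 0" using gm_nonzero[OF i] by simp
    then show ?thesis using l by (simp add: cc_def zero_less_divide_iff mult_neg_pos)
  qed
qed

lemma pp_pos: "0 < pp i" by (simp add: pp_def prod_pos)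
lemma pp_0 [simp]: "pp 0 = 1" by (simp add: pp_def)
lemma pp_Suc: "pp (Suc i) * ee i = pp i"
  by (simp add: pp_def ee_def flip: exp_add)
lemma mm_pos: "i < N \<Longrightarrow> 0 < mm i" by (simp add: mm_def pp_pos cc_pos)

lemma unperturbed_coeffs:
  assumes "i < N"
  shows "dsol (gm i) 0 (len i) = of_real (ee i)" "sol (gm i) 0 (len i) = of_real (cc i)"
    "dsol 0 0 y = 1" "sol 0 0 y = of_real y"
proof -
  show "dsol (gm i) 0 (len i) = of_real (ee i)" "dsol 0 0 y = 1" "sol 0 0 y = of_real y"
    unfolding sol_at_0 ee_def by simp_all
  have "of_real (gm i) * sol (gm i) 0 (len i) = of_real (gm i) * of_real (cc i)"
    using gm_nonzero[OF assms] unfolding sol_at_0 by (simp add: cc_def del: of_real_mult flip: of_real_mult)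
  then show "sol (gm i) 0 (len i) = of_real (cc i)"
    using gm_nonzero[OF assms] by simp
qed

lemma cc_ee: "i < N \<Longrightarrow> ee i + gm i * cc i = 1"
  using gm_nonzero by (simp add: cc_def ee_def)

lemma q_0 [simp]: "qi 0 = 0" "qo 0 = 0" by (simp_all add: qi_def qo_def)

lemma unperturbed_right:
  assumes "i < N"
  shows "uR 0 0 m n i = uL 0 0 m n i"
    "aR 0 0 m n i = m * of_real (ee i) * aL 0 0 m n i"
    "bR 0 0 m n i = m * of_real (ee i) * bL 0 0 m n i - of_real (cc i) * uL 0 0 m n i / of_real (vb\<^sup>2)"
    "FR 0 0 m n i = n * bR 0 0 m n i"
    "FL 0 0 m n i = n * bL 0 0 m n i"
proof -
  have "of_real (ee i) + of_real (gm i) * of_real (cc i) = (1::complex)"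
    using cc_ee[OF assms] by (simp flip: of_real_add of_real_mult)
  then show "uR 0 0 m n i = uL 0 0 m n i"
    by (simp add: state_right unperturbed_coeffs[OF assms])
qed (simp_all add: state_right unperturbed_coeffs[OF assms] FR_def FL_def)

lemma unperturbed_Suc:
  assumes "i < N"
  shows "uL 0 0 m n (Suc i) = m * uL 0 0 m n i + of_real (gp i) * (n * bR 0 0 m n i)"
    "aL 0 0 m n (Suc i) = aR 0 0 m n i"
    "bL 0 0 m n (Suc i) = bR 0 0 m n i"
  by (simp_all add: state_Suc unperturbed_coeffs[OF assms] unperturbed_right[OF assms])

text \<open>The limiting problem with n = \<open>\<mu>\<close>. \<open>U\<close> is the value on
  resonator i and \<open>\<mu>\<close> times \<open>Q\<close> the flux to its right; dividing the
  flux by \<open>\<mu>\<close> separates off the eigenvalue 0.\<close>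

abbreviation "U \<mu> i \<equiv> uL 0 0 1 \<mu> i"
abbreviation "Q \<mu> i \<equiv> bR 0 0 1 \<mu> i"

text \<open>The pair (\<open>U\<close>, \<open>bL\<close>) as polynomials in \<open>\<mu>\<close>,
  needed to count roots by degree; \<open>pCons 0\<close> is multiplication by
  \<open>\<mu>\<close>.\<close>

primrec upoly :: "nat \<Rightarrow> complex poly \<times> complex poly" where
  "upoly 0 = (1, 0)"
| "upoly (Suc i) = (let b = Polynomial.smult (of_real (ee i)) (snd (upoly i)) - Polynomial.smult (of_real (cc i / vb\<^sup>2)) (fst (upoly i))
     in (fst (upoly i) + Polynomial.smult (of_real (gp i)) (pCons 0 b), b))"

lemma poly_upoly:
  assumes "i \<le> N"
  shows "poly (fst (upoly i)) \<mu> = U \<mu> i" "poly (snd (upoly i)) \<mu> = bL 0 0 1 \<mu> i"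
  using assms
  by (induction i) (simp_all add: Let_def unperturbed_Suc unperturbed_right)

text \<open>Each cell raises the degree of the value by exactly one, with leading coefficient
  multiplied by - gp * cc / vb^2, while \<open>bL\<close> stays one degree behind.\<close>

lemma coeff_upoly:
  assumes "i < N"
  shows "(\<forall>k\<ge>i. poly.coeff (snd (upoly i)) k = 0) \<and> (\<forall>k>i. poly.coeff (fst (upoly i)) k = 0) \<and> poly.coeff (fst (upoly i)) i \<noteq> 0"
  using assms
proof (induction i)
  case 0
  then show ?case by simp
next
  case (Suc i)
  then have IH: "\<And>k. k \<ge> i \<Longrightarrow> poly.coeff (snd (upoly i)) k = 0" "\<And>k. k > i \<Longrightarrow> poly.coeff (fst (upoly i)) k = 0"
    "poly.coeff (fst (upoly i)) i \<noteq> 0" by auto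
  have "cc i \<noteq> 0" "gp i \<noteq> 0" using cc_pos[of i] rg_less_lf[of i] Suc.prems by auto
  then show ?case
    using IH vb_pos Suc.prems by (auto simp: Let_def coeff_pCons split: nat.split)
qed

definition qpoly :: "complex poly" where "qpoly = snd (upoly N)"

lemma poly_qpoly: "poly qpoly \<mu> = Q \<mu> (N - 1)"
  unfolding qpoly_def poly_upoly(2)[OF order_refl]
  using unperturbed_Suc(3)[of "N - 1" 1 \<mu>] N_pos by simp

lemma degree_qpoly: "Polynomial.degree qpoly = N - 1"
proof -
  obtain k where k: "N = Suc k" using N_pos by (cases N) auto
  have *: "(\<forall>j\<ge>k. poly.coeff (snd (upoly k)) j = 0) \<and> (\<forall>j>k. poly.coeff (fst (upoly k)) j = 0) \<and> poly.coeff (fst (upoly k)) k \<noteq> 0"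
    by (rule coeff_upoly) (simp add: k)
  have "cc k \<noteq> 0" using cc_pos[of k] k by simp
  then have "poly.coeff qpoly k \<noteq> 0" "\<forall>j>k. poly.coeff qpoly j = 0"
    using * vb_pos by (auto simp: qpoly_def k Let_def)
  then show ?thesis
    using Polynomial.le_degree[of qpoly k] Polynomial.degree_le[of k qpoly] k by auto
qed

text \<open>The weights \<open>pp\<close> make the recursion symmetric.\<close>

lemma wronskian_sum:
  fixes u F F' V G G' e1 e2 e3 :: "nat \<Rightarrow> complex"
  assumes F': "\<And>i. i \<le> k \<Longrightarrow> F' i = of_real (ee i) * F i - \<mu> * of_real (cc i) * u i / of_real (vb\<^sup>2) + e1 i"
    and u: "\<And>i. i < k \<Longrightarrow> u (Suc i) = u i + of_real (gp i) * F' i + e2 i"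
    and F: "\<And>i. i < k \<Longrightarrow> F (Suc i) = F' i + e3 i"
    and G': "\<And>i. i \<le> k \<Longrightarrow> G' i = of_real (ee i) * G i - \<nu> * of_real (cc i) * V i / of_real (vb\<^sup>2)"
    and V: "\<And>i. i < k \<Longrightarrow> V (Suc i) = V i + of_real (gp i) * G' i"
    and G: "\<And>i. i < k \<Longrightarrow> G (Suc i) = G' i"
  shows "of_real (pp (Suc k)) * (F' k * V k - G' k * u k) = F 0 * V 0 - G 0 * u 0
     - (\<mu> - \<nu>) / of_real (vb\<^sup>2) * (\<Sum>j\<le>k. of_real (mm j) * u j * V j)
     + ((\<Sum>j\<le>k. of_real (pp (Suc j)) * e1 j * V j)
        + (\<Sum>j<k. of_real (pp (Suc j)) * (e3 j * V (Suc j) - G' j * e2 j)))"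
proof -
  define c where "c = (\<mu> - \<nu>) / of_real (vb\<^sup>2)"
  \<comment> \<open>\<open>pp_Suc\<close> absorbs the damping factor \<open>ee\<close>, so both
    fluxes are carried from weight \<open>pp i\<close> to weight \<open>pp (Suc i)\<close> without
    loss, and only the mass term remains.\<close>
  have right: "of_real (pp (Suc i)) * (F' i * V i - G' i * u i)
      = of_real (pp i) * (F i * V i - G i * u i) - c * (of_real (mm i) * u i * V i)
        + of_real (pp (Suc i)) * e1 i * V i" if "i \<le> k" for i
    unfolding F'[OF that] G'[OF that] pp_Suc[of i, symmetric] mm_def c_def
    by (simp add: algebra_simps diff_divide_distrib)
  \<comment> \<open>The products gp * F' * G' cancel, so crossing a gap changes the Wronskian only
    through the errors e2 and e3.\<close>
  have gap: "of_real (pp (Suc i)) * (F (Suc i) * V (Suc i) - G (Suc i) * u (Suc i))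
      = of_real (pp (Suc i)) * (F' i * V i - G' i * u i)
        + of_real (pp (Suc i)) * (e3 i * V (Suc i) - G' i * e2 i)" if "i < k" for i
    unfolding F[OF that] G[OF that] u[OF that] unfolding V[OF that] by (simp add: algebra_simps)
  have "of_real (pp i) * (F i * V i - G i * u i) = F 0 * V 0 - G 0 * u 0
     - c * (\<Sum>j<i. of_real (mm j) * u j * V j)
     + ((\<Sum>j<i. of_real (pp (Suc j)) * e1 j * V j)
        + (\<Sum>j<i. of_real (pp (Suc j)) * (e3 j * V (Suc j) - G' j * e2 j)))" if "i \<le> k" for i
    using that
  proof (induction i)
    case (Suc i)
    then show ?case
      unfolding gap[OF Suc_le_lessD[OF Suc.prems]] right[OF Suc_leD[OF Suc.prems]]
      by (simp add: algebra_simps)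
  qed simp
  from this[OF order_refl] show ?thesis
    unfolding right[OF order_refl] lessThan_Suc_atMost[symmetric] c_def[symmetric]
    by (simp add: algebra_simps)
qed

text \<open>A discrete Lagrange identity; the left boundary term vanishes because the recursion
  starts with zero flux. Taking \<open>\<nu>\<close> conjugate to \<open>\<mu>\<close> gives real
  roots, and differentiating at \<open>\<nu>\<close> = \<open>\<mu>\<close> gives simple
  ones.\<close>

lemma unperturbed_wronskian:
  "of_real (pp N) * (\<mu> * Q \<mu> (N - 1) * U \<nu> (N - 1) - \<nu> * Q \<nu> (N - 1) * U \<mu> (N - 1))
     = (\<nu> - \<mu>) / of_real (vb\<^sup>2) * (\<Sum>j<N. of_real (mm j) * U \<mu> j * U \<nu> j)"
proof -
  have "of_real (pp (Suc (N - 1))) * (\<mu> * Q \<mu> (N - 1) * U \<nu> (N - 1) - \<nu> * Q \<nu> (N - 1) * U \<mu> (N - 1))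
     = \<mu> * bL 0 0 1 \<mu> 0 * U \<nu> 0 - \<nu> * bL 0 0 1 \<nu> 0 * U \<mu> 0
     - (\<mu> - \<nu>) / of_real (vb\<^sup>2) * (\<Sum>j\<le>N - 1. of_real (mm j) * U \<mu> j * U \<nu> j)
     + ((\<Sum>j\<le>N - 1. of_real (pp (Suc j)) * 0 * U \<nu> j)
        + (\<Sum>j<N - 1. of_real (pp (Suc j)) * (0 * U \<nu> (Suc j) - \<nu> * Q \<nu> j * 0)))"
    using N_pos
    by (intro wronskian_sum[where F = "\<lambda>i. \<mu> * bL 0 0 1 \<mu> i" and G = "\<lambda>i. \<nu> * bL 0 0 1 \<nu> i"])
      (auto simp: unperturbed_Suc unperturbed_right algebra_simps)
  moreover have "{..N - 1} = {..<N}" using N_pos by auto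
  ultimately show ?thesis using N_pos by (simp add: diff_divide_distrib left_diff_distrib)
qed

lemma unperturbed_real:
  assumes "i < N"
  shows "U (of_real x) i = of_real (Re (U (of_real x) i))" "Q (of_real x) i = of_real (Re (Q (of_real x) i))"
proof -
  have *: "U (of_real x) i \<in> \<real> \<and> bL 0 0 1 (of_real x) i \<in> \<real>" if "i < N" for i
    using that
    by (induction i) (auto simp: unperturbed_Suc unperturbed_right intro!: Reals_add Reals_diff Reals_mult Reals_divide)
  then have "U (of_real x) i \<in> \<real>" "Q (of_real x) i \<in> \<real>"
    using assms by (auto simp: unperturbed_right intro!: Reals_add Reals_diff Reals_mult Reals_divide)
  then show "U (of_real x) i = of_real (Re (U (of_real x) i))" "Q (of_real x) i = of_real (Re (Q (of_real x) i))"
    by (simp_all add: of_real_Re)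
qed

lemma unperturbed_cnj: "i < N \<Longrightarrow> U (cnj \<mu>) i = cnj (U \<mu> i) \<and> bL 0 0 1 (cnj \<mu>) i = cnj (bL 0 0 1 \<mu> i)"
  by (induction i) (simp_all add: unperturbed_Suc unperturbed_right)

text \<open>For x <= 0 every Q is negative, so x * Q is nonnegative and the values can only grow
  from 1; this in turn keeps Q negative. In particular Q does not vanish at 0.\<close>

lemma unperturbed_nonpos:
  assumes "x \<le> 0" "i < N"
  shows "1 \<le> Re (U (of_real x) i) \<and> Re (bL 0 0 1 (of_real x) i) \<le> 0 \<and> Re (Q (of_real x) i) < 0"
proof -
  have Q: "Re (Q (of_real x) i) < 0" if "1 \<le> Re (U (of_real x) i)" "Re (bL 0 0 1 (of_real x) i) \<le> 0" "i < N" for i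
  proof -
    have "ee i * Re (bL 0 0 1 (of_real x) i) \<le> 0" using that by (simp add: ee_def mult_nonneg_nonpos)
    moreover have "0 < cc i * Re (U (of_real x) i) / vb\<^sup>2" using that vb_pos cc_pos[of i] by simp
    moreover have "Re (Q (of_real x) i) = ee i * Re (bL 0 0 1 (of_real x) i) - cc i * Re (U (of_real x) i) / vb\<^sup>2"
      unfolding unperturbed_right[OF that(3)] by (simp del: of_real_power)
    ultimately show ?thesis by simp
  qed
  have "1 \<le> Re (U (of_real x) i) \<and> Re (bL 0 0 1 (of_real x) i) \<le> 0"
    using assms(2)
  proof (induction i)
    case (Suc i)
    then have IH: "1 \<le> Re (U (of_real x) i)" "Re (bL 0 0 1 (of_real x) i) \<le> 0" "i < N" by auto
    have "0 \<le> gp i * (x * Re (Q (of_real x) i))"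
      using Q[OF IH] rg_less_lf[of i] Suc.prems assms(1) by (simp add: mult_nonpos_nonpos)
    then show ?case using IH Q[OF IH] by (simp add: unperturbed_Suc)
  qed simp
  with Q assms show ?thesis by blast
qed

definition roots :: "complex set" where "roots = {\<mu>. Q \<mu> (N - 1) = 0}"

lemma weighted_sum_pos:
  assumes "f 0 \<noteq> 0"
  shows "0 < (\<Sum>j<N. mm j * (f j)\<^sup>2)"
proof (rule sum_pos2[of _ 0])
  show "0 < mm 0 * (f 0)\<^sup>2" using mm_pos[OF N_pos] assms by simp
  show "0 \<le> mm i * (f i)\<^sup>2" if "i \<in> {..<N}" for i
    using mm_pos[of i] that by simp
qed (use N_pos in auto)

text \<open>For conjugate parameters both final fluxes vanish, and the weighted sum of squared
  moduli is positive because the first value is 1. Hence the root equals its conjugate, and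
  \<open>unperturbed_nonpos\<close> gives its sign.\<close>

lemma roots_real_pos:
  assumes "\<mu> \<in> roots"
  shows "\<mu> = of_real (Re \<mu>)" "0 < Re \<mu>"
proof -
  have cnj: "U (cnj \<mu>) j = cnj (U \<mu> j)" "Q (cnj \<mu>) j = cnj (Q \<mu> j)" if "j < N" for j
    using unperturbed_cnj[OF that, of \<mu>] that by (auto simp: unperturbed_right)
  have "Q \<mu> (N - 1) = 0" "Q (cnj \<mu>) (N - 1) = 0"
    using assms cnj(2)[of "N - 1"] N_pos by (simp_all add: roots_def)
  then have "(\<mu> - cnj \<mu>) * (\<Sum>j<N. of_real (mm j) * U \<mu> j * U (cnj \<mu>) j) = 0"
    using unperturbed_wronskian[of \<mu> "cnj \<mu>"] vb_pos by auto
  moreover have "(\<Sum>j<N. of_real (mm j) * U \<mu> j * U (cnj \<mu>) j) = of_real (\<Sum>j<N. mm j * (norm (U \<mu> j))\<^sup>2)"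
    unfolding of_real_sum of_real_mult complex_norm_square
    by (rule sum.cong) (simp_all add: cnj mult.assoc)
  moreover have "0 < (\<Sum>j<N. mm j * (norm (U \<mu> j))\<^sup>2)"
    by (rule weighted_sum_pos) simp
  ultimately have "\<mu> = cnj \<mu>" by (simp del: of_real_sum)
  then show real: "\<mu> = of_real (Re \<mu>)" by (simp add: complex_eq_iff)
  show "0 < Re \<mu>"
  proof (rule ccontr)
    assume "\<not> 0 < Re \<mu>"
    then have "Re (Q (of_real (Re \<mu>)) (N - 1)) < 0"
      using unperturbed_nonpos[of "Re \<mu>" "N - 1"] N_pos by simp
    then show False using assms real by (simp add: roots_def)
  qed
qed

lemma Q_deriv: "((\<lambda>\<mu>. Q \<mu> (N - 1)) has_field_derivative poly (pderiv qpoly) \<mu>) (at \<mu>)"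
  unfolding poly_qpoly[symmetric] by (rule poly_DERIV)

text \<open>At a double root the left side of the Lagrange identity would have derivative 0, whereas
  the right side has derivative -T / vb^2 with T a weighted sum of squares starting with 1.\<close>

lemma roots_simple:
  assumes "\<mu> \<in> roots"
  shows "poly (pderiv qpoly) \<mu> \<noteq> 0"
proof
  assume zero: "poly (pderiv qpoly) \<mu> = 0"
  define x where "x = Re \<mu>"
  have \<mu>: "\<mu> = of_real x" "0 < x" and Q0: "Q \<mu> (N - 1) = 0"
    using roots_real_pos[OF assms] assms by (simp_all add: x_def roots_def)
  define T where "T \<kappa> = (\<Sum>j<N. of_real (mm j) * U \<kappa> j * U \<mu> j)" for \<kappa>
  have hol: "(\<lambda>\<kappa>. U \<kappa> j) holomorphic_on UNIV" for j
    using holomorphic_left[of "\<lambda>_. 0" UNIV "\<lambda>_. 0" "\<lambda>_. 1" "\<lambda>x. x" j] by (auto intro!: holomorphic_intros)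
  have "T holomorphic_on UNIV"
    unfolding T_def[abs_def] by (intro holomorphic_intros hol)
  then have T: "(T has_field_derivative deriv T \<mu>) (at \<mu>)"
    by (auto intro: holomorphic_derivI)
  have id: "of_real (pp N) * (\<kappa> * Q \<kappa> (N - 1) * U \<mu> (N - 1)) = (\<mu> - \<kappa>) / of_real (vb\<^sup>2) * T \<kappa>" for \<kappa>
    using unperturbed_wronskian[of \<kappa> \<mu>] Q0 by (simp add: T_def)
  have "((\<lambda>\<kappa>. of_real (pp N) * (\<kappa> * Q \<kappa> (N - 1) * U \<mu> (N - 1))) has_field_derivative 0) (at \<mu>)"
    by (rule derivative_eq_intros Q_deriv refl)+ (use Q0 in \<open>simp add: zero\<close>)
  moreover have "((\<lambda>\<kappa>. (\<mu> - \<kappa>) / of_real (vb\<^sup>2) * T \<kappa>) has_field_derivative - 1 / of_real (vb\<^sup>2) * T \<mu>) (at \<mu>)"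
    using vb_pos by (auto intro!: derivative_eq_intros T simp: field_simps)
  ultimately have "- 1 / of_real (vb\<^sup>2) * T \<mu> = 0"
    unfolding id using DERIV_unique by blast
  then have "T \<mu> = 0" using vb_pos by simp
  moreover have "T \<mu> = of_real (\<Sum>j<N. mm j * (Re (U \<mu> j))\<^sup>2)"
    unfolding T_def of_real_sum
  proof (rule sum.cong)
    fix j assume "j \<in> {..<N}"
    then have "U \<mu> j = of_real (Re (U \<mu> j))" using unperturbed_real(1)[of j x] \<mu> by simp
    then show "of_real (mm j) * U \<mu> j * U \<mu> j = of_real (mm j * (Re (U \<mu> j))\<^sup>2)"
      by (metis mult.assoc of_real_mult power2_eq_square)
  qed simp
  moreover have "0 < (\<Sum>j<N. mm j * (Re (U \<mu> j))\<^sup>2)"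
    by (rule weighted_sum_pos) simp
  ultimately show False by (simp del: of_real_sum)
qed

text \<open>With simple roots only, the polynomial is a constant times a product of distinct linear
  factors, so its degree N - 1 counts them.\<close>

lemma finite_roots: "finite roots" and card_roots: "card roots = N - 1"
proof -
  have r: "roots = {x. poly qpoly x = 0}" by (simp add: roots_def poly_qpoly)
  have nz: "qpoly \<noteq> 0"
  proof
    assume "qpoly = 0"
    then have "Q (of_real 0) (N - 1) = 0" using poly_qpoly[of 0] by simp
    then show False using unperturbed_nonpos[of 0 "N - 1"] N_pos by simp
  qed
  show "finite roots" unfolding r by (rule poly_roots_finite[OF nz])
  have "rsquarefree qpoly"
    unfolding rsquarefree_roots using roots_simple r by blast
  then have "Polynomial.smult (lead_coeff qpoly) (\<Prod>z|poly qpoly z = 0. [:-z, 1:]) = qpoly"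
    by (rule complex_poly_decompose_rsquarefree)
  then have "Polynomial.degree qpoly = Polynomial.degree (\<Prod>z|poly qpoly z = 0. [:-z, 1:])"
    using nz by (metis degree_smult_eq leading_coeff_0_iff)
  also have "\<dots> = (\<Sum>z|poly qpoly z = 0. Polynomial.degree [:-z, 1:])"
    by (rule degree_prod_eq_sum_degree) auto
  also have "\<dots> = card roots" by (simp add: r)
  finally show "card roots = N - 1" by (simp add: degree_qpoly)
qed

subsection \<open>Eigenvectors of the capacitance matrix\<close>

abbreviation ratio where "ratio \<equiv> speed_ratio S"

lemma ratio_pos: "0 < ratio" by (simp add: speed_ratio_def v_pos vb_pos)
lemma ratio_vb: "ratio * vb\<^sup>2 = v * vb"
  using vb_pos by (simp add: speed_ratio_def power2_eq_square)

text \<open>The speed ratio cancels in beta * t, and beta exp(x) / (2 sinh x) becomes 1 / (ratio *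
  cc). The value 1 in the last case is the convention for the final entry of
  \<open>tt\<close>.\<close>

lemma theta_odd:
  assumes "i < N"
  shows "theta S (2 * i + 1) = 1 / (ratio * cc i * (if Suc i = N then 1 else gp i))"
proof -
  have tt: "tt S (2 * i + 1 + 1) = (if Suc i = N then 1 else gp i)" "tt S (2 * i + 1) = ratio * len i"
    using assms by (auto simp: tt_def res_gap_def res_len_def)
  have b: "beta S (2 * i + 1) = gm i / ratio" by (simp add: beta_def)
  define x where "x = gm i * len i / 2"
  have x: "beta S (2 * i + 1) * tt S (2 * i + 1) / 2 = x"
    unfolding b tt x_def using ratio_pos by simp
  have c: "cc i = (1 - exp (- (2 * x))) / gm i" by (simp add: cc_def x_def)
  have "x \<noteq> 0" using gm_nonzero[OF assms] lf_less_rg[OF assms] by (simp add: x_def)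
  have sh: "2 * sinh x = exp x * (1 - exp (- (2 * x)))"
    by (simp add: sinh_field_def right_diff_distrib flip: exp_add)
  have "theta S (2 * i + 1) = beta S (2 * i + 1) * exp (beta S (2 * i + 1) * tt S (2 * i + 1) / 2)
      / (2 * sinh (beta S (2 * i + 1) * tt S (2 * i + 1) / 2) * tt S (2 * i + 1 + 1))"
    by (simp add: theta_def)
  also have "\<dots> = (gm i / ratio) * exp x / (2 * sinh x * tt S (2 * i + 1 + 1))"
    unfolding x unfolding b ..
  also have "\<dots> = 1 / (ratio * cc i * (if Suc i = N then 1 else gp i))"
    unfolding tt c sh using gm_nonzero[OF assms] \<open>x \<noteq> 0\<close> by (simp add: divide_simps)
  finally show ?thesis .
qed

lemma theta_even:
  assumes "i < N"
  shows "theta S (2 * i) = ee i / (ratio * cc i * (if i = 0 then 1 else gp (i - 1)))"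
proof -
  have tt: "tt S (2 * i) = (if i = 0 then 1 else gp (i - 1))" "tt S (2 * i + 1) = ratio * len i"
    using assms by (auto simp: tt_def res_gap_def res_len_def)
  have b: "beta S (2 * i + 1) = gm i / ratio" by (simp add: beta_def)
  define x where "x = gm i * len i / 2"
  have x: "beta S (2 * i + 1) * tt S (2 * i + 1) / 2 = x" "- beta S (2 * i + 1) * tt S (2 * i + 1) / 2 = - x"
    unfolding b tt x_def using ratio_pos by simp_all
  have c: "cc i = (1 - exp (- (2 * x))) / gm i" "ee i = exp (- (2 * x))" by (simp_all add: cc_def ee_def x_def)
  have "x \<noteq> 0" using gm_nonzero[OF assms] lf_less_rg[OF assms] by (simp add: x_def)
  have sh: "2 * sinh x = exp x * (1 - exp (- (2 * x)))" "exp (- x) = exp x * exp (- (2 * x))"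
    by (simp_all add: sinh_field_def right_diff_distrib flip: exp_add)
  have "theta S (2 * i) = beta S (2 * i + 1) * exp (- beta S (2 * i + 1) * tt S (2 * i + 1) / 2)
      / (2 * sinh (beta S (2 * i + 1) * tt S (2 * i + 1) / 2) * tt S (2 * i))"
    by (simp add: theta_def)
  also have "\<dots> = (gm i / ratio) * exp (- x) / (2 * sinh x * tt S (2 * i))"
    unfolding x unfolding b ..
  also have "\<dots> = ee i / (ratio * cc i * (if i = 0 then 1 else gp (i - 1)))"
    unfolding tt c sh using gm_nonzero[OF assms] \<open>x \<noteq> 0\<close> by (simp add: divide_simps)
  finally show ?thesis .
qed

text \<open>Written with differences of neighbours because the rows of the capacitance matrix sum to
  zero.\<close>

definition row :: "(nat \<Rightarrow> real) \<Rightarrow> nat \<Rightarrow> real" where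
  "row a i = (if 0 < i then theta S (2 * i) * (a i - a (i - 1)) else 0)
     + (if Suc i < N then theta S (2 * i + 1) * (a i - a (Suc i)) else 0)"

lemma tridiagonal_sum:
  fixes f g h :: "nat \<Rightarrow> real"
  assumes "i < n"
  shows "(\<Sum>j = 0..<n. (if j = i then f j else if j = i + 1 then g j else if j + 1 = i then h j else 0))
    = f i + (if Suc i < n then g (Suc i) else 0) + (if 0 < i then h (i - 1) else 0)"
proof -
  have "(\<Sum>j = 0..<n. (if j = i then f j else if j = i + 1 then g j else if j + 1 = i then h j else 0))
    = (\<Sum>j = 0..<n. (if j = i then f j else 0) + (if j = Suc i then g j else 0)
        + (if j = i - 1 then (if 0 < i then h j else 0) else 0))"
    by (rule sum.cong) auto
  also have "\<dots> = f i + (if Suc i < n then g (Suc i) else 0) + (if 0 < i then h (i - 1) else 0)"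
    using assms unfolding sum.distrib by (auto simp: sum.delta)
  finally show ?thesis .
qed

lemma cap_mat_row:
  assumes "a \<in> carrier_vec N" "i < N"
  shows "vec_index (cap_mat S *\<^sub>v a) i = row (vec_index a) i"
proof -
  have "vec_index (cap_mat S *\<^sub>v a) i = (\<Sum>j = 0..<N. (if j = i then ((if 0 < i then theta S (2 * i) else 0)
         + (if i + 1 < N then theta S (2 * i + 1) else 0)) * vec_index a j
       else if j = i + 1 then - theta S (2 * i + 1) * vec_index a j
       else if j + 1 = i then - theta S (2 * i) * vec_index a j else 0))"
    using assms by (auto simp: cap_mat_def scalar_prod_def intro!: sum.cong)
  also have "\<dots> = row (vec_index a) i"
    unfolding tridiagonal_sum[OF assms(2)] by (auto simp: row_def algebra_simps)
  finally show ?thesis .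
qed

text \<open>The off-diagonal entries satisfy mm_j theta_{2j+1} = mm_{j+1} theta_{2j+2}, so diag(mm)
  times the matrix is symmetric. Therefore the transpose acts on b as the matrix itself acts on b /
  mm.\<close>

lemma cap_mat_transpose_row:
  assumes "b \<in> carrier_vec N" "i < N"
  shows "vec_index (transpose_mat (cap_mat S) *\<^sub>v b) i = mm i * row (\<lambda>j. vec_index b j / mm j) i"
proof -
  have m: "mm j * theta S (2 * j + 1) = mm (Suc j) * theta S (2 * Suc j)" if "Suc j < N" for j
  proof -
    have "cc j \<noteq> 0" "cc (Suc j) \<noteq> 0" using that cc_pos[of j] cc_pos[of "Suc j"] by auto
    then have "mm j * theta S (2 * j + 1) = pp (Suc j) / (ratio * gp j)"
      "mm (Suc j) * theta S (2 * Suc j) = pp (Suc (Suc j)) * ee (Suc j) / (ratio * gp j)"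
      unfolding theta_odd[OF Suc_lessD[OF that]] theta_even[OF that] mm_def using that
      by simp_all
    then show ?thesis unfolding pp_Suc by simp
  qed
  have mp: "mm j \<noteq> 0" if "j < N" for j using mm_pos[OF that] by simp
  define y where "y j = vec_index b j / mm j" for j
  have bi: "vec_index b i = mm i * y i" using mp[OF assms(2)] by (simp add: y_def)
  have "vec_index (transpose_mat (cap_mat S) *\<^sub>v b) i = (\<Sum>j = 0..<N. (if j = i then ((if 0 < i then theta S (2 * i) else 0)
         + (if i + 1 < N then theta S (2 * i + 1) else 0)) * vec_index b j
       else if j = i + 1 then - theta S (2 * Suc i) * vec_index b j
       else if j + 1 = i then - theta S (2 * j + 1) * vec_index b j else 0))"
    using assms by (auto simp: cap_mat_def scalar_prod_def intro!: sum.cong)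
  also have "\<dots> = ((if 0 < i then theta S (2 * i) else 0)
         + (if i + 1 < N then theta S (2 * i + 1) else 0)) * vec_index b i
       - (if Suc i < N then theta S (2 * Suc i) * vec_index b (Suc i) else 0)
       - (if 0 < i then theta S (2 * (i - 1) + 1) * vec_index b (i - 1) else 0)"
    unfolding tridiagonal_sum[OF assms(2)] by auto
  also have "(if Suc i < N then theta S (2 * Suc i) * vec_index b (Suc i) else 0)
      = (if Suc i < N then mm i * theta S (2 * i + 1) * (vec_index b (Suc i) / mm (Suc i)) else 0)"
    using m[of i] mp[of "Suc i"] by (auto simp: field_simps)
  also have "(if 0 < i then theta S (2 * (i - 1) + 1) * vec_index b (i - 1) else 0)
      = (if 0 < i then mm i * theta S (2 * i) * (vec_index b (i - 1) / mm (i - 1)) else 0)"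
    using m[of "i - 1"] mp[of "i - 1"] assms(2) by (cases i) (auto simp: field_simps)
  finally show ?thesis
    unfolding y_def[symmetric] bi by (auto simp: row_def algebra_simps split: if_splits)
qed

text \<open>The matrix equation is the unperturbed recursion with \<open>\<mu> = v * vb * l\<close> and vanishing final
  flux.\<close>

lemma row_eq_iff:
  assumes "i < N"
  shows "row a i = l * a i \<longleftrightarrow>
    (if Suc i < N then (a (Suc i) - a i) / gp i else 0)
      = ee i * (if 0 < i then (a i - a (i - 1)) / gp (i - 1) else 0) - v * vb * l * cc i * a i / vb\<^sup>2"
proof -
  have c: "cc i > 0" using cc_pos[OF assms] .
  define X where "X = (if Suc i < N then (a (Suc i) - a i) / gp i else 0)"
  define Y where "Y = (if 0 < i then (a i - a (i - 1)) / gp (i - 1) else 0)"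
  have "row a i = (ee i * Y - X) / (ratio * cc i)"
    unfolding row_def theta_odd[OF assms] theta_even[OF assms] X_def Y_def using assms
    by (auto simp: diff_divide_distrib right_diff_distrib mult.commute)
  moreover have "l * a i * (ratio * cc i) = v * vb * l * cc i * a i / vb\<^sup>2"
    using ratio_vb vb_pos by (simp add: field_simps)
  moreover have "ratio * cc i \<noteq> 0" using c ratio_pos by simp
  ultimately have "row a i = l * a i \<longleftrightarrow> ee i * Y - X = v * vb * l * cc i * a i / vb\<^sup>2"
    by (metis nonzero_divide_eq_eq)
  then show ?thesis unfolding X_def[symmetric] Y_def[symmetric] by auto
qed

text \<open>The first row starts the recursion and each later row advances it, so everything is
  determined by a 0. The convention 0 in the last cell encodes the vanishing final flux.\<close>

lemma row_imp_recursion: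
  assumes row: "\<And>i. i < N \<Longrightarrow> row a i = l * a i"
  defines "\<mu> \<equiv> of_real (v * vb * l)"
  shows "i < N \<Longrightarrow> of_real (a i) = of_real (a 0) * U \<mu> i"
    and "i < N \<Longrightarrow> of_real (if Suc i < N then (a (Suc i) - a i) / gp i else 0) = of_real (a 0) * (\<mu> * Q \<mu> i)"
proof -
  define D where "D i = (if Suc i < N then (a (Suc i) - a i) / gp i else 0)" for i
  have D0: "D 0 = - v * vb * l * cc 0 * a 0 / vb\<^sup>2"
    using row[OF N_pos] unfolding row_eq_iff[OF N_pos] D_def by simp
  have DS: "D (Suc i) = ee (Suc i) * D i - v * vb * l * cc (Suc i) * a (Suc i) / vb\<^sup>2" if "Suc i < N" for i
    using row[OF that] unfolding row_eq_iff[OF that] D_def using that by simp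
  have aS: "a (Suc i) = a i + gp i * D i" if "Suc i < N" for i
    using rg_less_lf[OF that] that by (simp add: D_def)
  have "of_real (a i) = of_real (a 0) * U \<mu> i \<and> of_real (D i) = of_real (a 0) * (\<mu> * Q \<mu> i)" if "i < N" for i
    using that
  proof (induction i)
    case 0
    then show ?case by (simp add: D0 unperturbed_right \<mu>_def)
  next
    case (Suc i)
    then have IH: "of_real (a i) = of_real (a 0) * U \<mu> i" "of_real (D i) = of_real (a 0) * (\<mu> * Q \<mu> i)" by auto
    have 1: "of_real (a (Suc i)) = of_real (a 0) * U \<mu> (Suc i)"
      unfolding aS[OF Suc.prems] of_real_add of_real_mult IH
      using Suc.prems by (simp add: unperturbed_Suc algebra_simps)
    have "of_real (D (Suc i)) = of_real (ee (Suc i)) * of_real (D i) - \<mu> * of_real (cc (Suc i)) * of_real (a (Suc i)) / of_real (vb\<^sup>2)"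
      unfolding DS[OF Suc.prems] \<mu>_def by simp
    also have "\<dots> = of_real (a 0) * (\<mu> * Q \<mu> (Suc i))"
      unfolding IH 1 using Suc.prems
      by (simp add: unperturbed_right(3) unperturbed_Suc(3)[OF Suc_lessD[OF Suc.prems]] algebra_simps)
    finally show ?case using 1 by blast
  qed
  then show "i < N \<Longrightarrow> of_real (a i) = of_real (a 0) * U \<mu> i"
    "i < N \<Longrightarrow> of_real (if Suc i < N then (a (Suc i) - a i) / gp i else 0) = of_real (a 0) * (\<mu> * Q \<mu> i)"
    unfolding D_def by blast+
qed

lemma recursion_imp_row:
  assumes fin: "of_real (v * vb * l) * Q (of_real (v * vb * l)) (N - 1) = 0" and i: "i < N"
  shows "row (\<lambda>i. Re (U (of_real (v * vb * l)) i)) i = l * Re (U (of_real (v * vb * l)) i)"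
proof -
  define \<mu> where "\<mu> = v * vb * l"
  define a where "a i = Re (U (of_real \<mu>) i)" for i
  have D: "(if Suc i < N then (a (Suc i) - a i) / gp i else 0) = \<mu> * Re (Q (of_real \<mu>) i)" if "i < N" for i
  proof (cases "Suc i < N")
    case True
    then show ?thesis using rg_less_lf[OF True] that by (simp add: a_def unperturbed_Suc)
  next
    case False
    then have "i = N - 1" using that by simp
    then show ?thesis using fin False unfolding \<mu>_def by (auto simp: simp flip: of_real_mult)
  qed
  have h: "Re (Q (of_real \<mu>) i) = ee i * (if 0 < i then Re (Q (of_real \<mu>) (i - 1)) else 0) - cc i * a i / vb\<^sup>2"
    using i by (cases i) (simp_all add: unperturbed_right(3) unperturbed_Suc(3) a_def del: of_real_power)
  have "\<mu> * Re (Q (of_real \<mu>) i)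
      = ee i * (if 0 < i then \<mu> * Re (Q (of_real \<mu>) (i - 1)) else 0) - \<mu> * cc i * a i / vb\<^sup>2"
    by (subst h) (simp add: algebra_simps)
  moreover have "(if 0 < i then \<mu> * Re (Q (of_real \<mu>) (i - 1)) else 0)
      = (if 0 < i then (a i - a (i - 1)) / gp (i - 1) else 0)"
    using D[of "i - 1"] i by auto
  ultimately show ?thesis
    using D[OF i] unfolding row_eq_iff[OF i] \<mu>_def[symmetric] a_def[symmetric] by simp
qed

text \<open>An eigenvector is its first entry times the recursion, so that entry cannot vanish. It
  serves as the normalization of the modes.\<close>

lemma eigenvector_shape:
  assumes "eigenvector (cap_mat S) a l"
  shows "vec_index a 0 \<noteq> 0"
    "i < N \<Longrightarrow> of_real (vec_index a i) = of_real (vec_index a 0) * U (of_real (v * vb * l)) i"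
    "Suc i < N \<Longrightarrow> of_real ((vec_index a (Suc i) - vec_index a i) / gp i)
       = of_real (vec_index a 0) * (of_real (v * vb * l) * Q (of_real (v * vb * l)) i)"
    "of_real (v * vb * l) * Q (of_real (v * vb * l)) (N - 1) = 0"
proof -
  have a: "a \<in> carrier_vec N" "a \<noteq> 0\<^sub>v N" "cap_mat S *\<^sub>v a = l \<cdot>\<^sub>v a"
    using assms by (auto simp: eigenvector_def cap_mat_def)
  have row: "row (vec_index a) i = l * vec_index a i" if "i < N" for i
    using cap_mat_row[OF a(1) that] a that by simp
  note r = row_imp_recursion[of "vec_index a" l, OF row]
  show 1: "i < N \<Longrightarrow> of_real (vec_index a i) = of_real (vec_index a 0) * U (of_real (v * vb * l)) i" for i
    by (rule r(1))
  show 0: "vec_index a 0 \<noteq> 0"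
  proof
    assume "vec_index a 0 = 0"
    then have "vec_index a i = 0" if "i < N" for i using 1[OF that] by simp
    then have "a = 0\<^sub>v N" using a(1) by (intro eq_vecI) auto
    with a(2) show False by simp
  qed
  show "Suc i < N \<Longrightarrow> of_real ((vec_index a (Suc i) - vec_index a i) / gp i)
       = of_real (vec_index a 0) * (of_real (v * vb * l) * Q (of_real (v * vb * l)) i)"
    using r(2)[of i] by simp
  show "of_real (v * vb * l) * Q (of_real (v * vb * l)) (N - 1) = 0"
    using r(2)[of "N - 1"] N_pos 0 by simp
qed

lemma left_eigenvector_shape:
  assumes "eigenvector (transpose_mat (cap_mat S)) b l"
  shows "vec_index b 0 \<noteq> 0"
    "i < N \<Longrightarrow> of_real (vec_index b i) = of_real (vec_index b 0 / mm 0) * of_real (mm i) * U (of_real (v * vb * l)) i"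
proof -
  have b: "b \<in> carrier_vec N" "b \<noteq> 0\<^sub>v N" "transpose_mat (cap_mat S) *\<^sub>v b = l \<cdot>\<^sub>v b"
    using assms by (auto simp: eigenvector_def cap_mat_def)
  define a where "a i = vec_index b i / mm i" for i
  have ab: "vec_index b i = mm i * a i" if "i < N" for i
    using mm_pos[OF that] by (simp add: a_def)
  have row: "row a i = l * a i" if "i < N" for i
  proof -
    have "mm i * row a i = vec_index (l \<cdot>\<^sub>v b) i"
      using cap_mat_transpose_row[OF b(1) that] unfolding b(3) a_def[abs_def] by simp
    also have "\<dots> = mm i * (l * a i)" using b(1) that by (simp add: ab)
    finally show ?thesis using mm_pos[OF that] by simp
  qed
  have 1: "of_real (a i) = of_real (a 0) * U (of_real (v * vb * l)) i" if "i < N" for i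
    using row_imp_recursion(1)[of a l, OF row that] .
  show "i < N \<Longrightarrow> of_real (vec_index b i) = of_real (vec_index b 0 / mm 0) * of_real (mm i) * U (of_real (v * vb * l)) i"
    using 1[of i] unfolding ab a_def[of 0] by simp
  show "vec_index b 0 \<noteq> 0"
  proof
    assume "vec_index b 0 = 0"
    then have "a i = 0" if "i < N" for i using 1[OF that] by (simp add: a_def)
    then have "b = 0\<^sub>v N" using b(1) ab by (intro eq_vecI) auto
    with b(2) show False by simp
  qed
qed

lemma eigenvalue_iff:
  "eigenvalue (cap_mat S) l \<longleftrightarrow> of_real (v * vb * l) * Q (of_real (v * vb * l)) (N - 1) = 0"
proof
  assume "eigenvalue (cap_mat S) l"
  then show "of_real (v * vb * l) * Q (of_real (v * vb * l)) (N - 1) = 0"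
    unfolding eigenvalue_def using eigenvector_shape(4) by blast
next
  assume fin: "of_real (v * vb * l) * Q (of_real (v * vb * l)) (N - 1) = 0"
  define a where "a = vec N (\<lambda>i. Re (U (of_real (v * vb * l)) i))"
  have a: "a \<in> carrier_vec N" by (simp add: a_def)
  have "cap_mat S *\<^sub>v a = l \<cdot>\<^sub>v a"
  proof (rule eq_vecI)
    fix i assume "i < dim_vec (l \<cdot>\<^sub>v a)"
    then have i: "i < N" using a by simp
    have "row (vec_index a) i = row (\<lambda>i. Re (U (of_real (v * vb * l)) i)) i"
      using i by (auto simp: row_def a_def)
    then show "vec_index (cap_mat S *\<^sub>v a) i = vec_index (l \<cdot>\<^sub>v a) i"
      unfolding cap_mat_row[OF a i] using recursion_imp_row[OF fin i] i by (simp add: a_def)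
  qed (simp add: a_def cap_mat_def)
  moreover have "a \<noteq> 0\<^sub>v N"
  proof
    assume "a = 0\<^sub>v N"
    then have "vec_index a 0 = 0" using N_pos by simp
    then show False using N_pos by (simp add: a_def)
  qed
  ultimately have "eigenvector (cap_mat S) a l"
    using a by (simp add: eigenvector_def cap_mat_def)
  then show "eigenvalue (cap_mat S) l" unfolding eigenvalue_def by blast
qed

lemma eigenvalue_cases:
  "eigenvalue (cap_mat S) l \<longleftrightarrow> l = 0 \<or> of_real (v * vb * l) \<in> roots"
  using eigenvalue_iff[of l] v_pos vb_pos by (simp add: roots_def)

end

section \<open>Selection of a branch on a connected set, and the square root on the cut
  plane\<close>

text \<open>Each coincidence set is closed, and since the branches never meet its complement is a
  finite union of the others. So it is also open.\<close>

lemma connected_finite_selection: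
  fixes f :: "'a::topological_space \<Rightarrow> 'b::real_normed_vector"
  assumes X: "connected X" "X \<noteq> {}" and f: "continuous_on X f"
    and I: "finite I" "\<And>b. b \<in> I \<Longrightarrow> continuous_on X (h b)"
    and cover: "\<And>x. x \<in> X \<Longrightarrow> \<exists>b\<in>I. f x = h b x"
    and distinct: "\<And>x b b'. x \<in> X \<Longrightarrow> b \<in> I \<Longrightarrow> b' \<in> I \<Longrightarrow> b \<noteq> b' \<Longrightarrow> h b x \<noteq> h b' x"
  obtains b where "b \<in> I" "\<And>x. x \<in> X \<Longrightarrow> f x = h b x"
proof -
  define A where "A b = {x \<in> X. f x = h b x}" for b
  have closed: "closedin (top_of_set X) (A b)" if "b \<in> I" for b
    using continuous_closedin_preimage_constant[OF continuous_on_diff[OF f I(2)[OF that]], of 0]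
    by (simp add: A_def)
  obtain x0 b where b: "x0 \<in> X" "b \<in> I" "f x0 = h b x0" using X cover by blast
  have "X - A b = (\<Union>b'\<in>I - {b}. A b')"
    using cover distinct[OF _ b(2)] b(2) by (fastforce simp: A_def)
  moreover have "closedin (top_of_set X) (\<Union>b'\<in>I - {b}. A b')"
    using I closed by (intro closedin_Union) auto
  ultimately have "openin (top_of_set X) (A b)"
    using openin_diff[of "top_of_set X" X "X - A b"] closedin_imp_subset[OF closed[OF b(2)]]
    by (metis double_diff openin_subtopology_self subset_refl)
  then have "A b = {} \<or> A b = X"
    using X(1) closed[OF b(2)] unfolding connected_clopen by blast
  then have "A b = X" using b by (auto simp: A_def)
  then show thesis using that b(2) by (auto simp: A_def)
qed

lemma sqrt_up_norm: "norm (sqrt_up z) = sqrt (norm z)"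
  using arg_cong[OF sqrt_up_square[of z], of norm] by (metis norm_ge_zero norm_power real_sqrt_unique)

lemma sqrt_up_nonzero [simp]: "sqrt_up z = 0 \<longleftrightarrow> z = 0"
  using sqrt_up_square[of z] by (auto simp flip: power_eq_0_iff[of _ 2])

lemma filterlim_sqrt_up: "filterlim sqrt_up (at 0) (at 0)"
proof -
  have "((\<lambda>z::complex. sqrt (norm z)) \<longlongrightarrow> sqrt (norm (0::complex))) (at 0)"
    by (intro tendsto_intros)
  then have "((\<lambda>z. norm (sqrt_up z)) \<longlongrightarrow> 0) (at 0)"
    by (simp add: sqrt_up_norm)
  then have "(sqrt_up \<longlongrightarrow> 0) (at 0)" by (rule tendsto_norm_zero_cancel)
  then show ?thesis
    by (auto simp: filterlim_at eventually_at_filter)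
qed

lemma sqrt_up_unique:
  assumes "w\<^sup>2 = z" "0 < Im w \<or> Im w = 0 \<and> 0 \<le> Re w"
  shows "sqrt_up z = w"
proof -
  have "sqrt_up z = w \<or> sqrt_up z = - w"
    using sqrt_up_square[of z] assms(1) by (metis power2_eq_iff)
  moreover have "0 \<le> Im (sqrt_up z)"
    by (auto simp: sqrt_up_def)
  moreover have "sqrt_up z = w" if "sqrt_up z = - w" "Im w = 0" "0 \<le> Re w"
  proof -
    have "w = of_real (Re w)" using that by (simp add: complex_eq_iff)
    then have "sqrt_up z = w"
      using assms(1) sqrt_up_of_nonneg[of "(Re w)\<^sup>2"] that(3)
      by (metis of_real_power real_sqrt_unique sqrt_up_of_nonneg zero_le_power2)
    then show ?thesis .
  qed
  ultimately show ?thesis using assms(2) by auto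
qed

text \<open>For angles in [0, 2 pi) the half angle lies in [0, pi), so the imaginary part is
  nonnegative and angle 0 gives the positive root.\<close>

lemma sqrt_up_polar:
  assumes "0 < \<rho>" "0 \<le> \<phi>" "\<phi> < 2 * pi"
  shows "sqrt_up (of_real \<rho> * cis \<phi>) = of_real (sqrt \<rho>) * cis (\<phi> / 2)"
proof (rule sqrt_up_unique)
  show "(of_real (sqrt \<rho>) * cis (\<phi> / 2))\<^sup>2 = of_real \<rho> * cis \<phi>"
  proof -
    have "(cis (\<phi> / 2))\<^sup>2 = cis \<phi>" by (simp add: power2_eq_square cis_mult)
    then show ?thesis using assms(1) by (simp add: power_mult_distrib flip: of_real_power)
  qed
  show "0 < Im (of_real (sqrt \<rho>) * cis (\<phi> / 2)) \<or>
    Im (of_real (sqrt \<rho>) * cis (\<phi> / 2)) = 0 \<and> 0 \<le> Re (of_real (sqrt \<rho>) * cis (\<phi> / 2))"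
    using assms sin_gt_zero[of "\<phi> / 2"] by (cases "\<phi> = 0") auto
qed

text \<open>Scaling by a nonnegative real never leads across the cut; this extracts the eigenvalue
  from the root of lambda * delta / r.\<close>

lemma sqrt_up_mult_nonneg:
  assumes "0 \<le> x"
  shows "sqrt_up (of_real x * z) = of_real (sqrt x) * sqrt_up z"
proof -
  have "0 < Im (sqrt_up z) \<or> Im (sqrt_up z) = 0 \<and> 0 \<le> Re (sqrt_up z)"
  proof (cases "z \<in> \<real>\<^sub>\<ge>\<^sub>0")
    case True
    then show ?thesis by (auto simp: nonneg_Reals_def sqrt_up_of_nonneg)
  qed (simp add: sqrt_up_Im_pos)
  then show ?thesis
    using assms by (cases "x = 0", simp add: sqrt_up_of_nonneg[of 0, simplified], intro sqrt_up_unique)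
      (auto simp: power_mult_distrib sqrt_up_square mult_nonneg_nonneg zero_less_mult_iff simp flip: of_real_power)
qed

context resonators
begin

subsection \<open>The characteristic function in two scalings\<close>

text \<open>In the scaling w = e z, d = e^2, n = z^2 the radiation defect at the right end is z
  times this function.\<close>

definition Hf :: "complex \<Rightarrow> complex \<Rightarrow> complex" where
  "Hf z e = e * (aR (e * z) (e\<^sup>2) 1 (z\<^sup>2) (N - 1) - \<i> / of_real v * uR (e * z) (e\<^sup>2) 1 (z\<^sup>2) (N - 1))
     + z * bR (e * z) (e\<^sup>2) 1 (z\<^sup>2) (N - 1)"

text \<open>The radiation defect for w = d x and n = d x^2, divided by d x. Only d itself occurs, so
  a root depending holomorphically on d gives a frequency analytic in the contrast.\<close>

definition Kf :: "complex \<Rightarrow> complex \<Rightarrow> complex" where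
  "Kf x d = aR (d * x) d 1 (d * x\<^sup>2) (N - 1) - \<i> / of_real v * uR (d * x) d 1 (d * x\<^sup>2) (N - 1)
     + x * bR (d * x) d 1 (d * x\<^sup>2) (N - 1)"

lemma resonant_Hf:
  assumes "e \<noteq> 0"
  shows "resonant_frequency S (e\<^sup>2) (e * z) \<longleftrightarrow> z = 0 \<or> Hf z e = 0"
proof -
  have "(e * z)\<^sup>2 / e\<^sup>2 = z\<^sup>2" using assms by (simp add: power_mult_distrib)
  then have "GR (e * z) (e\<^sup>2) (N - 1) - \<i> * (e * z) / of_real v * UR (e * z) (e\<^sup>2) (N - 1) = z * Hf z e"
    by (simp add: FR_def Hf_def algebra_simps power2_eq_square)
  then show ?thesis using assms by (subst resonant_frequency_iff) auto
qed

lemma resonant_Kf: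
  assumes "d \<noteq> 0"
  shows "resonant_frequency S d (d * x) \<longleftrightarrow> x = 0 \<or> Kf x d = 0"
proof -
  have "(d * x)\<^sup>2 / d = d * x\<^sup>2" using assms by (simp add: power2_eq_square)
  then have "GR (d * x) d (N - 1) - \<i> * (d * x) / of_real v * UR (d * x) d (N - 1) = d * x * Kf x d"
    by (simp add: FR_def Kf_def algebra_simps power2_eq_square)
  then show ?thesis using assms by (subst resonant_frequency_iff) auto
qed

lemma Hf_holomorphic:
  assumes "f holomorphic_on X" "h holomorphic_on X"
  shows "(\<lambda>t. Hf (f t) (h t)) holomorphic_on X"
  unfolding Hf_def using v_pos by (intro holomorphic_intros holomorphic_right assms) auto

lemma Kf_holomorphic:
  assumes "f holomorphic_on X" "h holomorphic_on X"
  shows "(\<lambda>t. Kf (f t) (h t)) holomorphic_on X"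
  unfolding Kf_def using v_pos by (intro holomorphic_intros holomorphic_right assms) auto

lemma Hf_continuous: "continuous_on UNIV (\<lambda>(z, e). Hf z e)"
  unfolding Hf_def case_prod_unfold using v_pos by (intro continuous_intros continuous_right) auto

lemma Kf_continuous: "continuous_on UNIV (\<lambda>(z, e). Kf z e)"
  unfolding Kf_def case_prod_unfold using v_pos by (intro continuous_intros continuous_right) auto

text \<open>The possible limits of w / e along nontrivial branches. Here 0 belongs to the first
  eigenfrequency; the trivial frequency is the factor removed from the characteristic
  equation.\<close>

definition Z :: "complex set" where "Z = insert 0 {z. z\<^sup>2 \<in> roots}"

lemma Hf_0: "Hf z 0 = z * Q (z\<^sup>2) (N - 1)"
  by (simp add: Hf_def)

lemma Hf_0_iff: "Hf z 0 = 0 \<longleftrightarrow> z \<in> Z"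
  by (auto simp: Hf_0 Z_def roots_def)

lemma zero_notin_roots: "0 \<notin> roots"
  using roots_real_pos(2)[of 0] by auto

text \<open>The derivative of z Q(z^2) is Q(z0^2) + 2 z0^2 Q'(z0^2). At z0 = 0 the first term
  survives, elsewhere the second, since the roots of Q are positive and simple.\<close>

lemma Hf_branch:
  assumes "z0 \<in> Z"
  obtains g \<rho> \<eta> where "0 < \<rho>" "0 < \<eta>" "g holomorphic_on ball 0 \<rho>" "g 0 = z0"
    "\<And>e. norm e < \<rho> \<Longrightarrow> Hf (g e) e = 0"
    "\<And>e z. norm e < \<rho> \<Longrightarrow> norm (z - z0) < \<eta> \<Longrightarrow> Hf z e = 0 \<Longrightarrow> z = g e"
proof -
  define h where "h = Q (z0\<^sup>2) (N - 1) + z0 * (poly (pderiv qpoly) (z0\<^sup>2) * (2 * z0))"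
  have "((\<lambda>z. Q (z\<^sup>2) (N - 1)) has_field_derivative poly (pderiv qpoly) (z0\<^sup>2) * (2 * z0)) (at z0)"
    by (rule DERIV_chain2[OF Q_deriv]) (auto intro!: derivative_eq_intros)
  then have "((\<lambda>z. Hf z 0) has_field_derivative h) (at z0)"
    unfolding Hf_0 h_def by (auto intro!: derivative_eq_intros)
  moreover have "h \<noteq> 0"
  proof (cases "z0 = 0")
    case True
    then show ?thesis using zero_notin_roots by (simp add: h_def roots_def)
  next
    case False
    then have "z0\<^sup>2 \<in> roots" using assms by (simp add: Z_def)
    then show ?thesis using False roots_simple[of "z0\<^sup>2"] by (simp add: h_def roots_def)
  qed
  moreover have "Hf z0 0 = 0" using assms by (simp add: Hf_0_iff)
  ultimately show thesis
    by - (rule holomorphic_implicit_function[of Hf z0 h, OF Hf_continuous],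
      rule Hf_holomorphic, assumption, rule holomorphic_on_ident,
      rule Hf_holomorphic, rule holomorphic_on_ident, rule holomorphic_on_const,
      assumption+, rule that, assumption+)
qed

lemma prod_ee: "(\<Prod>j<n. ee j) = 1 / pp n"
proof (induction n)
  case (Suc n)
  have "ee n = pp n / pp (Suc n)" using pp_Suc[of n] pp_pos[of "Suc n"] by (simp add: field_simps)
  with Suc show ?case using pp_pos[of n] by simp
qed simp

text \<open>At n = 0 the mode is constant, the incoming flux is damped by 1 / pp, and each resonator
  contributes its mass to the B-part. These are the coefficients of \<open>Kf\<close> at d =
  0.\<close>

lemma first_order_state:
  assumes "i < N"
  shows "U 0 i = 1" "aR 0 0 1 0 i = - \<i> / of_real v / of_real (pp (Suc i))"
    "Q 0 i = - of_real ((\<Sum>j\<le>i. mm j) / pp (Suc i) / vb\<^sup>2)"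
proof -
  have *: "U 0 i = 1 \<and> aL 0 0 1 0 i = - \<i> / of_real v / of_real (pp i)
    \<and> bL 0 0 1 0 i = - of_real ((\<Sum>j<i. mm j) / pp i / vb\<^sup>2)
    \<and> aR 0 0 1 0 i = - \<i> / of_real v / of_real (pp (Suc i))
    \<and> Q 0 i = - of_real ((\<Sum>j\<le>i. mm j) / pp (Suc i) / vb\<^sup>2)" if "i < N" for i
    using that
  proof (induction i)
    case 0
    have "ee 0 = 1 / pp (Suc 0)" "mm 0 / pp (Suc 0) = cc 0"
      using prod_ee[of "Suc 0"] pp_pos[of "Suc 0"] by (simp_all add: mm_def)
    then show ?case using N_pos by (simp add: unperturbed_right)
  next
    case (Suc i)
    let ?i = "Suc i"
    have e: "ee ?i = pp ?i / pp (Suc ?i)" "cc ?i = mm ?i / pp (Suc ?i)"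
      using pp_Suc[of ?i] pp_pos[of "Suc ?i"] by (simp_all add: mm_def field_simps)
    have "pp ?i \<noteq> 0" using pp_pos[of ?i] by simp
    moreover have "U 0 ?i = 1 \<and> aL 0 0 1 0 ?i = - \<i> / of_real v / of_real (pp ?i)
       \<and> bL 0 0 1 0 ?i = - of_real ((\<Sum>j<?i. mm j) / pp ?i / vb\<^sup>2)"
      using Suc by (simp add: unperturbed_Suc unperturbed_right(1) lessThan_Suc_atMost)
    ultimately show ?case
      using Suc.prems pp_pos[of "Suc ?i"] vb_pos
      by (simp add: unperturbed_right e lessThan_Suc_atMost[symmetric]) (simp add: field_simps)
  qed
  show "U 0 i = 1" "aR 0 0 1 0 i = - \<i> / of_real v / of_real (pp (Suc i))"
    "Q 0 i = - of_real ((\<Sum>j\<le>i. mm j) / pp (Suc i) / vb\<^sup>2)"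
    using *[OF assms] by blast+
qed

lemma sum_mm_pos: "0 < (\<Sum>j<N. mm j)"
  using weighted_sum_pos[of "\<lambda>_. 1"] by simp

text \<open>The unique zero of the affine function x |-> \<open>Kf x 0\<close>; it equals the
  coefficient claimed for the first eigenfrequency.\<close>

definition w1 :: complex where
  "w1 = - \<i> * of_real (vb\<^sup>2 * (pp N + 1) / (v * (\<Sum>j<N. mm j)))"

lemma w1_nonzero: "w1 \<noteq> 0"
proof -
  have "pp N + 1 > 0" using pp_pos[of N] by simp
  then show ?thesis using v_pos vb_pos sum_mm_pos by (simp add: w1_def del: of_real_mult of_real_divide of_real_power)
qed

lemma Kf_0: "Kf x 0 = (- \<i> / of_real v) * (1 / of_real (pp N) + 1) - x * of_real ((\<Sum>j<N. mm j) / pp N / vb\<^sup>2)"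
proof -
  have "{..N - 1} = {..<N}" using N_pos by auto
  then show ?thesis
    using N_pos first_order_state[of "N - 1"] unperturbed_right(1)[of "N - 1" 1 0]
    by (simp add: Kf_def algebra_simps)
qed

lemma Kf_branch:
  obtains h \<rho> where "0 < \<rho>" "h holomorphic_on ball 0 \<rho>" "h 0 = w1"
    "\<And>d. norm d < \<rho> \<Longrightarrow> Kf (h d) d = 0"
proof -
  define k where "k = (- of_real ((\<Sum>j<N. mm j) / pp N / vb\<^sup>2) :: complex)"
  have "((\<lambda>x. Kf x 0) has_field_derivative k) (at w1)"
    unfolding Kf_0 k_def using pp_pos[of N] vb_pos by (auto intro!: derivative_eq_intros)
  moreover have "k \<noteq> 0" using sum_mm_pos pp_pos[of N] vb_pos by (simp add: k_def del: of_real_divide of_real_sum)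
  moreover have "Kf w1 0 = 0"
  proof -
    have "vb\<^sup>2 * (pp N + 1) / (v * (\<Sum>j<N. mm j)) * ((\<Sum>j<N. mm j) / pp N / vb\<^sup>2) - (1 / pp N + 1) / v = 0"
      using sum_mm_pos pp_pos[of N] v_pos vb_pos by (simp add: field_simps)
    moreover have "Kf w1 0 = \<i> * of_real (vb\<^sup>2 * (pp N + 1) / (v * (\<Sum>j<N. mm j))
        * ((\<Sum>j<N. mm j) / pp N / vb\<^sup>2) - (1 / pp N + 1) / v)"
      unfolding Kf_0 w1_def of_real_diff of_real_mult[of "vb\<^sup>2 * (pp N + 1) / (v * (\<Sum>j<N. mm j))"]
      using pp_pos[of N] vb_pos by (auto simp: algebra_simps add_divide_distrib)
    ultimately show ?thesis by simp
  qed
  ultimately show thesis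
    by - (rule holomorphic_implicit_function[of Kf w1 k, OF Kf_continuous],
      rule Kf_holomorphic, assumption, rule holomorphic_on_ident,
      rule Kf_holomorphic, rule holomorphic_on_ident, rule holomorphic_on_const,
      assumption+, rule that, assumption+)
qed

subsection \<open>Boundedness of the scaled frequencies\<close>

text \<open>Every resonator step of the rescaled system equals m times the step with n = 1 / m in
  the flux, and the following gap step restores a common power of m.\<close>

lemma state_rescale:
  assumes "m \<noteq> 0"
  shows "uL w d m 1 i = m ^ i * uL w d 1 (1 / m) i \<and> FL w d m 1 i = m ^ i * FL w d 1 (1 / m) i
    \<and> uR w d m 1 i = m ^ i * uR w d 1 (1 / m) i \<and> FR w d m 1 i = m ^ Suc i * FR w d 1 (1 / m) i"
proof (induction i)
  case 0
  then show ?case using assms by (simp add: state_right flux_right field_simps)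
next
  case (Suc i)
  then have "uL w d m 1 (Suc i) = m ^ Suc i * uL w d 1 (1 / m) (Suc i)"
    "FL w d m 1 (Suc i) = m ^ Suc i * FL w d 1 (1 / m) (Suc i)"
    by (simp_all add: state_Suc flux_Suc algebra_simps)
  then show ?case
    using assms by (simp add: state_right(1) flux_right) (simp add: field_simps)
qed

text \<open>With m = d / w^2 the rescaled equation is continuous at w = m = 0. There each cell
  multiplies the value by - gp * cc / vb^2, so the final flux is nonzero, and no small resonance has
  w^2 / d large.\<close>

lemma large_scaling_nonresonant:
  obtains \<eta> where "0 < \<eta>"
    "\<And>w m. norm w < \<eta> \<Longrightarrow> norm m < \<eta> \<Longrightarrow> w \<noteq> 0 \<Longrightarrow> m \<noteq> 0 \<Longrightarrow> \<not> resonant_frequency S (w\<^sup>2 * m) w"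
proof -
  define f where "f = (\<lambda>p. FR (fst p) ((fst p)\<^sup>2 * snd p) (snd p) 1 (N - 1)
     - snd p * \<i> * fst p / of_real v * uR (fst p) ((fst p)\<^sup>2 * snd p) (snd p) 1 (N - 1))"
  have "continuous_on UNIV f"
    unfolding f_def FR_def using v_pos by (intro continuous_intros continuous_right) auto
  then have cont: "isCont f (0, 0)" by (simp add: continuous_on_eq_continuous_at)
  have nz: "uL 0 0 0 1 i \<noteq> 0" if "i < N" for i
    using that
  proof (induction i)
    case (Suc i)
    then show ?case
      using cc_pos[of i] rg_less_lf[of i] vb_pos by (simp add: unperturbed_Suc unperturbed_right)
  qed simp
  have "f (0, 0) \<noteq> 0"
    using nz[of "N - 1"] cc_pos[of "N - 1"] N_pos vb_pos by (simp add: f_def unperturbed_right)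
  then have "\<forall>\<^sub>F p in at (0, 0). f p \<noteq> 0"
    using cont by (auto simp: isCont_def intro: tendsto_imp_eventually_ne)
  then obtain r where r: "0 < r" "\<And>p. p \<noteq> (0, 0) \<Longrightarrow> dist p (0, 0) < r \<Longrightarrow> f p \<noteq> 0"
    unfolding eventually_at by auto
  show thesis
  proof (rule that[of "r / 2"])
    fix w m :: complex assume wm: "norm w < r / 2" "norm m < r / 2" "w \<noteq> 0" "m \<noteq> 0"
    have "dist (w, m) (0, 0) \<le> norm w + norm m"
      using norm_Pair_le[of w m] by (simp add: dist_norm)
    then have "f (w, m) \<noteq> 0" using r(2)[of "(w, m)"] wm by simp
    moreover have "f (w, m) = m ^ N * (FR w (w\<^sup>2 * m) 1 (1 / m) (N - 1)
        - \<i> * w / of_real v * uR w (w\<^sup>2 * m) 1 (1 / m) (N - 1))"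
      using state_rescale[OF wm(4), of w "w\<^sup>2 * m" "N - 1"] N_pos
      by (simp add: f_def algebra_simps power_eq_if)
    ultimately show "\<not> resonant_frequency S (w\<^sup>2 * m) w"
      using wm by (subst resonant_frequency_iff) auto
  qed (use r in simp)
qed

lemma finite_square_roots: "finite R \<Longrightarrow> finite {z :: complex. z\<^sup>2 \<in> R}"
proof -
  assume "finite R"
  then have "finite (\<Union>x\<in>R. {csqrt x, - csqrt x})" by auto
  moreover have "{z :: complex. z\<^sup>2 \<in> R} \<subseteq> (\<Union>x\<in>R. {csqrt x, - csqrt x})"
    by (auto, metis power2_csqrt power2_eq_iff)
  ultimately show ?thesis by (rule rev_finite_subset)
qed

lemma finite_Z: "finite Z"
  unfolding Z_def using finite_square_roots[OF finite_roots] by simp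

text \<open>The zeros of \<open>Hf\<close> with z in the disc but away from all limit points, and
  with |e| <= 1, form a compact set. Its projection to e is closed and misses 0.\<close>

lemma branch_exclusion:
  assumes \<eta>: "\<And>z. z \<in> Z \<Longrightarrow> 0 < \<eta> z"
  obtains \<rho> where "0 < \<rho>" "\<And>z e. norm z \<le> R \<Longrightarrow> norm e < \<rho> \<Longrightarrow> Hf z e = 0 \<Longrightarrow> \<exists>z0\<in>Z. norm (z - z0) < \<eta> z0"
proof -
  define K where "K = cball 0 R - (\<Union>z\<in>Z. ball z (\<eta> z))"
  have "compact K" unfolding K_def by (intro compact_diff) auto
  then have "compact (K \<times> cball (0::complex) 1)" by (intro compact_Times) auto
  moreover define T where "T = {p \<in> K \<times> cball 0 1. (\<lambda>(z, e). Hf z e) p = 0}"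
  moreover have "closedin (top_of_set (K \<times> cball 0 1)) T"
    unfolding T_def by (rule continuous_closedin_preimage_constant[OF continuous_on_subset[OF Hf_continuous]]) auto
  ultimately have "compact T" using closedin_compact by blast
  then have "compact (snd ` T)" by (intro compact_continuous_image continuous_intros)
  then have "open (- snd ` T)" by (simp add: compact_imp_closed open_Compl)
  moreover have "0 \<in> - snd ` T"
    using \<eta> by (force simp: T_def K_def Hf_0_iff)
  ultimately obtain r where r: "0 < r" "ball 0 r \<subseteq> - snd ` T" by (meson open_contains_ball)
  show thesis
  proof (rule that[of "min r 1"])
    fix z e assume a: "norm z \<le> R" "norm e < min r 1" "Hf z e = 0"
    then have "e \<notin> snd ` T" using r by auto
    then have "z \<notin> K" using a by (force simp: T_def)
    then show "\<exists>z0\<in>Z. norm (z - z0) < \<eta> z0"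
      using a by (auto simp: K_def dist_norm norm_minus_commute)
  qed (use r in simp)
qed

end

section \<open>A complete system of frequency branches on one common disc\<close>

text \<open>Fixes one choice of branches for all later arguments. \<open>\<rho>\<close> bounds e and
  \<open>\<eta>\<close> bounds the unscaled frequency; \<open>g_h\<close> records that the branch at
  0 is e times a function of e^2, hence analytic in the contrast.\<close>

locale branch_data = resonators +
  fixes g :: "complex \<Rightarrow> complex \<Rightarrow> complex" and h :: "complex \<Rightarrow> complex" and \<rho> \<eta> :: real
  assumes \<rho>_pos: "0 < \<rho>" and \<eta>_pos: "0 < \<eta>"
    and g_holomorphic: "\<And>z. z \<in> Z \<Longrightarrow> g z holomorphic_on ball 0 \<rho>"
    and g_0: "\<And>z. z \<in> Z \<Longrightarrow> g z 0 = z"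
    and Hf_g: "\<And>z e. z \<in> Z \<Longrightarrow> norm e < \<rho> \<Longrightarrow> Hf (g z e) e = 0"
    and exhaustive: "\<And>e w. 0 < norm e \<Longrightarrow> norm e < \<rho> \<Longrightarrow> norm w < \<eta> \<Longrightarrow> resonant_frequency S (e\<^sup>2) w
       \<Longrightarrow> w = 0 \<or> (\<exists>z\<in>Z. w = e * g z e)"
    and g_nonzero: "\<And>e z. 0 < norm e \<Longrightarrow> norm e < \<rho> \<Longrightarrow> z \<in> Z \<Longrightarrow> g z e \<noteq> 0"
    and g_distinct: "\<And>e z z'. 0 < norm e \<Longrightarrow> norm e < \<rho> \<Longrightarrow> z \<in> Z \<Longrightarrow> z' \<in> Z \<Longrightarrow> z \<noteq> z' \<Longrightarrow> g z e \<noteq> g z' e"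
    and h_holomorphic: "h holomorphic_on ball 0 (\<rho>\<^sup>2)" and h_0: "h 0 = w1"
    and g_h: "\<And>e. norm e < \<rho> \<Longrightarrow> g 0 e = e * h (e\<^sup>2)"

context resonators
begin

lemma branches:
  obtains g h \<rho> \<eta> where "branch_data S g h \<rho> \<eta>"
proof -
  have "\<forall>z0\<in>Z. \<exists>p. case p of (g, \<rho>, \<eta>) \<Rightarrow> 0 < \<rho> \<and> 0 < \<eta> \<and> g holomorphic_on ball 0 \<rho> \<and> g 0 = z0
    \<and> (\<forall>e. norm e < \<rho> \<longrightarrow> Hf (g e) e = 0)
    \<and> (\<forall>e z. norm e < \<rho> \<longrightarrow> norm (z - z0) < \<eta> \<longrightarrow> Hf z e = 0 \<longrightarrow> z = g e)"
  proof
    fix z0 assume z0: "z0 \<in> Z"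
    obtain g \<rho> \<eta> where "0 < \<rho>" "0 < \<eta>" "g holomorphic_on ball 0 \<rho>" "g 0 = z0"
      "\<And>e. norm e < \<rho> \<Longrightarrow> Hf (g e) e = 0"
      "\<And>e z. norm e < \<rho> \<Longrightarrow> norm (z - z0) < \<eta> \<Longrightarrow> Hf z e = 0 \<Longrightarrow> z = g e"
      by (rule Hf_branch[OF z0]) blast
    then show "\<exists>p. case p of (g, \<rho>, \<eta>) \<Rightarrow> 0 < \<rho> \<and> 0 < \<eta> \<and> g holomorphic_on ball 0 \<rho> \<and> g 0 = z0
    \<and> (\<forall>e. norm e < \<rho> \<longrightarrow> Hf (g e) e = 0)
    \<and> (\<forall>e z. norm e < \<rho> \<longrightarrow> norm (z - z0) < \<eta> \<longrightarrow> Hf z e = 0 \<longrightarrow> z = g e)"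
      by (intro exI[of _ "(g, \<rho>, \<eta>)"]) auto
  qed
  from bchoice[OF this] obtain F where F: "\<forall>z0\<in>Z. (case F z0 of (g, \<rho>, \<eta>) \<Rightarrow> 0 < \<rho> \<and> 0 < \<eta> \<and> g holomorphic_on ball 0 \<rho> \<and> g 0 = z0
    \<and> (\<forall>e. norm e < \<rho> \<longrightarrow> Hf (g e) e = 0)
    \<and> (\<forall>e z. norm e < \<rho> \<longrightarrow> norm (z - z0) < \<eta> \<longrightarrow> Hf z e = 0 \<longrightarrow> z = g e))"
    ..
  define g where "g z = fst (F z)" for z
  define \<rho>0 where "\<rho>0 z = fst (snd (F z))" for z
  define \<eta>0 where "\<eta>0 z = snd (snd (F z))" for z
  have G: "0 < \<rho>0 z0" "0 < \<eta>0 z0" "g z0 holomorphic_on ball 0 (\<rho>0 z0)" "g z0 0 = z0"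
      "\<And>e. norm e < \<rho>0 z0 \<Longrightarrow> Hf (g z0 e) e = 0"
      "\<And>e z. norm e < \<rho>0 z0 \<Longrightarrow> norm (z - z0) < \<eta>0 z0 \<Longrightarrow> Hf z e = 0 \<Longrightarrow> z = g z0 e"
    if "z0 \<in> Z" for z0
    using bspec[OF F that] by (auto simp: g_def \<rho>0_def \<eta>0_def case_prod_unfold)
  obtain \<eta> where \<eta>: "0 < \<eta>"
    "\<And>w m. norm w < \<eta> \<Longrightarrow> norm m < \<eta> \<Longrightarrow> w \<noteq> 0 \<Longrightarrow> m \<noteq> 0 \<Longrightarrow> \<not> resonant_frequency S (w\<^sup>2 * m) w"
    by (rule large_scaling_nonresonant) blast
  \<comment> \<open>Since d / w^2 = 1 / z^2, a small resonance must satisfy |1 / z^2| >=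
    \<open>\<eta>\<close>, that is |z| <= R.\<close>
  define R where "R = sqrt (1 / \<eta>)"
  obtain \<rho>1 where \<rho>1: "0 < \<rho>1" "\<And>z e. norm z \<le> R \<Longrightarrow> norm e < \<rho>1 \<Longrightarrow> Hf z e = 0 \<Longrightarrow> \<exists>z0\<in>Z. norm (z - z0) < \<eta>0 z0"
    by (rule branch_exclusion[of \<eta>0 R]) (use G in auto)
  obtain h \<rho>2 where h: "0 < \<rho>2" "h holomorphic_on ball 0 \<rho>2" "h 0 = w1" "\<And>d. norm d < \<rho>2 \<Longrightarrow> Kf (h d) d = 0"
    by (rule Kf_branch) blast
  have gcont: "g z \<midarrow>0\<rightarrow> z" if "z \<in> Z" for z
  proof -
    have "isCont (g z) 0"
      using holomorphic_on_imp_continuous_on[OF G(3)[OF that]] G(1)[OF that]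
      by (simp add: continuous_on_eq_continuous_at)
    then show ?thesis using G(4)[OF that] by (simp add: isCont_def)
  qed
  have hcont: "isCont h 0"
    using holomorphic_on_imp_continuous_on[OF h(2)] h(1) by (simp add: continuous_on_eq_continuous_at)
  have sq: "((\<lambda>e::complex. e\<^sup>2) \<longlongrightarrow> 0) (at 0)"
    by (auto intro!: tendsto_eq_intros)
  have hlim: "((\<lambda>e. h (e\<^sup>2)) \<longlongrightarrow> w1) (at 0)"
    using isCont_tendsto_compose[OF hcont, of "\<lambda>e. e\<^sup>2" "at 0"] sq h(3) by simp
  have 0: "0 \<in> Z" by (simp add: Z_def)
  have "\<forall>\<^sub>F e in at (0::complex). norm e < \<rho>0 z" if "z \<in> Z" for z
    using G(1)[OF that] eventually_at[of "\<lambda>e. norm e < \<rho>0 z" 0 UNIV] by (auto simp: dist_norm)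
  then have ev0: "\<forall>\<^sub>F e in at (0::complex). \<forall>z\<in>Z. norm e < \<rho>0 z" using finite_Z by (simp add: eventually_ball_finite)
  have ev1: "\<forall>\<^sub>F e in at (0::complex). norm e < \<rho>1"
    using \<rho>1(1) eventually_at[of "\<lambda>e. norm e < \<rho>1" 0 UNIV] by (auto simp: dist_norm)
  have ev2: "\<forall>\<^sub>F e in at (0::complex). norm (e\<^sup>2) < \<rho>2"
    using order_tendstoD(2)[OF tendsto_norm_zero[OF sq] h(1)] .
  have ev3: "\<forall>\<^sub>F e in at (0::complex). norm (e * h (e\<^sup>2) - 0) < \<eta>0 0"
  proof -
    have "((\<lambda>e. norm (e * h (e\<^sup>2) - 0)) \<longlongrightarrow> norm (0 * w1 - 0)) (at 0)"
      by (intro tendsto_intros hlim)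
    then show ?thesis using order_tendstoD(2)[of _ _ _ "\<eta>0 0"] G(2)[OF 0] by simp
  qed
  have ev4: "\<forall>\<^sub>F e in at (0::complex). h (e\<^sup>2) \<noteq> 0"
    using tendsto_imp_eventually_ne[OF hlim w1_nonzero] .
  have ev5: "\<forall>\<^sub>F e in at (0::complex). \<forall>z\<in>Z - {0}. g z e \<noteq> 0"
    using finite_Z gcont by (auto intro!: eventually_ball_finite tendsto_imp_eventually_ne)
  have ev6: "\<forall>\<^sub>F e in at (0::complex). \<forall>z\<in>Z. \<forall>z'\<in>Z - {z}. g z e - g z' e \<noteq> 0"
    using finite_Z gcont
    by (intro eventually_ball_finite ballI tendsto_imp_eventually_ne[OF tendsto_diff]) auto
  from ev0 ev1 ev2 ev3 ev4 ev5 ev6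
  have "\<forall>\<^sub>F e in at (0::complex). (\<forall>z\<in>Z. norm e < \<rho>0 z) \<and> norm e < \<rho>1 \<and> norm (e\<^sup>2) < \<rho>2 \<and> norm (e * h (e\<^sup>2) - 0) < \<eta>0 0
    \<and> h (e\<^sup>2) \<noteq> 0 \<and> (\<forall>z\<in>Z - {0}. g z e \<noteq> 0) \<and> (\<forall>z\<in>Z. \<forall>z'\<in>Z - {z}. g z e - g z' e \<noteq> 0)"
    by eventually_elim blast
  then obtain r where r: "0 < r" and re: "\<And>e. e \<noteq> 0 \<Longrightarrow> norm e < r \<Longrightarrow> (\<forall>z\<in>Z. norm e < \<rho>0 z) \<and> norm e < \<rho>1
    \<and> norm (e\<^sup>2) < \<rho>2 \<and> norm (e * h (e\<^sup>2) - 0) < \<eta>0 0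
    \<and> h (e\<^sup>2) \<noteq> 0 \<and> (\<forall>z\<in>Z - {0}. g z e \<noteq> 0) \<and> (\<forall>z\<in>Z. \<forall>z'\<in>Z - {z}. g z e - g z' e \<noteq> 0)"
    unfolding eventually_at by (auto simp: dist_norm)
  \<comment> \<open>Halving r makes the point \<open>of_real \<rho>\<close> itself admissible in
    \<open>re\<close>, which yields the comparison of \<open>\<rho>\<close> with all earlier
    radii.\<close>
  define \<rho> where "\<rho> = r / 2"
  have \<rho>: "0 < \<rho>" "\<rho> < r" using r by (auto simp: \<rho>_def)
  have \<rho>_le: "\<rho> \<le> \<rho>0 z" if "z \<in> Z" for z
    using re[of "of_real \<rho>"] \<rho> that by auto
  have \<rho>2_le: "\<rho>\<^sup>2 \<le> \<rho>2"
    using re[of "of_real \<rho>"] \<rho> by (auto simp: norm_power)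
  \<comment> \<open>The \<open>Kf\<close> branch is a resonance, hence solves \<open>Hf\<close>
    because h does not vanish. It is close to 0, so local uniqueness identifies it with
    \<open>g 0\<close>.\<close>
  have g0: "g 0 e = e * h (e\<^sup>2)" if e: "norm e < \<rho>" for e
  proof (cases "e = 0")
    case False
    then have *: "norm e < \<rho>0 0" "norm (e * h (e\<^sup>2) - 0) < \<eta>0 0" "norm (e\<^sup>2) < \<rho>2" "h (e\<^sup>2) \<noteq> 0"
      using re[of e] e \<rho> 0 by auto
    have "resonant_frequency S (e\<^sup>2) (e\<^sup>2 * h (e\<^sup>2))"
      using False h(4)[OF *(3)] by (subst resonant_Kf) auto
    then have "resonant_frequency S (e\<^sup>2) (e * (e * h (e\<^sup>2)))"
      by (simp add: power2_eq_square mult.assoc)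
    then have "Hf (e * h (e\<^sup>2)) e = 0"
      using False *(4) unfolding resonant_Hf[OF False] by auto
    then show ?thesis using G(6)[OF 0 *(1,2)] by simp
  qed (use G(4)[OF 0] in simp)
  have "branch_data S g h \<rho> \<eta>"
  proof unfold_locales
    show "0 < \<rho>" "0 < \<eta>" by (fact \<rho>(1) \<eta>(1))+
    show "g z holomorphic_on ball 0 \<rho>" if "z \<in> Z" for z
      using \<rho>_le[OF that] by (intro holomorphic_on_subset[OF G(3)[OF that]]) auto
    show "g z 0 = z" if "z \<in> Z" for z by (rule G(4)[OF that])
    show "Hf (g z e) e = 0" if "z \<in> Z" "norm e < \<rho>" for z e
      using G(5)[OF that(1)] \<rho>_le[OF that(1)] that by simp
    show "h holomorphic_on ball 0 (\<rho>\<^sup>2)" using \<rho>2_le by (intro holomorphic_on_subset[OF h(2)]) auto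
    show "h 0 = w1" by (rule h(3))
    show "g 0 e = e * h (e\<^sup>2)" if "norm e < \<rho>" for e by (rule g0[OF that])
    show "g z e \<noteq> 0" if "0 < norm e" "norm e < \<rho>" "z \<in> Z" for e z
      using re[of e] that \<rho> g0[OF that(2)] by (cases "z = 0") auto
    show "g z e \<noteq> g z' e" if "0 < norm e" "norm e < \<rho>" "z \<in> Z" "z' \<in> Z" "z \<noteq> z'" for e z z'
      using re[of e] that \<rho> by auto
    show "w = 0 \<or> (\<exists>z\<in>Z. w = e * g z e)"
      if e: "0 < norm e" "norm e < \<rho>" and w: "norm w < \<eta>" and res: "resonant_frequency S (e\<^sup>2) w" for e w
    proof (cases "w = 0")
      case False
      define z where "z = w / e"
      have z: "w = e * z" "z \<noteq> 0" using e False by (auto simp: z_def)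
      have "e\<^sup>2 = w\<^sup>2 * (1 / z\<^sup>2)" using z e by (simp add: power_mult_distrib)
      then have "\<not> norm (1 / z\<^sup>2) < \<eta>"
        using \<eta>(2)[OF w, of "1 / z\<^sup>2"] res False z by auto
      then have "(norm z)\<^sup>2 \<le> 1 / \<eta>"
        using z \<eta>(1) by (simp add: norm_divide norm_power field_simps)
      then have zR: "norm z \<le> R" unfolding R_def by (rule real_le_rsqrt)
      have H: "Hf z e = 0" using res z e resonant_Hf[of e z] by auto
      obtain z0 where z0: "z0 \<in> Z" "norm (z - z0) < \<eta>0 z0"
        using \<rho>1(2)[OF zR _ H] re[of e] e \<rho> by auto
      then have "z = g z0 e" using G(6)[OF z0(1) _ z0(2) H] re[of e] e \<rho> by auto
      then show ?thesis using z z0 by auto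
    qed simp
  qed
  then show thesis by (rule that)
qed

end

section \<open>Second-order remainders and estimates for solutions with given Cauchy data\<close>

text \<open>An O(e^2) error in the form that drops out when an identity is differentiated at 0. It
  is stable under sums and under products with functions differentiable at 0.\<close>

definition flat :: "(complex \<Rightarrow> complex) \<Rightarrow> bool" where
  "flat r \<longleftrightarrow> r 0 = 0 \<and> (r has_field_derivative 0) (at 0)"

lemma flat_add: "flat r \<Longrightarrow> flat s \<Longrightarrow> flat (\<lambda>e. r e + s e)"
  and flat_diff: "flat r \<Longrightarrow> flat s \<Longrightarrow> flat (\<lambda>e. r e - s e)"
  unfolding flat_def by (auto intro!: derivative_eq_intros)

lemma flat_mult: "flat r \<Longrightarrow> f field_differentiable at 0 \<Longrightarrow> flat (\<lambda>e. r e * f e)"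
  unfolding flat_def field_differentiable_def by (auto intro!: derivative_eq_intros)

lemma flat_mult_left: "flat r \<Longrightarrow> f field_differentiable at 0 \<Longrightarrow> flat (\<lambda>e. f e * r e)"
  using flat_mult[of r f] by (simp add: mult.commute)

lemma flat_cmult: "flat r \<Longrightarrow> flat (\<lambda>e. c * r e)"
  by (rule flat_mult_left) auto

lemma flat_sum: "(\<And>i. i \<in> I \<Longrightarrow> flat (r i)) \<Longrightarrow> flat (\<lambda>e. \<Sum>i\<in>I. r i e)"
  unfolding flat_def by (auto intro!: derivative_eq_intros sum.neutral)

lemma flat_square: "flat (\<lambda>e. e\<^sup>2)"
  unfolding flat_def by (auto intro!: derivative_eq_intros)

lemma flat_compose:
  assumes "F holomorphic_on UNIV" "flat q"
  shows "flat (\<lambda>e. F (q e) - F 0)"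
proof -
  have "(F has_field_derivative deriv F 0) (at (q 0))"
    using assms by (auto simp: flat_def intro: holomorphic_derivI)
  from DERIV_chain2[where g = q and x = 0, OF this, of 0 UNIV] assms show ?thesis
    by (auto simp: flat_def intro!: derivative_eq_intros)
qed

lemma holomorphic_bigo_linear:
  assumes f: "f holomorphic_on ball 0 \<rho>" "0 < \<rho>"
  shows "(\<lambda>e. f e - f 0) \<in> O[at 0](\<lambda>e. e)"
proof -
  have "(f has_field_derivative deriv f 0) (at 0)"
    using f by (auto intro: holomorphic_derivI)
  then have "((\<lambda>e. (f e - f 0) / e) \<longlongrightarrow> deriv f 0) (at 0)"
    by (simp add: has_field_derivative_iff)
  then show ?thesis
    by (rule bigoI_tendsto) (auto simp: eventually_at_filter)
qed

text \<open>The difference quotient extends holomorphically over 0, so the linear estimate applied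
  to it gains one more power of e.\<close>

lemma holomorphic_bigo_quadratic:
  assumes f: "f holomorphic_on ball 0 \<rho>" "0 < \<rho>" and d: "(f has_field_derivative d) (at 0)"
  shows "(\<lambda>e. f e - f 0 - d * e) \<in> O[at 0](\<lambda>e. e\<^sup>2)"
proof -
  define k where "k e = (if e = 0 then deriv f 0 else (f e - f 0) / (e - 0))" for e
  have "k holomorphic_on ball 0 \<rho>"
    unfolding k_def[abs_def] using f by (intro pole_lemma) auto
  then have "(\<lambda>e. k e - k 0) \<in> O[at 0](\<lambda>e. e)"
    using f(2) by (rule holomorphic_bigo_linear)
  then have "(\<lambda>e. e * (k e - k 0)) \<in> O[at 0](\<lambda>e. e * e)"
    by (intro landau_o.big.mult) auto
  moreover have "e * (k e - k 0) = f e - f 0 - d * e" for e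
    using DERIV_imp_deriv[OF d] by (cases "e = 0") (simp_all add: k_def field_simps)
  ultimately show ?thesis by (simp add: power2_eq_square)
qed

lemma norm_diff_le_derivative_bound:
  fixes f :: "real \<Rightarrow> complex"
  assumes "\<And>x. (f has_vector_derivative f' x) (at x)" "\<And>x. \<bar>x\<bar> \<le> \<bar>y\<bar> \<Longrightarrow> norm (f' x) \<le> B"
  shows "norm (f y - f 0) \<le> B * \<bar>y\<bar>"
proof -
  have "norm (f y - f 0) \<le> B * norm (y - 0)"
  proof (rule differentiable_bound[of "closed_segment 0 y" f "\<lambda>x h. h *\<^sub>R f' x"])
    fix x assume x: "x \<in> closed_segment 0 y"
    show "(f has_derivative (\<lambda>h. h *\<^sub>R f' x)) (at x within closed_segment 0 y)"
      using assms(1)[of x] by (auto simp: has_vector_derivative_def intro: has_derivative_at_withinI)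
    have "\<bar>x\<bar> \<le> \<bar>y\<bar>" using x by (auto simp: closed_segment_eq_real_ivl split: if_splits)
    then show "onorm (\<lambda>h. h *\<^sub>R f' x) \<le> B"
      using assms(2)[of x] by (intro onorm_le) (auto simp: mult.commute[of B] intro!: mult_left_mono)
  qed auto
  then show ?thesis by simp
qed

lemma sol_bound:
  obtains K where "1 \<le> K" "\<And>q y. norm q \<le> 1 \<Longrightarrow> \<bar>y\<bar> \<le> Y \<Longrightarrow> norm (sol c q y) \<le> K \<and> norm (dsol c q y) \<le> K"
proof -
  have "compact (cball (0::complex) 1 \<times> cball (0::real) Y)" by (intro compact_Times) auto
  moreover have "continuous_on (cball 0 1 \<times> cball 0 Y) (\<lambda>p. (sol c (fst p) (snd p), dsol c (fst p) (snd p)))"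
    by (intro continuous_intros)
  ultimately have "bounded ((\<lambda>p. (sol c (fst p) (snd p), dsol c (fst p) (snd p))) ` (cball 0 1 \<times> cball 0 Y))"
    by (intro compact_imp_bounded compact_continuous_image)
  then obtain B where B: "\<And>p. p \<in> cball 0 1 \<times> cball 0 Y \<Longrightarrow> norm (sol c (fst p) (snd p), dsol c (fst p) (snd p)) \<le> B"
    unfolding bounded_iff by blast
  show thesis
  proof (rule that[of "max 1 B"])
    fix q :: complex and y :: real assume "norm q \<le> 1" "\<bar>y\<bar> \<le> Y"
    then have "norm (sol c q y, dsol c q y) \<le> B" using B[of "(q, y)"] by simp
    then have "norm (sol c q y) \<le> B" "norm (dsol c q y) \<le> B"
      using norm_fst_le[of "sol c q y" "dsol c q y"] norm_snd_le[of "dsol c q y" "sol c q y"] by linarith+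
    then show "norm (sol c q y) \<le> max 1 B \<and> norm (dsol c q y) \<le> max 1 B" by (simp add: le_max_iff_disj)
  qed simp
qed

text \<open>Inside a resonator both the coefficient q and the slope d will be small; the derivative
  is bounded by them and the value by integrating the derivative.\<close>

lemma gen_sol_interior_estimate:
  obtains C where "0 \<le> C" "\<And>q u d y. norm q \<le> 1 \<Longrightarrow> \<bar>y\<bar> \<le> Y \<Longrightarrow>
    norm (dgen_sol c q u d y) \<le> C * (norm q * norm u + norm d)
    \<and> norm (gen_sol c q u d y - u) \<le> C * (norm q * norm u + norm d)"
proof -
  obtain K where K: "1 \<le> K" "\<And>q y. norm q \<le> 1 \<Longrightarrow> \<bar>y\<bar> \<le> Y \<Longrightarrow> norm (sol c q y) \<le> K \<and> norm (dsol c q y) \<le> K"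
    by (rule sol_bound) blast
  have D: "norm (dgen_sol c q u d y) \<le> K * (norm q * norm u + norm d)"
    if "norm q \<le> 1" "\<bar>y\<bar> \<le> Y" for q u d y
  proof -
    have "norm (dgen_sol c q u d y) \<le> norm q * norm u * norm (sol c q y) + norm d * norm (dsol c q y)"
      unfolding dgen_sol_def using norm_triangle_ineq[of "- q * u * sol c q y" "d * dsol c q y"]
      by (simp add: norm_mult)
    also have "\<dots> \<le> norm q * norm u * K + norm d * K"
      using K(2)[OF that] by (intro add_mono mult_left_mono) auto
    finally show ?thesis by (simp add: algebra_simps)
  qed
  show thesis
  proof (rule that[of "K * max 1 Y"])
    fix q u d :: complex and y :: real assume a: "norm q \<le> 1" "\<bar>y\<bar> \<le> Y"
    have nn: "0 \<le> K * (norm q * norm u + norm d)" using K(1) by simp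
    have "norm (gen_sol c q u d y - gen_sol c q u d 0) \<le> K * (norm q * norm u + norm d) * \<bar>y\<bar>"
      by (rule norm_diff_le_derivative_bound[OF gen_sol_derivs(1)]) (use D a in auto)
    also have "\<dots> \<le> K * (norm q * norm u + norm d) * max 1 Y"
      using nn a by (intro mult_left_mono) auto
    finally have 1: "norm (gen_sol c q u d y - u) \<le> K * max 1 Y * (norm q * norm u + norm d)"
      by (simp add: mult_ac)
    have "K * (norm q * norm u + norm d) * 1 \<le> K * (norm q * norm u + norm d) * max 1 Y"
      using nn by (intro mult_left_mono) auto
    then show "norm (dgen_sol c q u d y) \<le> K * max 1 Y * (norm q * norm u + norm d)
      \<and> norm (gen_sol c q u d y - u) \<le> K * max 1 Y * (norm q * norm u + norm d)"
      using 1 D[OF a, of u d] by (simp add: mult_ac)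
  qed (use K in simp)
qed

text \<open>Outside the slope is not small, so the comparison is with the affine solution of the
  equation for q = 0, and every error carries a factor q.\<close>

lemma gen_sol_exterior_estimate:
  obtains C where "0 \<le> C" "\<And>q u d y. norm q \<le> 1 \<Longrightarrow> \<bar>y\<bar> \<le> Y \<Longrightarrow>
    norm (dgen_sol 0 q u d y - d) \<le> C * (norm q * (norm u + norm d))
    \<and> norm (gen_sol 0 q u d y - (u + d * of_real y)) \<le> C * (norm q * (norm u + norm d))"
proof -
  obtain K where K: "1 \<le> K" "\<And>q y. norm q \<le> 1 \<Longrightarrow> \<bar>y\<bar> \<le> Y \<Longrightarrow> norm (sol 0 q y) \<le> K \<and> norm (dsol 0 q y) \<le> K"
    by (rule sol_bound) blast
  define Y' where "Y' = max 1 Y"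
  have Y': "1 \<le> Y'" "\<bar>y\<bar> \<le> Y \<Longrightarrow> \<bar>y\<bar> \<le> Y'" for y by (auto simp: Y'_def)
  have D: "norm (dgen_sol 0 q u d y - d) \<le> K * Y' * (norm q * (norm u + norm d))"
    if a: "norm q \<le> 1" "\<bar>y\<bar> \<le> Y" for q u d y
  proof -
    have "norm (dsol 0 q y - dsol 0 q 0) \<le> (norm q * K) * \<bar>y\<bar>"
      by (rule norm_diff_le_derivative_bound[OF sol_derivs(2)]) 
        (use K a in \<open>auto simp: norm_mult intro!: mult_left_mono\<close>)
    also have "\<dots> \<le> (norm q * K) * Y'" using K(1) Y'(2)[OF a(2)] by (intro mult_left_mono) auto
    finally have d1: "norm (dsol 0 q y - 1) \<le> norm q * K * Y'" by simp
    have "norm (sol 0 q y) \<le> K * 1" using K(2)[OF a] by simp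
    also have "\<dots> \<le> K * Y'" using K(1) Y'(1) by (intro mult_left_mono) auto
    finally have d2: "norm (sol 0 q y) \<le> K * Y'" .
    have "dgen_sol 0 q u d y - d = - q * u * sol 0 q y + d * (dsol 0 q y - 1)"
      by (simp add: dgen_sol_def algebra_simps)
    then have "norm (dgen_sol 0 q u d y - d) \<le> norm q * norm u * norm (sol 0 q y) + norm d * norm (dsol 0 q y - 1)"
      using norm_triangle_ineq[of "- q * u * sol 0 q y" "d * (dsol 0 q y - 1)"] by (simp add: norm_mult)
    also have "\<dots> \<le> norm q * norm u * (K * Y') + norm d * (norm q * K * Y')"
      using d1 d2 by (intro add_mono mult_left_mono) auto
    finally show ?thesis by (simp add: algebra_simps)
  qed
  show thesis
  proof (rule that[of "K * Y' * Y'"])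
    fix q u d :: complex and y :: real assume a: "norm q \<le> 1" "\<bar>y\<bar> \<le> Y"
    have nn: "0 \<le> K * Y' * (norm q * (norm u + norm d))" using K(1) Y'(1) by simp
    have der: "((\<lambda>y. gen_sol 0 q u d y - (u + d * of_real y)) has_vector_derivative dgen_sol 0 q u d x - d) (at x)" for x
    proof -
      have "((\<lambda>z. u + d * z) has_field_derivative d) (at (of_real x))"
        by (auto intro!: derivative_eq_intros)
      from has_vector_derivative_diff[OF gen_sol_derivs(1) has_vector_derivative_real_field[OF this]]
      show ?thesis .
    qed
    have "norm ((gen_sol 0 q u d y - (u + d * of_real y)) - (gen_sol 0 q u d 0 - (u + d * of_real 0)))
        \<le> K * Y' * (norm q * (norm u + norm d)) * \<bar>y\<bar>"
      by (rule norm_diff_le_derivative_bound[OF der]) (use D a in auto)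
    also have "\<dots> \<le> K * Y' * (norm q * (norm u + norm d)) * Y'"
      using nn Y'(2)[OF a(2)] by (intro mult_left_mono) auto
    finally have 1: "norm (gen_sol 0 q u d y - (u + d * of_real y)) \<le> K * Y' * Y' * (norm q * (norm u + norm d))"
      by (simp add: mult_ac)
    have "K * Y' * (norm q * (norm u + norm d)) * 1 \<le> K * Y' * (norm q * (norm u + norm d)) * Y'"
      using nn Y'(1) by (intro mult_left_mono) auto
    then show "norm (dgen_sol 0 q u d y - d) \<le> K * Y' * Y' * (norm q * (norm u + norm d))
      \<and> norm (gen_sol 0 q u d y - (u + d * of_real y)) \<le> K * Y' * Y' * (norm q * (norm u + norm d))"
      using 1 D[OF a, of u d] by (simp add: mult_ac)
  qed (use K Y' in simp)
qed

context resonators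
begin

subsection \<open>First-order terms of the branches\<close>

text \<open>The perturbed state on the branch is paired with the unperturbed one at
  \<open>\<mu>\<close> = z0^2 in \<open>wronskian_sum\<close>. The errors are flat, so
  differentiating at e = 0 leaves the two radiation fluxes against g'(0) times the weighted sum of
  squares.\<close>

lemma branch_derivative:
  assumes \<rho>: "0 < \<rho>" and g: "g holomorphic_on ball 0 \<rho>" "g 0 = z0" "z0 \<in> Z" "z0 \<noteq> 0"
    and Hf: "\<And>e. norm e < \<rho> \<Longrightarrow> Hf (g e) e = 0"
  shows "(g has_field_derivative - \<i> * of_real (vb\<^sup>2 / (2 * v)) * (1 + of_real (pp N) * (U (z0\<^sup>2) (N - 1))\<^sup>2)
    / (\<Sum>j<N. of_real (mm j) * (U (z0\<^sup>2) j)\<^sup>2)) (at 0)"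
proof -
  define \<mu> where "\<mu> = z0\<^sup>2"
  define V where "V i = U \<mu> i" for i
  define G' where "G' i = \<mu> * Q \<mu> i" for i
  define u where "u i e = uL (e * g e) (e\<^sup>2) 1 ((g e)\<^sup>2) i" for i e
  define uu where "uu i e = uR (e * g e) (e\<^sup>2) 1 ((g e)\<^sup>2) i" for i e
  define F where "F i e = FL (e * g e) (e\<^sup>2) 1 ((g e)\<^sup>2) i" for i e
  define F' where "F' i e = FR (e * g e) (e\<^sup>2) 1 ((g e)\<^sup>2) i" for i e
  have diff_hol: "f field_differentiable at 0" if "f holomorphic_on ball 0 \<rho>" for f :: "complex \<Rightarrow> complex"
    using that \<rho> by (auto intro: holomorphic_on_imp_differentiable_at)
  have hL: "u i holomorphic_on ball 0 \<rho>" "F i holomorphic_on ball 0 \<rho>"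
    and hR: "uu i holomorphic_on ball 0 \<rho>" "F' i holomorphic_on ball 0 \<rho>" for i
    unfolding u_def[abs_def] F_def[abs_def] uu_def[abs_def] F'_def[abs_def] by (intro holomorphic_curve g)+
  note dL = hL[THEN diff_hol] and dR = hR[THEN diff_hol]
  have dg: "g field_differentiable at 0" using diff_hol[OF g(1)] .
  have hq: "(\<lambda>e. qi (e * g e)) holomorphic_on ball 0 \<rho>" "(\<lambda>e. qo (e * g e)) holomorphic_on ball 0 \<rho>"
    using g by (auto intro!: holomorphic_intros)
  have fq: "flat (\<lambda>e. qi (e * g e))" "flat (\<lambda>e. qo (e * g e))"
  proof -
    have "(\<lambda>e. (g e)\<^sup>2 / of_real (vb\<^sup>2)) holomorphic_on ball 0 \<rho>" "(\<lambda>e. (g e)\<^sup>2 / of_real (v\<^sup>2)) holomorphic_on ball 0 \<rho>"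
      using v_pos vb_pos g by (auto intro!: holomorphic_intros)
    from this[THEN diff_hol, THEN flat_mult[OF flat_square]]
    show "flat (\<lambda>e. qi (e * g e))" "flat (\<lambda>e. qo (e * g e))"
      by (simp_all add: qi_def qo_def power_mult_distrib)
  qed
  have fc: "flat (\<lambda>e. sol c (qi (e * g e)) y - sol c 0 y)" "flat (\<lambda>e. dsol c (qi (e * g e)) y - dsol c 0 y)"
    "flat (\<lambda>e. sol c (qo (e * g e)) y - sol c 0 y)" "flat (\<lambda>e. dsol c (qo (e * g e)) y - dsol c 0 y)" for c y
    by (intro flat_compose[where F = "\<lambda>q. sol c q y"] flat_compose[where F = "\<lambda>q. dsol c q y"] fq
        holomorphic_intros)+
  define e1 where "e1 i e = F' i e - (of_real (ee i) * F i e - (g e)\<^sup>2 * of_real (cc i) * u i e / of_real (vb\<^sup>2))" for i e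
  define e2 where "e2 i e = u (Suc i) e - (u i e + of_real (gp i) * F' i e)" for i e
  define e3 where "e3 i e = F (Suc i) e - F' i e" for i e
  have flat1: "flat (e1 i)" if "i < N" for i
  proof -
    have "e1 i = (\<lambda>e. (dsol (gm i) (qi (e * g e)) (len i) - dsol (gm i) 0 (len i)) * F i e
        - (sol (gm i) (qi (e * g e)) (len i) - sol (gm i) 0 (len i)) * ((g e)\<^sup>2 * u i e / of_real (vb\<^sup>2)))"
      unfolding unperturbed_coeffs[OF that]
      by (rule ext) (simp add: e1_def F'_def flux_right F_def u_def algebra_simps diff_divide_distrib)
    moreover have "(\<lambda>e. (g e)\<^sup>2 * u i e / of_real (vb\<^sup>2)) holomorphic_on ball 0 \<rho>"
      using hL g vb_pos by (auto intro!: holomorphic_intros)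
    ultimately show ?thesis
      by (simp only:) (rule flat_diff, rule flat_mult, rule fc, rule dL, rule flat_mult, rule fc, rule diff_hol)
  qed
  have flat2: "flat (e2 i)" if "i < N" for i
  proof -
    have c1: "of_real (ee i) + of_real (gm i) * of_real (cc i) = (1::complex)"
      using cc_ee[OF that] by (simp flip: of_real_add of_real_mult)
    have "uu i e - u i e = ((dsol (gm i) (qi (e * g e)) (len i) - of_real (ee i))
        + of_real (gm i) * (sol (gm i) (qi (e * g e)) (len i) - of_real (cc i))) * u i e
        + e\<^sup>2 * (sol (gm i) (qi (e * g e)) (len i) * F i e)
        + (of_real (ee i) + of_real (gm i) * of_real (cc i) - 1) * u i e" for e
      by (simp add: uu_def state_right u_def F_def algebra_simps)
    \<comment> \<open>The unperturbed coefficients of u add up to 1 by \<open>cc_ee\<close>, so the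
      value changes across a resonator only by flat terms.\<close>
    then have uu: "uu i e = u i e + ((dsol (gm i) (qi (e * g e)) (len i) - of_real (ee i))
        + of_real (gm i) * (sol (gm i) (qi (e * g e)) (len i) - of_real (cc i))) * u i e
        + e\<^sup>2 * (sol (gm i) (qi (e * g e)) (len i) * F i e)" for e
      unfolding c1 by (simp add: diff_eq_eq)
    have "e2 i = (\<lambda>e. (dsol 0 (qo (e * g e)) (gp i) - dsol 0 0 (gp i)) * uu i e
       + (sol 0 (qo (e * g e)) (gp i) - sol 0 0 (gp i)) * F' i e
       + (((dsol (gm i) (qi (e * g e)) (len i) - dsol (gm i) 0 (len i))
        + of_real (gm i) * (sol (gm i) (qi (e * g e)) (len i) - sol (gm i) 0 (len i))) * u i e
        + e\<^sup>2 * (sol (gm i) (qi (e * g e)) (len i) * F i e)))"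
    proof
      fix e
      have "e2 i e = (dsol 0 (qo (e * g e)) (gp i) - 1) * uu i e
       + (sol 0 (qo (e * g e)) (gp i) - of_real (gp i)) * F' i e + (uu i e - u i e)"
        by (simp add: e2_def u_def[of "Suc i"] state_Suc uu_def F'_def algebra_simps)
      then show "e2 i e = (dsol 0 (qo (e * g e)) (gp i) - dsol 0 0 (gp i)) * uu i e
       + (sol 0 (qo (e * g e)) (gp i) - sol 0 0 (gp i)) * F' i e
       + (((dsol (gm i) (qi (e * g e)) (len i) - dsol (gm i) 0 (len i))
        + of_real (gm i) * (sol (gm i) (qi (e * g e)) (len i) - sol (gm i) 0 (len i))) * u i e
        + e\<^sup>2 * (sol (gm i) (qi (e * g e)) (len i) * F i e))"
        unfolding unperturbed_coeffs[OF that] using uu[of e] by simp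
    qed
    moreover have "(\<lambda>e. sol (gm i) (qi (e * g e)) (len i) * F i e) field_differentiable at 0"
      using hL hq by (auto intro!: diff_hol holomorphic_intros)
    ultimately show ?thesis
      by (simp only:) (rule flat_add, rule flat_add, rule flat_mult, rule fc, rule dR,
          rule flat_mult, rule fc, rule dR, rule flat_add, rule flat_mult, rule flat_add, rule fc,
          rule flat_cmult, rule fc, rule dL, rule flat_mult, rule flat_square)
  qed
  have flat3: "flat (e3 i)" if "i < N" for i
  proof -
    have "e3 i = (\<lambda>e. (dsol 0 (qo (e * g e)) (gp i) - dsol 0 0 (gp i)) * F' i e
       - qo (e * g e) * (sol 0 (qo (e * g e)) (gp i) * uu i e))"
      unfolding unperturbed_coeffs[OF that]
      by (rule ext) (simp add: e3_def F_def F'_def flux_Suc uu_def algebra_simps)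
    moreover have "(\<lambda>e. sol 0 (qo (e * g e)) (gp i) * uu i e) field_differentiable at 0"
      using hR hq by (auto intro!: diff_hol holomorphic_intros)
    ultimately show ?thesis
      by (simp only:) (rule flat_diff, rule flat_mult, rule fc, rule dR, rule flat_mult, rule fq)
  qed
  define R where "R e = (\<Sum>j\<le>N - 1. of_real (pp (Suc j)) * e1 j e * V j)
        + (\<Sum>j<N - 1. of_real (pp (Suc j)) * (e3 j e * V (Suc j) - G' j * e2 j e))" for e
  have "flat R"
    unfolding R_def[abs_def]
    by (intro flat_add flat_sum flat_mult flat_cmult flat_diff flat1 flat2 flat3) (use N_pos in auto)
  then have R: "(R has_field_derivative 0) (at 0)" by (simp add: flat_def)
  define T where "T e = (\<Sum>j<N. of_real (mm j) * u j e * V j)" for e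
  have \<mu>: "\<mu> \<in> roots" using g by (simp add: Z_def \<mu>_def)
  have u0: "u i 0 = V i" for i by (simp add: u_def V_def g \<mu>_def)
  \<comment> \<open>The unperturbed end flux is zero because \<open>\<mu>\<close> is a root, and the
    perturbed one is i w / v times the end value because \<open>Hf\<close> vanishes on the
    branch.\<close>
  have id: "of_real (pp N) * (\<i> * e * g e / of_real v * uu (N - 1) e * V (N - 1))
      = - \<i> * e * g e / of_real v - ((g e)\<^sup>2 - \<mu>) / of_real (vb\<^sup>2) * T e + R e" if e: "norm e < \<rho>" for e
  proof -
    have W: "of_real (pp (Suc (N - 1))) * (F' (N - 1) e * V (N - 1) - G' (N - 1) * u (N - 1) e)
      = F 0 e * V 0 - \<mu> * bL 0 0 1 \<mu> 0 * u 0 e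
      - ((g e)\<^sup>2 - \<mu>) / of_real (vb\<^sup>2) * (\<Sum>j\<le>N - 1. of_real (mm j) * u j e * V j) + R e"
      unfolding R_def
    proof (rule wronskian_sum[where G = "\<lambda>i. \<mu> * bL 0 0 1 \<mu> i"])
      show "F' i e = of_real (ee i) * F i e - (g e)\<^sup>2 * of_real (cc i) * u i e / of_real (vb\<^sup>2) + e1 i e" for i
        by (simp add: e1_def)
      show "u (Suc i) e = u i e + of_real (gp i) * F' i e + e2 i e" for i by (simp add: e2_def)
      show "F (Suc i) e = F' i e + e3 i e" for i by (simp add: e3_def)
      show "G' i = of_real (ee i) * (\<mu> * bL 0 0 1 \<mu> i) - \<mu> * of_real (cc i) * V i / of_real (vb\<^sup>2)" if "i \<le> N - 1" for i
        using that N_pos by (simp add: G'_def V_def unperturbed_right algebra_simps)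
      show "V (Suc i) = V i + of_real (gp i) * G' i" "\<mu> * bL 0 0 1 \<mu> (Suc i) = G' i" if "i < N - 1" for i
        using that by (simp_all add: G'_def V_def unperturbed_Suc)
    qed
    have "F' (N - 1) e = \<i> * e * g e / of_real v * uu (N - 1) e + g e * Hf (g e) e"
      by (simp add: F'_def FR_def Hf_def uu_def power2_eq_square algebra_simps)
    then have F'N: "F' (N - 1) e = \<i> * e * g e / of_real v * uu (N - 1) e" using Hf[OF e] by simp
    have F0: "F 0 e = - \<i> * e * g e / of_real v" "u 0 e = 1" "V 0 = 1" by (simp_all add: F_def u_def V_def)
    have "{..N - 1} = {..<N}" "Suc (N - 1) = N" using N_pos by auto
    moreover have "G' (N - 1) = 0" using \<mu> by (simp add: G'_def roots_def)
    ultimately show ?thesis using W unfolding F'N F0 T_def by (simp add: mult.assoc)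
  qed
  define g' where "g' = deriv g 0"
  have g': "(g has_field_derivative g') (at 0)"
    unfolding g'_def using g \<rho> by (auto intro: holomorphic_derivI)
  have uu0: "uu (N - 1) 0 = V (N - 1)"
    using unperturbed_right(1)[of "N - 1" 1 \<mu>] N_pos by (simp add: uu_def V_def g \<mu>_def)
  obtain uu' where uu': "(uu (N - 1) has_field_derivative uu') (at 0)"
    using dR(1) by (auto simp: field_differentiable_def)
  have "T holomorphic_on ball 0 \<rho>"
    unfolding T_def[abs_def] using hL by (intro holomorphic_intros) auto
  then obtain T' where T': "(T has_field_derivative T') (at 0)"
    using diff_hol by (auto simp: field_differentiable_def)
  have D1: "((\<lambda>e. of_real (pp N) * (\<i> * e * g e / of_real v * uu (N - 1) e * V (N - 1))) has_field_derivative
      of_real (pp N) * (\<i> * z0 / of_real v * (V (N - 1))\<^sup>2)) (at 0)"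
    using v_pos by (auto intro!: derivative_eq_intros g' uu'[simplified] simp: g uu0[simplified] power2_eq_square)
  have "((\<lambda>e. - \<i> * e * g e / of_real v - ((g e)\<^sup>2 - \<mu>) / of_real (vb\<^sup>2) * T e + R e) has_field_derivative
      of_real (pp N) * (\<i> * z0 / of_real v * (V (N - 1))\<^sup>2)) (at 0)"
    by (rule has_field_derivative_transform_within_open[where S = "ball 0 \<rho>", OF D1 open_ball]) (use \<rho> id in auto)
  moreover have "((\<lambda>e. - \<i> * e * g e / of_real v - ((g e)\<^sup>2 - \<mu>) / of_real (vb\<^sup>2) * T e + R e) has_field_derivative
      - \<i> * z0 / of_real v - 2 * z0 * g' / of_real (vb\<^sup>2) * T 0) (at 0)"
    using v_pos vb_pos
    by (auto intro!: derivative_eq_intros g' T' R simp: g \<mu>_def field_simps)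
  ultimately have eq: "of_real (pp N) * (\<i> * z0 / of_real v * (V (N - 1))\<^sup>2)
      = - \<i> * z0 / of_real v - 2 * z0 * g' / of_real (vb\<^sup>2) * T 0"
    using DERIV_unique by blast
  have T0: "T 0 = (\<Sum>j<N. of_real (mm j) * (V j)\<^sup>2)"
    by (simp add: T_def u0 power2_eq_square mult.assoc)
  have Tne: "T 0 \<noteq> 0"
  proof -
    have "V j = of_real (Re (V j))" if "j < N" for j
      unfolding V_def using unperturbed_real(1)[OF that, of "Re \<mu>"] roots_real_pos(1)[OF \<mu>] by simp
    then have "of_real (mm j) * (V j)\<^sup>2 = of_real (mm j * (Re (V j))\<^sup>2)" if "j < N" for j
      using that by (metis of_real_mult of_real_power)
    then have "T 0 = of_real (\<Sum>j<N. mm j * (Re (V j))\<^sup>2)"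
      unfolding T0 of_real_sum by (intro sum.cong) auto
    moreover have "0 < (\<Sum>j<N. mm j * (Re (V j))\<^sup>2)" by (rule weighted_sum_pos) (simp add: V_def)
    ultimately show ?thesis by (simp del: of_real_sum)
  qed
  \<comment> \<open>All surviving terms carry a factor z0; cancelling it is possible because this
    branch starts away from 0.\<close>
  have "z0 * (\<i> / of_real v * (1 + of_real (pp N) * (V (N - 1))\<^sup>2) + 2 * g' / of_real (vb\<^sup>2) * T 0) = 0"
    using eq by (simp add: algebra_simps)
  then have "2 * g' / of_real (vb\<^sup>2) * T 0 = - (\<i> / of_real v * (1 + of_real (pp N) * (V (N - 1))\<^sup>2))"
    using g(4) by (simp add: add_eq_0_iff)
  then have "g' = - \<i> * of_real (vb\<^sup>2 / (2 * v)) * (1 + of_real (pp N) * (V (N - 1))\<^sup>2) / T 0"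
    using Tne v_pos vb_pos by (simp add: field_simps)
  with g' show ?thesis unfolding T0 V_def \<mu>_def by simp
qed

text \<open>The eigenvectors are alpha * U and beta * mm * U, so alpha * beta cancels. Moreover
  theta_0 mm_0 = 1 / r and theta_{2N-1} mm_{N-1} = pp N / r, which turns the boundary entries into
  the radiation terms 1 and pp N.\<close>

lemma damping_coeff_eq:
  assumes a: "eigenvector (cap_mat S) a l" and b: "eigenvector (transpose_mat (cap_mat S)) b l"
  defines "\<mu> \<equiv> of_real (v * vb * l)"
  shows "damping_coeff S a b = - \<i> * of_real (vb\<^sup>2 / (2 * v)) * (1 + of_real (pp N) * (U \<mu> (N - 1))\<^sup>2)
    / (\<Sum>j<N. of_real (mm j) * (U \<mu> j)\<^sup>2)"
proof -
  define V where "V j = Re (U \<mu> j)" for j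
  have UV: "U \<mu> j = of_real (V j)" if "j < N" for j
    unfolding V_def \<mu>_def by (rule unperturbed_real(1)[OF that])
  define \<alpha> where "\<alpha> = vec_index a 0"
  define \<beta> where "\<beta> = vec_index b 0 / mm 0"
  have nz: "\<alpha> \<noteq> 0" "\<beta> \<noteq> 0"
    using eigenvector_shape(1)[OF a] left_eigenvector_shape(1)[OF b] mm_pos[OF N_pos] by (auto simp: \<alpha>_def \<beta>_def)
  have ab: "vec_index a j = \<alpha> * V j" "vec_index b j = \<beta> * mm j * V j" if "j < N" for j
  proof -
    have "of_real (vec_index a j) = (of_real (\<alpha> * V j) :: complex)"
      using eigenvector_shape(2)[OF a that] UV[OF that] by (simp add: \<alpha>_def \<mu>_def)
    then show "vec_index a j = \<alpha> * V j" by (simp only: of_real_eq_iff)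
    have "of_real (vec_index b j) = (of_real (\<beta> * mm j * V j) :: complex)"
      using left_eigenvector_shape(2)[OF b that] UV[OF that] by (simp add: \<beta>_def \<mu>_def)
    then show "vec_index b j = \<beta> * mm j * V j" by (simp only: of_real_eq_iff)
  qed
  have N1: "N - 1 < N" "Suc (N - 1) = N" "2 * N - 1 = 2 * (N - 1) + 1" using N_pos by auto
  have V0: "V 0 = 1" by (simp add: V_def)
  have t0: "theta S 0 * mm 0 = 1 / ratio"
    using theta_even[OF N_pos] cc_pos[OF N_pos] pp_Suc[of 0] by (simp add: mm_def field_simps)
  have tN: "theta S (2 * N - 1) * mm (N - 1) = pp N / ratio"
    unfolding N1(3) theta_odd[OF N1(1)] using cc_pos[OF N1(1)] N1(2) by (simp add: mm_def field_simps)
  have "theta S 0 * vec_index a 0 * vec_index b 0 + theta S (2 * N - 1) * vec_index a (N - 1) * vec_index b (N - 1)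
      = \<alpha> * \<beta> * ((theta S 0 * mm 0) + (theta S (2 * N - 1) * mm (N - 1)) * (V (N - 1))\<^sup>2)"
    unfolding ab[OF N_pos] ab[OF N1(1)] V0 by (simp add: algebra_simps power2_eq_square)
  also have "\<dots> = \<alpha> * \<beta> * ((1 + pp N * (V (N - 1))\<^sup>2) / ratio)"
    unfolding t0 tN by (simp add: add_divide_distrib)
  finally have num: "theta S 0 * vec_index a 0 * vec_index b 0 + theta S (2 * N - 1) * vec_index a (N - 1) * vec_index b (N - 1)
      = \<alpha> * \<beta> * ((1 + pp N * (V (N - 1))\<^sup>2) / ratio)" .
  have den: "(\<Sum>j<N. vec_index a j * vec_index b j) = \<alpha> * \<beta> * (\<Sum>j<N. mm j * (V j)\<^sup>2)"
    unfolding sum_distrib_left by (rule sum.cong) (auto simp: ab power2_eq_square)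
  have "damping_coeff S a b = - \<i> * of_real (vb / 2 * ((1 + pp N * (V (N - 1))\<^sup>2) / ratio) / (\<Sum>j<N. mm j * (V j)\<^sup>2))"
    unfolding damping_coeff_def Let_def num den using nz by simp
  also have "vb / 2 * ((1 + pp N * (V (N - 1))\<^sup>2) / ratio) = vb\<^sup>2 / (2 * v) * (1 + pp N * (V (N - 1))\<^sup>2)"
    using vb_pos v_pos by (simp add: speed_ratio_def field_simps power2_eq_square)
  also have "- \<i> * of_real (vb\<^sup>2 / (2 * v) * (1 + pp N * (V (N - 1))\<^sup>2) / (\<Sum>j<N. mm j * (V j)\<^sup>2))
      = - \<i> * of_real (vb\<^sup>2 / (2 * v)) * (1 + of_real (pp N) * (U \<mu> (N - 1))\<^sup>2) / (\<Sum>j<N. of_real (mm j) * (U \<mu> j)\<^sup>2)"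
  proof -
    have "(\<Sum>j<N. of_real (mm j) * (U \<mu> j)\<^sup>2) = of_real (\<Sum>j<N. mm j * (V j)\<^sup>2)"
      by (simp add: UV)
    then show ?thesis unfolding UV[OF N1(1)] by simp
  qed
  finally show ?thesis .
qed

lemma prod_1_upto: "(\<Prod>j=1..N. f j) = (\<Prod>j<N. f (Suc j))"
  using prod.atLeast1_atMost_eq[of f N] by simp

text \<open>With half exponents p_j = exp(gamma_j l_j / 2) one has pp = P^2. Every summand of the
  denominator is G / P_N times \<open>mm i\<close>, so the factor G, the product of the gamma_j / 2,
  cancels.\<close>

lemma omega1_coeff_eq: "omega1_coeff S = w1"
proof -
  define G where "G = (\<Prod>j<N. gm j / 2)"
  define p where "p j = exp (gm j * len j / 2)" for j
  define P where "P n = (\<Prod>j<n. p j)" for n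
  have p_pos: "0 < p j" for j by (simp add: p_def)
  have P_pos: "0 < P n" for n by (simp add: P_def prod_pos p_pos)
  have pp: "pp n = (P n)\<^sup>2" for n
    by (simp add: pp_def P_def p_def power2_eq_square flip: prod.distrib exp_add)
  have Gnz: "G \<noteq> 0" using gm_nonzero by (auto simp: G_def)
  have len: "res_len S (Suc j) = len j" for j by (simp add: res_len_def)
  have m: "exp (- gm j * len j / 2) = 1 / p j" for j
    by (simp add: p_def exp_minus inverse_eq_divide)
  have num: "(\<Prod>j=1..N. gauge S j / 2 * exp (gauge S j * res_len S j / 2))
      + (\<Prod>j=1..N. gauge S j / 2 * exp (- gauge S j * res_len S j / 2)) = G * (P N + 1 / P N)"
    unfolding prod_1_upto len m by (simp add: G_def P_def p_def prod.distrib prod_dividef distrib_left)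
  have den: "(\<Sum>i=1..N. sinh (gauge S i * res_len S i / 2)
            * (\<Prod>j=1..<i. gauge S j / 2 * exp (gauge S j * res_len S j / 2))
            * (\<Prod>j=i+1..N. gauge S j / 2 * exp (- gauge S j * res_len S j / 2)))
      = G / P N * (\<Sum>j<N. mm j)"
  proof -
    have summand: "sinh (gm i * len i / 2)
        * (\<Prod>j=1..<Suc i. gauge S j / 2 * exp (gauge S j * res_len S j / 2))
        * (\<Prod>j=Suc i+1..N. gauge S j / 2 * exp (- gauge S j * res_len S j / 2)) = G / P N * mm i" if i: "i < N" for i
    proof -
      have shift: "(\<Prod>j=Suc k..<Suc n. f j) = (\<Prod>j=k..<n. f (Suc j))" for f :: "nat \<Rightarrow> real" and k n
        by (rule prod.shift_bounds_Suc_ivl)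
      have A: "(\<Prod>j=1..<Suc i. gauge S j / 2 * exp (gauge S j * res_len S j / 2)) = (\<Prod>j<i. gm j / 2) * P i"
        unfolding One_nat_def shift len P_def p_def prod.distrib[symmetric] atLeast0LessThan ..
      have B: "(\<Prod>j=Suc i+1..N. gauge S j / 2 * exp (- gauge S j * res_len S j / 2))
          = (\<Prod>j=Suc i..<N. gm j / 2) * (1 / (\<Prod>j=Suc i..<N. p j))"
      proof -
        have "{Suc i + 1..N} = {Suc (Suc i)..<Suc N}" by auto
        then show ?thesis
          by (simp only: shift len m prod.distrib) (simp add: prod_dividef)
      qed
      have split: "(\<Prod>j<N. f j) = (\<Prod>j<i. f j) * f i * (\<Prod>j=Suc i..<N. f j)" for f :: "nat \<Rightarrow> real"
      proof -
        have "{..<N} = {..<i} \<union> insert i {Suc i..<N}" using i by auto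
        then show ?thesis by (simp add: prod.union_disjoint disjoint_iff mult.assoc)
      qed
      have s: "sinh (gm i * len i / 2) = (p i - 1 / p i) / 2"
        by (simp add: sinh_field_def p_def exp_minus inverse_eq_divide)
      have c: "mm i = (P i * p i)\<^sup>2 * ((1 - 1 / (p i)\<^sup>2) / gm i)"
      proof -
        have "exp (- gm i * len i) = 1 / (p i)\<^sup>2"
          by (simp add: p_def power2_eq_square exp_minus inverse_eq_divide flip: exp_add)
        then show ?thesis unfolding mm_def cc_def pp by (simp add: P_def)
      qed
      define X where "X = (\<Prod>j=Suc i..<N. p j)"
      define Y where "Y = (\<Prod>j<i. gm j / 2) * (\<Prod>j=Suc i..<N. gm j / 2)"
      have X: "0 < X" by (simp add: X_def prod_pos p_pos)
      have PN: "P N = P i * p i * X" unfolding P_def X_def using split by blast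
      have GN: "G = Y * (gm i / 2)" unfolding G_def Y_def split[of "\<lambda>j. gm j / 2"] by (simp add: mult_ac)
      have "sinh (gm i * len i / 2) * ((\<Prod>j<i. gm j / 2) * P i) * ((\<Prod>j=Suc i..<N. gm j / 2) * (1 / X))
        = Y * ((p i - 1 / p i) / 2 * P i / X)"
        unfolding s Y_def by simp
      also have "\<dots> = G / P N * mm i"
        unfolding GN PN c using gm_nonzero[OF i] p_pos[of i] P_pos[of i] X
        by (simp add: field_simps power2_eq_square)
      finally show ?thesis unfolding A B X_def .
    qed
    have "(\<Sum>i=1..N. f i) = (\<Sum>i<N. f (Suc i))" for f :: "nat \<Rightarrow> real"
      using sum.atLeast1_atMost_eq[of f N] by simp
    then show ?thesis
      unfolding sum_distrib_left by (simp only: len) (rule sum.cong, use summand in auto)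
  qed
  have "omega1_coeff S = - \<i> * of_real (vb\<^sup>2 * (G * (P N + 1 / P N)) / (v * (G / P N * (\<Sum>j<N. mm j))))"
    unfolding omega1_coeff_def Let_def num den ..
  also have "vb\<^sup>2 * (G * (P N + 1 / P N)) / (v * (G / P N * (\<Sum>j<N. mm j))) = vb\<^sup>2 * (pp N + 1) / (v * (\<Sum>j<N. mm j))"
    using Gnz P_pos[of N] sum_mm_pos v_pos unfolding pp by (simp add: field_simps power2_eq_square)
  finally show ?thesis by (simp add: w1_def)
qed

end

section \<open>Uniform bounds for modes along a holomorphic branch\<close>

lemma bounded_quotient_nhds:
  fixes f :: "complex \<Rightarrow> complex"
  assumes "f \<in> O[at 0](h)"
  obtains C where "0 \<le> C" "\<forall>\<^sub>F e in at 0. norm (f e) \<le> C * norm (h e)"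
  using assms by (elim landau_o.bigE) (auto intro: less_imp_le)

lemma holomorphic_locally_bounded:
  assumes f: "f holomorphic_on ball 0 \<rho>" "0 < \<rho>"
  shows "\<forall>\<^sub>F e in at 0. norm (f e) \<le> norm (f 0) + 1"
proof -
  have "isCont f 0"
    using holomorphic_on_imp_continuous_on[OF f(1)] f(2) by (simp add: continuous_on_eq_continuous_at)
  then have "((\<lambda>e. norm (f e)) \<longlongrightarrow> norm (f 0)) (at 0)"
    by (intro tendsto_norm) (simp add: isCont_def)
  then have "\<forall>\<^sub>F e in at 0. norm (f e) < norm (f 0) + 1"
    by (rule order_tendstoD) simp
  then show ?thesis by (rule eventually_mono) simp
qed

text \<open>The bound is uniform in y for one fixed e, so each interval may first receive its own K
  before finitely many conditions are combined.\<close>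

definition interior_close :: "real \<Rightarrow> complex \<Rightarrow> real \<Rightarrow> complex \<Rightarrow> complex \<Rightarrow> complex \<Rightarrow> complex \<Rightarrow> real \<Rightarrow> complex \<Rightarrow> bool" where
  "interior_close Y \<alpha> c q u d u0 K e \<longleftrightarrow> (\<forall>y. \<bar>y\<bar> \<le> Y \<longrightarrow>
     norm (\<alpha> * gen_sol c q u d y - u0) \<le> K * norm e \<and> norm (\<alpha> * dgen_sol c q u d y) \<le> K * (norm e)\<^sup>2)"

definition exterior_close :: "real \<Rightarrow> complex \<Rightarrow> complex \<Rightarrow> complex \<Rightarrow> complex \<Rightarrow> complex \<Rightarrow> complex \<Rightarrow> real \<Rightarrow> complex \<Rightarrow> bool" where
  "exterior_close Y \<alpha> q u d u0 d0 K e \<longleftrightarrow> (\<forall>y. \<bar>y\<bar> \<le> Y \<longrightarrow>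
     norm (\<alpha> * gen_sol 0 q u d y - (u0 + d0 * of_real y)) \<le> K * norm e
   \<and> norm (\<alpha> * dgen_sol 0 q u d y - d0) \<le> K * norm e)"

lemma interior_close_mono: "interior_close Y \<alpha> c q u d u0 K e \<Longrightarrow> K \<le> K' \<Longrightarrow> interior_close Y \<alpha> c q u d u0 K' e"
  and exterior_close_mono: "exterior_close Y \<alpha> q u d u0 d0 K e \<Longrightarrow> K \<le> K' \<Longrightarrow> exterior_close Y \<alpha> q u d u0 d0 K' e"
  unfolding interior_close_def exterior_close_def
  by (meson mult_right_mono norm_ge_zero order_trans zero_le_power2)+

text \<open>On both kinds of intervals the coefficient of the differential equation is of order \<open>e\<^sup>2\<close>; inside
  a resonator so is the initial slope.\<close>

lemma interior_mode_bound:
  assumes \<rho>: "0 < \<rho>" and u: "u holomorphic_on ball 0 \<rho>" and d: "d holomorphic_on ball 0 \<rho>"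
    and q: "q holomorphic_on ball 0 \<rho>"
  obtains K where "0 \<le> K" "\<forall>\<^sub>F e in at 0. interior_close Y \<alpha> c (e\<^sup>2 * q e) (u e) (e\<^sup>2 * d e) (\<alpha> * u 0) K e"
proof -
  obtain C where C: "0 \<le> C" "\<And>q u d y. norm q \<le> 1 \<Longrightarrow> \<bar>y\<bar> \<le> Y \<Longrightarrow>
    norm (dgen_sol c q u d y) \<le> C * (norm q * norm u + norm d)
    \<and> norm (gen_sol c q u d y - u) \<le> C * (norm q * norm u + norm d)"
    by (rule gen_sol_interior_estimate) blast
  obtain L where L: "0 \<le> L" "\<forall>\<^sub>F e in at 0. norm (u e - u 0) \<le> L * norm e"
    by (rule bounded_quotient_nhds[OF holomorphic_bigo_linear[OF u \<rho>]]) auto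
  \<comment> \<open>Near 0 each holomorphic factor is bounded by its norm at 0 plus 1.\<close>
  define B where "B = C * ((norm (q 0) + 1) * (norm (u 0) + 1) + (norm (d 0) + 1))"
  have B: "0 \<le> B" using C(1) by (simp add: B_def)
  have sq: "((\<lambda>e::complex. e\<^sup>2 * q e) \<longlongrightarrow> 0\<^sup>2 * q 0) (at 0)"
  proof -
    have "isCont q 0"
      using holomorphic_on_imp_continuous_on[OF q] \<rho> by (simp add: continuous_on_eq_continuous_at)
    then show ?thesis by (intro tendsto_intros) (auto simp: isCont_def)
  qed
  then have "((\<lambda>e. norm (e\<^sup>2 * q e)) \<longlongrightarrow> 0) (at 0)" by (auto intro: tendsto_norm_zero)
  then have small: "\<forall>\<^sub>F e in at 0. norm (e\<^sup>2 * q e) < 1" by (rule order_tendstoD) simp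
  have e1: "\<forall>\<^sub>F e in at (0::complex). norm e < 1"
    using eventually_at[of "\<lambda>e::complex. norm e < 1" 0 UNIV] by (auto intro!: exI[of _ 1] simp: dist_norm)
  show thesis
  proof (rule that[of "norm \<alpha> * (B + L)"])
    show "0 \<le> norm \<alpha> * (B + L)" using B L by simp
    show "\<forall>\<^sub>F e in at 0. interior_close Y \<alpha> c (e\<^sup>2 * q e) (u e) (e\<^sup>2 * d e) (\<alpha> * u 0) (norm \<alpha> * (B + L)) e"
      using small e1 L(2) holomorphic_locally_bounded[OF u \<rho>] holomorphic_locally_bounded[OF d \<rho>]
        holomorphic_locally_bounded[OF q \<rho>]
    proof eventually_elim
      case (elim e)
      have "C * (norm (e\<^sup>2 * q e) * norm (u e) + norm (e\<^sup>2 * d e))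
          = C * (norm (q e) * norm (u e) + norm (d e)) * (norm e)\<^sup>2"
        by (simp add: norm_mult norm_power algebra_simps)
      also have "\<dots> \<le> B * (norm e)\<^sup>2"
        unfolding B_def using elim C(1) by (intro mult_right_mono mult_left_mono add_mono mult_mono) auto
      finally have b: "C * (norm (e\<^sup>2 * q e) * norm (u e) + norm (e\<^sup>2 * d e)) \<le> B * (norm e)\<^sup>2" .
      have ee: "(norm e)\<^sup>2 \<le> norm e" using elim by (simp add: power2_eq_square mult_left_le_one_le)
      show ?case
        unfolding interior_close_def
      proof (intro allI impI conjI)
        fix y assume y: "\<bar>y\<bar> \<le> Y"
        note est = C(2)[OF less_imp_le[OF elim(1)] y, of "u e" "e\<^sup>2 * d e"]
        let ?g = "gen_sol c (e\<^sup>2 * q e) (u e) (e\<^sup>2 * d e) y"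
        let ?g' = "dgen_sol c (e\<^sup>2 * q e) (u e) (e\<^sup>2 * d e) y"
        have "norm (?g - u 0) \<le> norm (?g - u e) + norm (u e - u 0)"
          using norm_triangle_ineq[of "?g - u e" "u e - u 0"] by simp
        also have "\<dots> \<le> B * norm e + L * norm e"
          using est b elim(3) mult_left_mono[OF ee B] by linarith
        finally have "norm \<alpha> * norm (?g - u 0) \<le> norm \<alpha> * ((B + L) * norm e)"
          by (intro mult_left_mono) (auto simp: algebra_simps)
        then show "norm (\<alpha> * ?g - \<alpha> * u 0) \<le> norm \<alpha> * (B + L) * norm e"
          by (simp add: norm_mult mult.assoc flip: right_diff_distrib)
        have "norm ?g' \<le> (B + L) * (norm e)\<^sup>2"
          using est b mult_right_mono[of B "B + L" "(norm e)\<^sup>2"] L(1) by simp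
        then have "norm \<alpha> * norm ?g' \<le> norm \<alpha> * ((B + L) * (norm e)\<^sup>2)"
          by (intro mult_left_mono) auto
        then show "norm (\<alpha> * ?g') \<le> norm \<alpha> * (B + L) * (norm e)\<^sup>2"
          by (simp add: norm_mult mult.assoc)
      qed
    qed
  qed
qed

lemma exterior_mode_bound:
  assumes \<rho>: "0 < \<rho>" and u: "u holomorphic_on ball 0 \<rho>" and d: "d holomorphic_on ball 0 \<rho>"
    and q: "q holomorphic_on ball 0 \<rho>" and Y: "0 \<le> Y"
  obtains K where "0 \<le> K" "\<forall>\<^sub>F e in at 0. exterior_close Y \<alpha> (e\<^sup>2 * q e) (u e) (d e) (\<alpha> * u 0) (\<alpha> * d 0) K e"
proof -
  obtain C where C: "0 \<le> C" "\<And>q u d y. norm q \<le> 1 \<Longrightarrow> \<bar>y\<bar> \<le> Y \<Longrightarrow>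
    norm (dgen_sol 0 q u d y - d) \<le> C * (norm q * (norm u + norm d))
    \<and> norm (gen_sol 0 q u d y - (u + d * of_real y)) \<le> C * (norm q * (norm u + norm d))"
    by (rule gen_sol_exterior_estimate) blast
  obtain L where L: "0 \<le> L" "\<forall>\<^sub>F e in at 0. norm (u e - u 0) \<le> L * norm e"
    by (rule bounded_quotient_nhds[OF holomorphic_bigo_linear[OF u \<rho>]]) auto
  obtain L' where L': "0 \<le> L'" "\<forall>\<^sub>F e in at 0. norm (d e - d 0) \<le> L' * norm e"
    by (rule bounded_quotient_nhds[OF holomorphic_bigo_linear[OF d \<rho>]]) auto
  define B where "B = C * ((norm (q 0) + 1) * ((norm (u 0) + 1) + (norm (d 0) + 1)))"
  have B: "0 \<le> B" using C(1) by (simp add: B_def)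
  have sq: "((\<lambda>e::complex. e\<^sup>2 * q e) \<longlongrightarrow> 0\<^sup>2 * q 0) (at 0)"
  proof -
    have "isCont q 0"
      using holomorphic_on_imp_continuous_on[OF q] \<rho> by (simp add: continuous_on_eq_continuous_at)
    then show ?thesis by (intro tendsto_intros) (auto simp: isCont_def)
  qed
  then have "((\<lambda>e. norm (e\<^sup>2 * q e)) \<longlongrightarrow> 0) (at 0)" by (auto intro: tendsto_norm_zero)
  then have small: "\<forall>\<^sub>F e in at 0. norm (e\<^sup>2 * q e) < 1" by (rule order_tendstoD) simp
  have e1: "\<forall>\<^sub>F e in at (0::complex). norm e < 1"
    using eventually_at[of "\<lambda>e::complex. norm e < 1" 0 UNIV] by (auto intro!: exI[of _ 1] simp: dist_norm)
  define K where "K = B + L + L' * (1 + Y)"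
  show thesis
  proof (rule that[of "norm \<alpha> * K"])
    show "0 \<le> norm \<alpha> * K" using B L L' Y by (simp add: K_def)
    show "\<forall>\<^sub>F e in at 0. exterior_close Y \<alpha> (e\<^sup>2 * q e) (u e) (d e) (\<alpha> * u 0) (\<alpha> * d 0) (norm \<alpha> * K) e"
      using small e1 L(2) L'(2) holomorphic_locally_bounded[OF u \<rho>] holomorphic_locally_bounded[OF d \<rho>]
        holomorphic_locally_bounded[OF q \<rho>]
    proof eventually_elim
      case (elim e)
      have "C * (norm (e\<^sup>2 * q e) * (norm (u e) + norm (d e)))
          = C * (norm (q e) * (norm (u e) + norm (d e))) * (norm e)\<^sup>2"
        by (simp add: norm_mult norm_power algebra_simps)
      also have "\<dots> \<le> B * (norm e)\<^sup>2"
        unfolding B_def using elim C(1) by (intro mult_right_mono mult_left_mono add_mono mult_mono) auto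
      also have "\<dots> \<le> B * norm e"
        using elim B by (intro mult_left_mono) (auto simp: power2_eq_square mult_left_le_one_le)
      finally have b: "C * (norm (e\<^sup>2 * q e) * (norm (u e) + norm (d e))) \<le> B * norm e" .
      show ?case
        unfolding exterior_close_def
      proof (intro allI impI conjI)
        fix y assume y: "\<bar>y\<bar> \<le> Y"
        note est = C(2)[OF less_imp_le[OF elim(1)] y, of "u e" "d e"]
        let ?g = "gen_sol 0 (e\<^sup>2 * q e) (u e) (d e) y"
        let ?g' = "dgen_sol 0 (e\<^sup>2 * q e) (u e) (d e) y"
        have dy: "norm ((d e - d 0) * of_real y) \<le> L' * norm e * Y"
          unfolding norm_mult using elim(4) y L'(1) by (intro mult_mono) auto
        have eq: "?g - (u 0 + d 0 * of_real y)
            = (?g - (u e + d e * of_real y)) + ((u e - u 0) + (d e - d 0) * of_real y)"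
          by (simp add: algebra_simps)
        have "norm (?g - (u 0 + d 0 * of_real y))
            \<le> norm (?g - (u e + d e * of_real y)) + (norm (u e - u 0) + norm ((d e - d 0) * of_real y))"
          unfolding eq
          using norm_triangle_ineq[of "?g - (u e + d e * of_real y)" "(u e - u 0) + (d e - d 0) * of_real y"]
            norm_triangle_ineq[of "u e - u 0" "(d e - d 0) * of_real y"] by linarith
        also have "\<dots> \<le> B * norm e + (L * norm e + L' * norm e * Y)"
          using est b elim(3) dy by linarith
        also have "\<dots> \<le> K * norm e"
          using L'(1) by (simp add: K_def algebra_simps)
        finally have "norm \<alpha> * norm (?g - (u 0 + d 0 * of_real y)) \<le> norm \<alpha> * (K * norm e)"
          by (intro mult_left_mono) auto
        moreover have "\<alpha> * ?g - (\<alpha> * u 0 + \<alpha> * d 0 * of_real y) = \<alpha> * (?g - (u 0 + d 0 * of_real y))"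
          by (simp add: algebra_simps)
        ultimately show "norm (\<alpha> * ?g - (\<alpha> * u 0 + \<alpha> * d 0 * of_real y)) \<le> norm \<alpha> * K * norm e"
          by (simp only: norm_mult mult.assoc)
        have "norm (?g' - d 0) \<le> norm (?g' - d e) + norm (d e - d 0)"
          using norm_triangle_ineq[of "?g' - d e" "d e - d 0"] by simp
        also have "\<dots> \<le> B * norm e + L' * norm e"
          using est b elim(4) by linarith
        also have "\<dots> \<le> K * norm e"
          using L(1) L'(1) Y by (simp add: K_def algebra_simps)
        finally have "norm \<alpha> * norm (?g' - d 0) \<le> norm \<alpha> * (K * norm e)"
          by (intro mult_left_mono) auto
        then show "norm (\<alpha> * ?g' - \<alpha> * d 0) \<le> norm \<alpha> * K * norm e"
          by (simp add: norm_mult mult.assoc flip: right_diff_distrib)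
      qed
    qed
  qed
qed

context resonators
begin

subsection \<open>The form of the eigenmodes\<close>

definition mode_val :: "real vec \<Rightarrow> nat \<Rightarrow> complex" where
  "mode_val a j = of_real (if j = 0 then vec_index a 0 else vec_index a (j - 1))"

text \<open>On both outer intervals the flux is a multiple of w and vanishes at leading order, so
  the slopes are 0; correspondingly \<open>mode_val a 0\<close> repeats the first entry.\<close>

definition mode_slope :: "real vec \<Rightarrow> nat \<Rightarrow> complex" where
  "mode_slope a j = (if j = 0 \<or> N \<le> j then 0 else (mode_val a (j + 1) - mode_val a j) / of_real (res_gap S j))"

lemma NR_solution_differentiable:
  assumes "NR_solution S d w u"
  shows "i < N \<Longrightarrow> lf i < x \<Longrightarrow> x < rg i \<Longrightarrow> u differentiable at x"
    and "i \<le> N \<Longrightarrow> x \<in> ext_comp i \<Longrightarrow> u differentiable at x"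
proof -
  show "u differentiable at x" if "i < N" "lf i < x" "x < rg i"
  proof -
    have "ode_on {left_end S (Suc i)<..<right_end S (Suc i)} (of_real (gauge S (Suc i))) (w\<^sup>2 / of_real (vb\<^sup>2)) u"
      using assms that(1) unfolding NR_solution_def by auto
    then show ?thesis using that unfolding ode_on_def by auto
  qed
  show "u differentiable at x" if "i \<le> N" "x \<in> ext_comp i"
    using assms ext_comp_exterior[OF that] unfolding NR_solution_def ode_on_def by auto
qed

lemma Dx_cmult:
  assumes "u differentiable at x"
  shows "Dx (\<lambda>x. c * u x) x = c * Dx u x"
  by (rule vector_derivative_at, rule has_vector_derivative_mult_right)
    (use assms in \<open>simp add: vector_derivative_works\<close>)

text \<open>An eigenmode is a multiple of the recursion mode, whose data at e = 0 are the
  unperturbed recursion at \<open>f 0\<close> squared. Rescaling by the first entry of a makes these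
  the eigenvector and its difference quotients.\<close>

lemma mode_form_along_curve:
  assumes \<rho>: "0 < \<rho>" and f: "f holomorphic_on ball 0 \<rho>" "(f 0)\<^sup>2 = of_real (v * vb * l)"
    and a: "eigenvector (cap_mat S) a l"
    and M: "- M < left_end S 1" "right_end S N < M"
  obtains K where "\<forall>\<^sub>F e in at 0. \<forall>u. eigenmode S (e\<^sup>2) (e * f e) u
     \<longrightarrow> (\<exists>c. c \<noteq> 0 \<and> mode_form S M K (mode_val a) (mode_slope a) (e\<^sup>2) (\<lambda>x. c * u x))"
proof -
  define \<alpha> :: complex where "\<alpha> = of_real (vec_index a 0)"
  define \<mu> :: complex where "\<mu> = of_real (v * vb * l)"
  define uu where "uu i e = uL (e * f e) (e\<^sup>2) 1 ((f e)\<^sup>2) i" for i e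
  define FF where "FF i e = FL (e * f e) (e\<^sup>2) 1 ((f e)\<^sup>2) i" for i e
  define xx where "xx i e = (if i = 0 then 1 else uR (e * f e) (e\<^sup>2) 1 ((f e)\<^sup>2) (i - 1))" for i e
  define yy where "yy i e = (if i = 0 then - \<i> * (e * f e) / of_real v else FR (e * f e) (e\<^sup>2) 1 ((f e)\<^sup>2) (i - 1))" for i e
  define q1 where "q1 e = (f e)\<^sup>2 / of_real (vb\<^sup>2)" for e
  define q2 where "q2 e = (f e)\<^sup>2 / of_real (v\<^sup>2)" for e
  have hL: "uu i holomorphic_on ball 0 \<rho>" "FF i holomorphic_on ball 0 \<rho>" for i
    unfolding uu_def[abs_def] FF_def[abs_def] by (intro holomorphic_curve f)+
  have hR: "xx i holomorphic_on ball 0 \<rho>" "yy i holomorphic_on ball 0 \<rho>" for i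
    unfolding xx_def[abs_def] yy_def[abs_def] using v_pos
    by (cases "i = 0"; auto intro!: holomorphic_curve holomorphic_intros f)+
  have hq: "q1 holomorphic_on ball 0 \<rho>" "q2 holomorphic_on ball 0 \<rho>"
    unfolding q1_def[abs_def] q2_def[abs_def] using f v_pos vb_pos by (auto intro!: holomorphic_intros)
  have q: "qi (e * f e) = e\<^sup>2 * q1 e" "qo (e * f e) = e\<^sup>2 * q2 e" for e
    by (simp_all add: qi_def qo_def q1_def q2_def power_mult_distrib)
  \<comment> \<open>Dominates the distance from the base point for all x in a resonator or in an
    exterior component cut off at -M and M.\<close>
  define Y where "Y = \<bar>M\<bar> + \<bar>lf 0\<bar> + (\<Sum>j<N. \<bar>lf j\<bar> + \<bar>rg j\<bar>)"
  have Y0: "0 \<le> Y" by (auto simp: Y_def intro!: add_nonneg_nonneg sum_nonneg)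
  have Yj: "\<bar>lf j\<bar> + \<bar>rg j\<bar> \<le> Y" "\<bar>M\<bar> + (\<bar>lf j\<bar> + \<bar>rg j\<bar>) \<le> Y" if "j < N" for j
  proof -
    have "\<bar>lf j\<bar> + \<bar>rg j\<bar> \<le> (\<Sum>j<N. \<bar>lf j\<bar> + \<bar>rg j\<bar>)"
      using that by (intro member_le_sum) auto
    then show "\<bar>lf j\<bar> + \<bar>rg j\<bar> \<le> Y" "\<bar>M\<bar> + (\<bar>lf j\<bar> + \<bar>rg j\<bar>) \<le> Y" by (auto simp: Y_def)
  qed
  define int where "int i K e = interior_close Y \<alpha> (gm i) (e\<^sup>2 * q1 e) (uu i e) (e\<^sup>2 * FF i e) (\<alpha> * uu i 0) K e" for i K e
  define ext where "ext i K e = exterior_close Y \<alpha> (e\<^sup>2 * q2 e) (xx i e) (yy i e) (\<alpha> * xx i 0) (\<alpha> * yy i 0) K e" for i K e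
  have "\<forall>i. \<exists>K\<ge>0. \<forall>\<^sub>F e in at 0. int i K e"
    unfolding int_def by (rule allI, rule interior_mode_bound[OF \<rho> hL hq(1)]) blast
  from choice[OF this] obtain K1 where K1: "\<And>i. 0 \<le> K1 i" "\<And>i. \<forall>\<^sub>F e in at 0. int i (K1 i) e" by blast
  have "\<forall>i. \<exists>K\<ge>0. \<forall>\<^sub>F e in at 0. ext i K e"
    unfolding ext_def by (rule allI, rule exterior_mode_bound[OF \<rho> hR hq(2) Y0]) blast
  from choice[OF this] obtain K2 where K2: "\<And>i. 0 \<le> K2 i" "\<And>i. \<forall>\<^sub>F e in at 0. ext i (K2 i) e" by blast
  define K where "K = (\<Sum>i\<le>N. K1 i + K2 i)"
  have K: "K1 i \<le> K" "K2 i \<le> K" if "i \<le> N" for i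
  proof -
    have "K1 i + K2 i \<le> K" unfolding K_def using that K1(1) K2(1) by (intro member_le_sum) auto
    then show "K1 i \<le> K" "K2 i \<le> K" using K1(1)[of i] K2(1)[of i] by linarith+
  qed
  have val: "\<alpha> * uu i 0 = mode_val a (Suc i)" if "i < N" for i
    using eigenvector_shape(2)[OF a that] f(2) by (simp add: uu_def \<alpha>_def mode_val_def \<mu>_def)
  have xval: "\<alpha> * xx i 0 = mode_val a i" if "i \<le> N" for i
  proof (cases i)
    case (Suc k)
    then show ?thesis using val[of k] unperturbed_right(1)[of k] that by (simp add: xx_def uu_def)
  qed (simp add: xx_def \<alpha>_def mode_val_def)
  have yval: "\<alpha> * yy i 0 = mode_slope a i" if "i \<le> N" for i
  proof (cases i)
    case (Suc k)
    then have k: "k < N" using that by simp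
    have y: "yy i 0 = \<mu> * Q \<mu> k" using k by (simp add: yy_def Suc unperturbed_right f \<mu>_def)
    show ?thesis
    proof (cases "Suc k < N")
      case True
      then show ?thesis
        using eigenvector_shape(3)[OF a True] unfolding y
        by (simp add: mode_slope_def mode_val_def Suc res_gap_def \<alpha>_def \<mu>_def)
    next
      case False
      then have "k = N - 1" using k by simp
      then show ?thesis using eigenvector_shape(4)[OF a] False unfolding y
        by (simp add: mode_slope_def Suc \<mu>_def)
    qed
  qed (simp add: yy_def mode_slope_def)
  have "\<forall>\<^sub>F e in at 0. e \<noteq> (0::complex)" by (simp add: eventually_at_filter)
  moreover have "\<forall>\<^sub>F e in at 0. \<forall>i\<in>{..N}. int i (K1 i) e" "\<forall>\<^sub>F e in at 0. \<forall>i\<in>{..N}. ext i (K2 i) e"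
    by (rule eventually_ball_finite; use K1(2) K2(2) in simp)+
  ultimately have "\<forall>\<^sub>F e in at 0. \<forall>u. eigenmode S (e\<^sup>2) (e * f e) u
     \<longrightarrow> (\<exists>c. c \<noteq> 0 \<and> mode_form S M K (mode_val a) (mode_slope a) (e\<^sup>2) (\<lambda>x. c * u x))"
  proof eventually_elim
    case (elim e)
    note E0 = elim(1)
    have int': "norm (\<alpha> * gen_sol (gm i) (e\<^sup>2 * q1 e) (uu i e) (e\<^sup>2 * FF i e) y - mode_val a (Suc i)) \<le> K * norm e"
      "norm (\<alpha> * dgen_sol (gm i) (e\<^sup>2 * q1 e) (uu i e) (e\<^sup>2 * FF i e) y) \<le> K * (norm e)\<^sup>2"
      if "i < N" "\<bar>y\<bar> \<le> Y" for i y
      using interior_close_mono[OF elim(2)[rule_format, of i, unfolded int_def] K(1)[of i]] that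
      unfolding interior_close_def val[OF that(1)] by auto
    have ext': "norm (\<alpha> * gen_sol 0 (e\<^sup>2 * q2 e) (xx i e) (yy i e) y - (mode_val a i + mode_slope a i * of_real y)) \<le> K * norm e"
      "norm (\<alpha> * dgen_sol 0 (e\<^sup>2 * q2 e) (xx i e) (yy i e) y - mode_slope a i) \<le> K * norm e"
      if "i \<le> N" "\<bar>y\<bar> \<le> Y" for i y
      using exterior_close_mono[OF elim(3)[rule_format, of i, unfolded ext_def] K(2)[of i]] that
      unfolding exterior_close_def xval[OF that(1)] yval[OF that(1)] by auto
    have e2: "(e * f e)\<^sup>2 / e\<^sup>2 = (f e)\<^sup>2" using E0 by (simp add: power_mult_distrib)
    have rm: "res_mode (e * f e) (e\<^sup>2) i x = gen_sol (gm i) (e\<^sup>2 * q1 e) (uu i e) (e\<^sup>2 * FF i e) (x - lf i)"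
      "dres_mode (e * f e) (e\<^sup>2) i x = dgen_sol (gm i) (e\<^sup>2 * q1 e) (uu i e) (e\<^sup>2 * FF i e) (x - lf i)" for i x
      unfolding res_mode_def dres_mode_def e2 q uu_def FF_def by simp_all
    have em: "ext_mode (e * f e) (e\<^sup>2) i x = gen_sol 0 (e\<^sup>2 * q2 e) (xx i e) (yy i e) (x - ext_base i)"
      "dext_mode (e * f e) (e\<^sup>2) i x = dgen_sol 0 (e\<^sup>2 * q2 e) (xx i e) (yy i e) (x - ext_base i)" for i x
      unfolding ext_mode_def dext_mode_def ext_val_def ext_flux_def e2 q xx_def yy_def by simp_all
    show ?case
    proof (intro allI impI)
      fix u assume u: "eigenmode S (e\<^sup>2) (e * f e) u"
      then obtain x0 where nr: "NR_solution S (e\<^sup>2) (e * f e) u" and x0: "x0 \<notin> interfaces S" "u x0 \<noteq> 0"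
        by (auto simp: eigenmode_def)
      obtain c where c:
        "\<And>i x. i < N \<Longrightarrow> lf i < x \<Longrightarrow> x < rg i \<Longrightarrow> u x = c * res_mode (e * f e) (e\<^sup>2) i x \<and> Dx u x = c * dres_mode (e * f e) (e\<^sup>2) i x"
        "\<And>i x. i \<le> N \<Longrightarrow> x \<in> ext_comp i \<Longrightarrow> u x = c * ext_mode (e * f e) (e\<^sup>2) i x \<and> Dx u x = c * dext_mode (e * f e) (e\<^sup>2) i x"
        by (rule NR_solution_shape[OF nr]) (use E0 in auto)
      have c0: "c \<noteq> 0"
      proof (rule position_cases[OF x0(1)])
        show "c \<noteq> 0" if "i < N" "lf i < x0" "x0 < rg i" for i
          using c(1)[OF that] x0(2) by force
        show "c \<noteq> 0" if "i \<le> N" "x0 \<in> ext_comp i" for i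
          using c(2)[OF that] x0(2) by force
      qed
      \<comment> \<open>Cancels the arbitrary multiple c and installs the first entry of the
        eigenvector.\<close>
      define c' where "c' = \<alpha> / c"
      have c': "c' \<noteq> 0" "c' * c = \<alpha>"
        using c0 eigenvector_shape(1)[OF a] by (simp_all add: c'_def \<alpha>_def)
      have cc: "c' * (c * z) = \<alpha> * z" for z using c'(2) by (simp flip: mult.assoc)
      have pw: "norm (e\<^sup>2) powr (1/2) = norm e" "norm (e\<^sup>2) = (norm e)\<^sup>2"
        by (simp_all add: norm_power powr_half_sqrt)
      have "mode_form S M K (mode_val a) (mode_slope a) (e\<^sup>2) (\<lambda>x. c' * u x)"
        unfolding mode_form_def pw(1) unfolding pw(2)
      proof (intro conjI ballI)
        fix j x assume j: "j \<in> {1..N}" and x: "x \<in> {left_end S j<..<right_end S j}"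
        obtain i where i: "j = Suc i" "i < N" using j by (cases j) auto
        have xi: "lf i < x" "x < rg i" using x i by auto
        have y: "\<bar>x - lf i\<bar> \<le> Y" using Yj(1)[OF i(2)] xi by linarith
        show "norm (c' * u x - mode_val a j) \<le> K * norm e"
          using int'(1)[OF i(2) y] c(1)[OF i(2) xi] by (simp add: cc rm i)
        show "norm (Dx (\<lambda>x. c' * u x) x) \<le> K * (norm e)\<^sup>2"
          using int'(2)[OF i(2) y] c(1)[OF i(2) xi] Dx_cmult[OF NR_solution_differentiable(1)[OF nr i(2) xi], of c']
          by (simp add: cc rm)
      next
        fix j x assume j: "j \<in> {0..N}" and x: "x \<in> {ext_right S M j<..<ext_left S M (j + 1)}"
        then have jN: "j \<le> N" by simp
        have xj: "x \<in> ext_comp j"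
          using x jN by (auto simp: ext_comp_def ext_right_def ext_left_def split: if_splits)
        have Mx: "- M < x" "x < M" and y: "\<bar>x - ext_base j\<bar> \<le> Y"
        proof -
          have NN: "right_end S N = rg (N - 1)" using N_pos by simp
          have "- M < x \<and> (j \<noteq> 0 \<longrightarrow> right_end S j < x)"
          proof (cases j)
            case (Suc k)
            then have "lf 0 \<le> lf k" "lf k < rg k" using jN rg_less_lf_mono[of 0 k] lf_less_rg[of 0] lf_less_rg[of k] N_pos
              by (cases "k = 0"; force)+
            then show ?thesis using x M Suc by (auto simp: ext_right_def)
          qed (use x in \<open>auto simp: ext_right_def\<close>)
          moreover have "x < M"
          proof (cases "j = N")
            case False
            then have jlt: "j < N" using jN by simp
            have "lf j < rg j" by (rule lf_less_rg[OF jlt])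
            moreover have "rg j \<le> rg (N - 1)"
            proof (cases "j = N - 1")
              case False
              then have "j < N - 1" "N - 1 < N" using jlt by auto
              then show ?thesis using rg_less_lf_mono[of j "N - 1"] lf_less_rg[of "N - 1"] by linarith
            qed simp
            moreover have "x < lf j" using x False by (simp add: ext_left_def)
            ultimately show ?thesis using M(2) NN by linarith
          qed (use x in \<open>auto simp: ext_left_def\<close>)
          ultimately show "- M < x" "x < M" by auto
          show "\<bar>x - ext_base j\<bar> \<le> Y"
          proof (cases j)
            case 0
            then show ?thesis using Yj(2)[of 0] N_pos \<open>- M < x\<close> \<open>x < M\<close> by (simp add: ext_base_def)
          next
            case (Suc k)
            then show ?thesis using Yj(2)[of k] jN \<open>- M < x\<close> \<open>x < M\<close> by (simp add: ext_base_def)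
          qed
        qed
        \<comment> \<open>On the left outer interval the base points \<open>lf 0\<close> and -M
          differ, but the slope there is 0.\<close>
        have base: "mode_val a j + mode_slope a j * of_real (x - ext_base j)
            = mode_val a j + mode_slope a j * of_real (x - ext_right S M j)"
          by (cases "j = 0") (simp_all add: mode_slope_def ext_base_def ext_right_def)
        show "norm (c' * u x - (mode_val a j + mode_slope a j * of_real (x - ext_right S M j))) \<le> K * norm e"
          using ext'(1)[OF jN y] c(2)[OF jN xj] unfolding base by (simp add: cc em)
        show "norm (Dx (\<lambda>x. c' * u x) x - mode_slope a j) \<le> K * norm e"
          using ext'(2)[OF jN y] c(2)[OF jN xj] Dx_cmult[OF NR_solution_differentiable(2)[OF nr jN xj], of c']
          by (simp add: cc em)
      qed
      with c'(1) show "\<exists>c. c \<noteq> 0 \<and> mode_form S M K (mode_val a) (mode_slope a) (e\<^sup>2) (\<lambda>x. c * u x)" by blast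
    qed
  qed
  then show thesis by (rule that)
qed

end

section \<open>Frequencies as germs: identification and counting\<close>

context branch_data
begin

text \<open>\<open>None\<close> stands for the trivial frequency.\<close>

fun scaled :: "complex option \<Rightarrow> complex \<Rightarrow> complex" where
  "scaled None e = 0"
| "scaled (Some z) e = g z e"

definition br :: "complex option \<Rightarrow> complex \<Rightarrow> complex" where
  "br b \<delta> = sqrt_up \<delta> * scaled b (sqrt_up \<delta>)"

definition I :: "complex option set" where "I = insert None (Some ` Z)"

lemma finite_I: "finite I" by (simp add: I_def finite_Z)

lemma scaled_holomorphic: "b \<in> I \<Longrightarrow> scaled b holomorphic_on ball 0 \<rho>"
proof -
  have "scaled None = (\<lambda>_. 0)" "scaled (Some z) = g z" for z by auto
  then show "b \<in> I \<Longrightarrow> ?thesis" by (auto simp: I_def g_holomorphic)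
qed

lemma sqrt_up_lt: "norm \<delta> < \<rho>\<^sup>2 \<Longrightarrow> norm (sqrt_up \<delta>) < \<rho>"
  unfolding sqrt_up_norm using \<rho>_pos by (metis real_sqrt_less_iff real_sqrt_unique less_imp_le)

lemma br_resonant:
  assumes "b \<in> I" "\<delta> \<noteq> 0" "norm \<delta> < \<rho>\<^sup>2"
  shows "resonant_frequency S \<delta> (br b \<delta>)"
proof -
  have "resonant_frequency S ((sqrt_up \<delta>)\<^sup>2) (sqrt_up \<delta> * scaled b (sqrt_up \<delta>))"
    using assms Hf_g[OF _ sqrt_up_lt[OF assms(3)]] by (subst resonant_Hf) (auto simp: I_def)
  then show ?thesis by (simp add: sqrt_up_square br_def)
qed

lemma br_distinct:
  assumes "b \<in> I" "b' \<in> I" "b \<noteq> b'" "\<delta> \<noteq> 0" "norm \<delta> < \<rho>\<^sup>2"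
  shows "br b \<delta> \<noteq> br b' \<delta>"
  using assms g_nonzero[OF _ sqrt_up_lt[OF assms(5)]] g_distinct[OF _ sqrt_up_lt[OF assms(5)]]
  by (auto simp: br_def I_def) metis

lemma br_exhaustive:
  assumes "\<delta> \<noteq> 0" "norm \<delta> < \<rho>\<^sup>2" "norm w < \<eta>" "resonant_frequency S \<delta> w"
  shows "\<exists>b\<in>I. w = br b \<delta>"
proof -
  have "w = 0 \<or> (\<exists>z\<in>Z. w = sqrt_up \<delta> * g z (sqrt_up \<delta>))"
    using exhaustive[of "sqrt_up \<delta>" w] sqrt_up_lt[OF assms(2)] assms by (simp add: sqrt_up_square)
  then show ?thesis by (auto simp: I_def br_def)
qed

text \<open>In polar coordinates the root is sqrt(r) cis(phi / 2), continuous up to phi = 0 even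
  though it jumps across the cut as a function of the contrast.\<close>

lemma br_polar_continuous:
  assumes b: "b \<in> I" and \<epsilon>: "\<epsilon> \<le> \<rho>\<^sup>2"
  shows "continuous_on ({0<..<\<epsilon>} \<times> {0..<2 * pi}) (\<lambda>(r, \<phi>). br b (of_real r * cis \<phi>))"
proof -
  define e where "e p = of_real (sqrt (fst p)) * cis (snd p / 2)" for p :: "real \<times> real"
  have e: "continuous_on ({0<..<\<epsilon>} \<times> {0..<2 * pi}) e"
    unfolding e_def by (intro continuous_intros) auto
  have "e ` ({0<..<\<epsilon>} \<times> {0..<2 * pi}) \<subseteq> ball 0 \<rho>"
  proof
    fix x assume "x \<in> e ` ({0<..<\<epsilon>} \<times> {0..<2 * pi})"
    then obtain r where "0 < r" "r < \<epsilon>" "norm x = sqrt r"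
      by (auto simp: e_def norm_mult)
    then show "x \<in> ball 0 \<rho>"
      using \<epsilon> \<rho>_pos real_less_lsqrt[of \<rho> r] by simp
  qed
  then have "continuous_on ({0<..<\<epsilon>} \<times> {0..<2 * pi}) (\<lambda>p. e p * scaled b (e p))"
    using holomorphic_on_imp_continuous_on[OF scaled_holomorphic[OF b]] e
    by (intro continuous_intros) (auto intro: continuous_on_compose2)
  then show ?thesis
    by (rule continuous_on_eq) (auto simp: e_def br_def sqrt_up_polar)
qed

lemma scaled_tendsto: "b \<in> I \<Longrightarrow> scaled b \<midarrow>0\<rightarrow> scaled b 0"
  using holomorphic_on_imp_continuous_on[OF scaled_holomorphic[of b]] \<rho>_pos
  by (simp add: continuous_on_eq_continuous_at isCont_def)

lemma br_tendsto: "b \<in> I \<Longrightarrow> br b \<midarrow>0\<rightarrow> 0"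
proof -
  assume b: "b \<in> I"
  have 1: "(sqrt_up \<longlongrightarrow> 0) (at 0)" using filterlim_sqrt_up by (simp add: filterlim_at)
  have "((\<lambda>\<delta>. scaled b (sqrt_up \<delta>)) \<longlongrightarrow> scaled b 0) (at 0)"
    by (rule filterlim_compose[OF scaled_tendsto[OF b] filterlim_sqrt_up])
  from tendsto_mult[OF 1 this] show ?thesis by (simp add: br_def[abs_def])
qed

lemma eventually_small: "0 < c \<Longrightarrow> \<forall>\<^sub>F \<delta> in at (0::complex). \<delta> \<noteq> 0 \<and> norm \<delta> < c"
  by (auto simp: eventually_at dist_norm intro!: exI[of _ c])

lemma subwavelength_br:
  assumes b: "b \<in> I" and w: "germ_eq w (br b)"
  shows "subwavelength S w"
  unfolding subwavelength_def
proof
  have "\<forall>\<^sub>F \<delta> in at 0. w \<delta> = br b \<delta> \<and> norm \<delta> < \<rho>\<^sup>2"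
    using w eventually_small[of "\<rho>\<^sup>2"] \<rho>_pos unfolding germ_eq_def by (auto elim: eventually_elim2)
  then obtain \<epsilon> where \<epsilon>: "0 < \<epsilon>" "\<And>\<delta>. \<delta> \<noteq> 0 \<Longrightarrow> norm \<delta> < \<epsilon> \<Longrightarrow> w \<delta> = br b \<delta> \<and> norm \<delta> < \<rho>\<^sup>2"
    unfolding eventually_at by (auto simp: dist_norm)
  define \<epsilon>' where "\<epsilon>' = min \<epsilon> (\<rho>\<^sup>2)"
  have \<epsilon>': "0 < \<epsilon>'" "\<epsilon>' \<le> \<epsilon>" "\<epsilon>' \<le> \<rho>\<^sup>2" using \<epsilon>(1) \<rho>_pos by (auto simp: \<epsilon>'_def)
  show "\<exists>\<epsilon>>0. (\<forall>\<delta>. 0 < norm \<delta> \<and> norm \<delta> < \<epsilon> \<longrightarrow> resonant_frequency S \<delta> (w \<delta>))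
        \<and> continuous_on ({0<..<\<epsilon>} \<times> {0..<2 * pi}) (\<lambda>(\<rho>, \<phi>). w (of_real \<rho> * cis \<phi>))"
  proof (intro exI[of _ \<epsilon>'] conjI allI impI)
    show "resonant_frequency S \<delta> (w \<delta>)" if "0 < norm \<delta> \<and> norm \<delta> < \<epsilon>'" for \<delta>
      using \<epsilon>(2)[of \<delta>] br_resonant[OF b, of \<delta>] that \<epsilon>' by auto
    show "continuous_on ({0<..<\<epsilon>'} \<times> {0..<2 * pi}) (\<lambda>(\<rho>, \<phi>). w (of_real \<rho> * cis \<phi>))"
      by (rule continuous_on_eq[OF br_polar_continuous[OF b \<epsilon>'(3)]])
        (use \<epsilon>(2) \<epsilon>' in \<open>auto simp: norm_mult\<close>)
  qed (use \<epsilon>' in simp)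
  show "w \<midarrow>0\<rightarrow> 0"
    using br_tendsto[OF b] w unfolding germ_eq_def by (rule Lim_transform_eventually[OF _ eventually_mono]) simp
qed

text \<open>Once |w| is below \<open>\<eta>\<close>, each value lies on some branch. Branches have
  disjoint values, and the polar rectangle is convex, hence connected, so the choice cannot change;
  by \<open>Arg2pi\<close> the rectangle reaches every small nonzero point.\<close>

lemma subwavelength_imp_br:
  assumes w: "subwavelength S w"
  obtains b where "b \<in> I" "germ_eq w (br b)"
proof -
  obtain \<epsilon> where \<epsilon>: "0 < \<epsilon>" "\<And>\<delta>. 0 < norm \<delta> \<Longrightarrow> norm \<delta> < \<epsilon> \<Longrightarrow> resonant_frequency S \<delta> (w \<delta>)"
    "continuous_on ({0<..<\<epsilon>} \<times> {0..<2 * pi}) (\<lambda>(\<rho>, \<phi>). w (of_real \<rho> * cis \<phi>))" "(w \<longlongrightarrow> 0) (at 0)"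
    using w unfolding subwavelength_def by auto
  have "\<forall>\<^sub>F \<delta> in at 0. norm (w \<delta>) < \<eta>"
    using order_tendstoD(2)[OF tendsto_norm_zero[OF \<epsilon>(4)] \<eta>_pos] .
  then obtain \<epsilon>1 where \<epsilon>1: "0 < \<epsilon>1" "\<And>\<delta>. \<delta> \<noteq> 0 \<Longrightarrow> norm \<delta> < \<epsilon>1 \<Longrightarrow> norm (w \<delta>) < \<eta>"
    unfolding eventually_at by (auto simp: dist_norm)
  define c where "c = min \<epsilon> (min \<epsilon>1 (\<rho>\<^sup>2))"
  have c: "0 < c" "c \<le> \<epsilon>" "c \<le> \<epsilon>1" "c \<le> \<rho>\<^sup>2" using \<epsilon>(1) \<epsilon>1(1) \<rho>_pos by (auto simp: c_def)
  define X where "X = {0<..<c} \<times> {0..<2 * pi}"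
  have X: "of_real (fst p) * cis (snd p) \<noteq> (0::complex)" "norm (of_real (fst p) * cis (snd p) :: complex) < c" if "p \<in> X" for p
    using that by (auto simp: X_def norm_mult)
  obtain b where b: "b \<in> I" "\<And>p. p \<in> X \<Longrightarrow> (\<lambda>(r, \<phi>). w (of_real r * cis \<phi>)) p = (\<lambda>(r, \<phi>). br b (of_real r * cis \<phi>)) p"
  proof (rule connected_finite_selection[of X "\<lambda>(r, \<phi>). w (of_real r * cis \<phi>)" I "\<lambda>b (r, \<phi>). br b (of_real r * cis \<phi>)"])
    show "connected X" unfolding X_def by (intro convex_connected convex_Times) auto
    have "(c / 2, 0) \<in> X" using c by (simp add: X_def)
    then show "X \<noteq> {}" by blast
    show "continuous_on X (\<lambda>(r, \<phi>). w (of_real r * cis \<phi>))"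
      by (rule continuous_on_subset[OF \<epsilon>(3)]) (use c in \<open>auto simp: X_def\<close>)
    show "finite I" by (rule finite_I)
    show "continuous_on X (\<lambda>(r, \<phi>). br b (of_real r * cis \<phi>))" if "b \<in> I" for b
      unfolding X_def by (rule br_polar_continuous[OF that c(4)])
    show "\<exists>b\<in>I. (\<lambda>(r, \<phi>). w (of_real r * cis \<phi>)) p = (\<lambda>(r, \<phi>). br b (of_real r * cis \<phi>)) p" if "p \<in> X" for p
      unfolding case_prod_unfold using X[OF that] c \<epsilon>(2) \<epsilon>1(2)
      by (intro br_exhaustive) auto
    show "(\<lambda>(r, \<phi>). br b (of_real r * cis \<phi>)) p \<noteq> (\<lambda>(r, \<phi>). br b' (of_real r * cis \<phi>)) p"
      if "p \<in> X" "b \<in> I" "b' \<in> I" "b \<noteq> b'" for p b b'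
      unfolding case_prod_unfold using X[OF that(1)] c that by (intro br_distinct) auto
  qed blast
  have "w \<delta> = br b \<delta>" if "\<delta> \<noteq> 0" "norm \<delta> < c" for \<delta>
  proof -
    have "(norm \<delta>, Arg2pi \<delta>) \<in> X" using that Arg2pi[of \<delta>] by (auto simp: X_def)
    moreover have "\<delta> = of_real (norm \<delta>) * cis (Arg2pi \<delta>)"
      using Arg2pi_eq[of \<delta>] by (simp add: cis_conv_exp)
    ultimately show ?thesis using b(2)[of "(norm \<delta>, Arg2pi \<delta>)"] by simp
  qed
  then have "germ_eq w (br b)"
    unfolding germ_eq_def using eventually_small[OF c(1)] by (auto elim: eventually_mono)
  then show thesis using that b(1) by blast
qed

text \<open>Different branches disagree at every small nonzero contrast, so they have different
  germs, and every germ comes from a branch.\<close>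

lemma card_germs: "card (subwavelength_germs S) = card Z + 1"
proof -
  have sym: "germ_eq f f'" if "germ_eq f' f" for f f'
    using that unfolding germ_eq_def by (auto elim: eventually_mono)
  have trans: "germ_eq f f''" if "germ_eq f f'" "germ_eq f' f''" for f f' f''
    using that unfolding germ_eq_def by eventually_elim simp
  have cls: "{\<eta>. germ_eq w \<eta>} = {\<eta>. germ_eq w' \<eta>}" if "germ_eq w w'" for w w'
    using that sym trans by blast
  have refl: "germ_eq f f" for f by (simp add: germ_eq_def)
  have "subwavelength_germs S = (\<lambda>b. {\<eta>. germ_eq (br b) \<eta>}) ` I"
  proof
    show "subwavelength_germs S \<subseteq> (\<lambda>b. {\<eta>. germ_eq (br b) \<eta>}) ` I"
    proof
      fix C assume "C \<in> subwavelength_germs S"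
      then obtain w where w: "subwavelength S w" "C = {\<eta>. germ_eq w \<eta>}" by (auto simp: subwavelength_germs_def)
      obtain b where "b \<in> I" "germ_eq w (br b)" by (rule subwavelength_imp_br[OF w(1)])
      then show "C \<in> (\<lambda>b. {\<eta>. germ_eq (br b) \<eta>}) ` I" using w(2) cls by blast
    qed
    show "(\<lambda>b. {\<eta>. germ_eq (br b) \<eta>}) ` I \<subseteq> subwavelength_germs S"
      unfolding subwavelength_germs_def using subwavelength_br refl by blast
  qed
  moreover have "inj_on (\<lambda>b. {\<eta>. germ_eq (br b) \<eta>}) I"
  proof (rule inj_onI, rule ccontr)
    fix b b' assume b: "b \<in> I" "b' \<in> I" "{\<eta>. germ_eq (br b) \<eta>} = {\<eta>. germ_eq (br b') \<eta>}" "b \<noteq> b'"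
    then have "germ_eq (br b) (br b')" using refl by blast
    moreover have "\<forall>\<^sub>F \<delta> in at (0::complex). \<delta> \<noteq> 0 \<and> norm \<delta> < \<rho>\<^sup>2"
      using \<rho>_pos by (intro eventually_small) simp
    ultimately have "\<forall>\<^sub>F \<delta> in at (0::complex). False"
      unfolding germ_eq_def by eventually_elim (use br_distinct[OF b(1,2,4)] in blast)
    then show False by simp
  qed
  ultimately have "card (subwavelength_germs S) = card I" by (simp add: card_image)
  also have "\<dots> = card Z + 1"
    using finite_Z by (simp add: I_def card_image image_iff)
  finally show ?thesis .
qed

subsection \<open>The eigenvalues\<close>

text \<open>The end condition is \<open>\<mu>\<close> Q(\<open>\<mu>\<close>) = 0 with
  \<open>\<mu>\<close> = v vb l, so 0 is adjoined to the scaled roots of Q.\<close>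

definition evs :: "real set" where "evs = insert 0 ((\<lambda>\<mu>. Re \<mu> / (v * vb)) ` roots)"

lemma evs_nonneg: "l \<in> evs \<Longrightarrow> 0 \<le> l"
  using roots_real_pos v_pos vb_pos by (fastforce simp: evs_def)

lemma finite_evs: "finite evs" by (simp add: evs_def finite_roots)

lemma eigenvalue_evs: "{l. eigenvalue (cap_mat S) l} = evs"
proof -
  have "of_real (v * vb * l) \<in> roots \<longleftrightarrow> l \<in> (\<lambda>\<mu>. Re \<mu> / (v * vb)) ` roots" for l
  proof
    assume "of_real (v * vb * l) \<in> roots"
    then show "l \<in> (\<lambda>\<mu>. Re \<mu> / (v * vb)) ` roots"
      by (rule rev_image_eqI) (use v_pos vb_pos in simp)
  next
    assume "l \<in> (\<lambda>\<mu>. Re \<mu> / (v * vb)) ` roots"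
    then obtain \<mu> where \<mu>: "\<mu> \<in> roots" "l = Re \<mu> / (v * vb)" by blast
    then have "of_real (v * vb * l) = \<mu>"
      using roots_real_pos(1)[OF \<mu>(1)] v_pos vb_pos by simp
    then show "of_real (v * vb * l) \<in> roots" using \<mu> by simp
  qed
  then show ?thesis by (auto simp: eigenvalue_cases evs_def)
qed

lemma card_evs: "card evs = N"
proof -
  have "inj_on (\<lambda>\<mu>. Re \<mu> / (v * vb)) roots"
  proof (rule inj_onI)
    fix \<mu> \<nu> assume "\<mu> \<in> roots" "\<nu> \<in> roots" "Re \<mu> / (v * vb) = Re \<nu> / (v * vb)"
    then show "\<mu> = \<nu>" using roots_real_pos(1)[of \<mu>] roots_real_pos(1)[of \<nu>] v_pos vb_pos by auto
  qed
  then have "card ((\<lambda>\<mu>. Re \<mu> / (v * vb)) ` roots) = N - 1" by (simp add: card_image card_roots)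
  moreover have "0 \<notin> (\<lambda>\<mu>. Re \<mu> / (v * vb)) ` roots"
    using roots_real_pos(2) v_pos vb_pos by fastforce
  ultimately show ?thesis using finite_roots N_pos by (simp add: evs_def)
qed

definition ev :: "nat \<Rightarrow> real" where "ev i = sorted_list_of_set evs ! (i - 1)"

lemma length_evs: "length (sorted_list_of_set evs) = N"
  by (simp add: card_evs)

lemma ev_image: "ev ` {1..N} = evs"
proof -
  have "ev ` {1..N} = (\<lambda>i. sorted_list_of_set evs ! i) ` {..<N}"
    unfolding image_1_upto by (simp add: ev_def)
  also have "\<dots> = set (sorted_list_of_set evs)"
    using nth_image[of N "sorted_list_of_set evs"] length_evs by (simp add: lessThan_atLeast0)
  finally show ?thesis using finite_evs by simp
qed

lemma ev_strict_mono: "strict_mono_on {1..N} ev"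
proof (rule strict_mono_onI)
  fix i j assume "i \<in> {1..N}" "j \<in> {1..N}" "i < j"
  then show "ev i < ev j"
    unfolding ev_def using length_evs
    by (intro sorted_wrt_nth_less[OF strict_sorted_list_of_set]) auto
qed

lemma ev_in: "i \<in> {1..N} \<Longrightarrow> ev i \<in> evs" using ev_image by blast

lemma ev_1: "ev 1 = 0"
proof -
  have "0 \<in> ev ` {1..N}" unfolding ev_image evs_def by blast
  then obtain i where i: "i \<in> {1..N}" "ev i = 0" by (metis imageE)
  have 1: "1 \<in> {1..N}" using N_pos by simp
  show ?thesis
  proof (cases "i = 1")
    case False
    then have "ev 1 < ev i" using i 1 by (intro strict_mono_onD[OF ev_strict_mono]) auto
    then show ?thesis using i evs_nonneg[OF ev_in[OF 1]] by simp
  qed (use i in simp)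
qed

lemma ev_pos: "i \<in> {2..N} \<Longrightarrow> 0 < ev i"
  using strict_mono_onD[OF ev_strict_mono, of 1 i] ev_1 by auto

text \<open>The leading coefficient of the scaled frequency; its square v * vb * lambda is the
  parameter \<open>\<mu>\<close> of the recursion.\<close>

definition zp :: "nat \<Rightarrow> real" where "zp i = v * sqrt (ev i / ratio)"

lemma zp_square: "i \<in> {1..N} \<Longrightarrow> (zp i)\<^sup>2 = v * vb * ev i"
  using evs_nonneg[OF ev_in[of i]] ratio_pos v_pos vb_pos
  by (simp add: zp_def power_mult_distrib speed_ratio_def power2_eq_square field_simps)

lemma zp_1: "zp 1 = 0" using ev_1 by (simp add: zp_def)

lemma zp_pos: "i \<in> {2..N} \<Longrightarrow> 0 < zp i"
  using ev_pos[of i] ratio_pos v_pos by (simp add: zp_def)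

lemma zp_strict_mono: "strict_mono_on {1..N} zp"
  using strict_mono_onD[OF ev_strict_mono] ratio_pos v_pos
  by (intro strict_mono_onI) (simp add: zp_def divide_strict_right_mono)

lemma Z_iff: "z \<in> Z \<longleftrightarrow> (\<exists>i\<in>{1..N}. z\<^sup>2 = of_real ((zp i)\<^sup>2))"
proof
  assume "z \<in> Z"
  then consider "z = 0" | "z\<^sup>2 \<in> roots" by (auto simp: Z_def)
  then show "\<exists>i\<in>{1..N}. z\<^sup>2 = of_real ((zp i)\<^sup>2)"
  proof cases
    case 1
    then show ?thesis using zp_1 N_pos by (intro bexI[of _ 1]) auto
  next
    case 2
    then have "Re (z\<^sup>2) / (v * vb) \<in> ev ` {1..N}" unfolding ev_image evs_def by blast
    then obtain i where i: "i \<in> {1..N}" "ev i = Re (z\<^sup>2) / (v * vb)" by auto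
    then have "(zp i)\<^sup>2 = Re (z\<^sup>2)" using zp_square[OF i(1)] v_pos vb_pos by simp
    then have "z\<^sup>2 = of_real ((zp i)\<^sup>2)" by (simp only: roots_real_pos(1)[OF 2, symmetric])
    then show ?thesis using i(1) by blast
  qed
next
  assume "\<exists>i\<in>{1..N}. z\<^sup>2 = of_real ((zp i)\<^sup>2)"
  then obtain i where i: "i \<in> {1..N}" "z\<^sup>2 = of_real (v * vb * ev i)" by (auto simp: zp_square simp del: of_real_power)
  then have "ev i = 0 \<or> of_real (v * vb * ev i) \<in> roots"
    using ev_in[OF i(1)] eigenvalue_evs eigenvalue_cases by blast
  then show "z \<in> Z" using i by (auto simp: Z_def)
qed

lemma Z_eq: "Z = (\<lambda>i. of_real (zp i)) ` {1..N} \<union> (\<lambda>i. - of_real (zp i)) ` {2..N}"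
proof (intro equalityI subsetI)
  fix z assume "z \<in> Z"
  then obtain i where i: "i \<in> {1..N}" "z\<^sup>2 = (of_real (zp i))\<^sup>2" by (auto simp: Z_iff)
  then have "z = of_real (zp i) \<or> z = - of_real (zp i)" by (simp add: power2_eq_iff)
  moreover have "z = of_real (zp i)" if "i = 1" using i that zp_1 by simp
  ultimately show "z \<in> (\<lambda>i. of_real (zp i)) ` {1..N} \<union> (\<lambda>i. - of_real (zp i)) ` {2..N}"
    using i(1) by (cases "i = 1") auto
qed (auto simp: Z_iff)

text \<open>Each positive eigenvalue contributes two opposite limits, the eigenvalue 0 only
  one.\<close>

lemma card_Z: "card Z = 2 * N - 1"
proof -
  have inj: "inj_on zp {1..N}" by (rule strict_mono_on_imp_inj_on[OF zp_strict_mono])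
  have "inj_on (\<lambda>i. of_real (zp i) :: complex) {1..N}" "inj_on (\<lambda>i. - of_real (zp i) :: complex) {2..N}"
    by (auto intro!: inj_onI intro: inj_onD[OF inj])
  moreover have "(\<lambda>i. of_real (zp i) :: complex) ` {1..N} \<inter> (\<lambda>i. - of_real (zp i)) ` {2..N} = {}"
  proof -
    have "of_real (zp i) \<noteq> (- of_real (zp j) :: complex)" if "i \<in> {1..N}" "j \<in> {2..N}" for i j
    proof -
      have "0 \<le> zp i" using zp_pos[of i] zp_1 that(1) by (cases "i = 1") auto
      then show ?thesis using zp_pos[OF that(2)] by (simp add: complex_eq_iff)
    qed
    then show ?thesis by blast
  qed
  ultimately show ?thesis
    using N_pos unfolding Z_eq by (subst card_Un_disjoint) (auto simp: card_image)
qed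

lemma Z_zp: "i \<in> {1..N} \<Longrightarrow> of_real (zp i) \<in> Z" "i \<in> {2..N} \<Longrightarrow> - of_real (zp i) \<in> Z"
  by (auto simp: Z_eq)

subsection \<open>Expansions\<close>

lemma sqrt_up_ev: "i \<in> {1..N} \<Longrightarrow> of_real v * sqrt_up (of_real (ev i / ratio) * \<delta>) = of_real (zp i) * sqrt_up \<delta>"
  using evs_nonneg[OF ev_in[of i]] ratio_pos by (subst sqrt_up_mult_nonneg) (auto simp: zp_def)

lemma first_frequency:
  defines "\<omega>1 \<equiv> \<lambda>\<delta>. \<delta> * h \<delta>"
  shows "germ_eq \<omega>1 (br (Some 0))" "\<omega>1 analytic_on {0}"
    "(\<lambda>\<delta>. \<omega>1 \<delta> - omega1_coeff S * \<delta>) \<in> O[at 0](\<lambda>\<delta>. \<delta>\<^sup>2)"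
proof -
  have \<rho>2: "0 < \<rho>\<^sup>2" using \<rho>_pos by simp
  have "\<omega>1 \<delta> = br (Some 0) \<delta>" if "norm \<delta> < \<rho>\<^sup>2" for \<delta>
    using g_h[OF sqrt_up_lt[OF that]] sqrt_up_square[of \<delta>]
    by (simp add: \<omega>1_def br_def power2_eq_square mult.assoc[symmetric])
  then show "germ_eq \<omega>1 (br (Some 0))"
    unfolding germ_eq_def using eventually_small[OF \<rho>2] by (auto elim: eventually_mono)
  have "\<omega>1 holomorphic_on ball 0 (\<rho>\<^sup>2)"
    unfolding \<omega>1_def by (intro holomorphic_intros h_holomorphic)
  then show "\<omega>1 analytic_on {0}"
    using \<rho>2 by (intro analytic_on_subset[of _ "ball 0 (\<rho>\<^sup>2)" "{0}"]) (simp_all add: analytic_on_open)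
  have "(\<lambda>\<delta>. \<delta> * (h \<delta> - h 0)) \<in> O[at 0](\<lambda>\<delta>. \<delta> * \<delta>)"
    by (intro landau_o.big.mult holomorphic_bigo_linear[OF h_holomorphic \<rho>2]) auto
  then show "(\<lambda>\<delta>. \<omega>1 \<delta> - omega1_coeff S * \<delta>) \<in> O[at 0](\<lambda>\<delta>. \<delta>\<^sup>2)"
    by (simp add: \<omega>1_def h_0 omega1_coeff_eq algebra_simps power2_eq_square)
qed

lemma br_analytic:
  assumes "z \<in> Z"
  shows "\<exists>f. f analytic_on {0} \<and> germ_eq (br (Some z)) (\<lambda>\<delta>. f (sqrt_up \<delta>))"
proof (intro exI[of _ "\<lambda>e. e * g z e"] conjI)
  have "(\<lambda>e. e * g z e) holomorphic_on ball 0 \<rho>"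
    by (intro holomorphic_intros g_holomorphic assms)
  then show "(\<lambda>e. e * g z e) analytic_on {0}"
    using \<rho>_pos by (intro analytic_on_subset[of _ "ball 0 \<rho>" "{0}"]) (simp_all add: analytic_on_open)
qed (simp add: germ_eq_def br_def)

text \<open>The derivative of a branch depends on its limit only through z^2, so the two branches of
  opposite sign share the damping coefficient. Since w = e g(e), the quadratic remainder of g
  becomes cubic.\<close>

lemma br_expansion:
  assumes i: "i \<in> {2..N}" and z: "z \<in> Z" "z\<^sup>2 = of_real ((zp i)\<^sup>2)"
    and a: "eigenvector (cap_mat S) a (ev i)" and b: "eigenvector (transpose_mat (cap_mat S)) b (ev i)"
  shows "(\<lambda>\<delta>. br (Some z) \<delta> - (z * sqrt_up \<delta> + damping_coeff S a b * \<delta>)) \<in> O[at 0](\<lambda>\<delta>. sqrt_up \<delta> ^ 3)"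
proof -
  have i1: "i \<in> {1..N}" using i by auto
  have z2: "z\<^sup>2 = of_real (v * vb * ev i)" using z(2) zp_square[OF i1] by simp
  have z0: "z \<noteq> 0" using z(2) zp_pos[OF i] by auto
  have D: "(g z has_field_derivative damping_coeff S a b) (at 0)"
    unfolding damping_coeff_eq[OF a b] z2[symmetric]
    by (rule branch_derivative[OF \<rho>_pos g_holomorphic[OF z(1)] g_0[OF z(1)] z(1) z0 Hf_g[OF z(1)]])
  have "(\<lambda>e. e * (g z e - g z 0 - damping_coeff S a b * e)) \<in> O[at 0](\<lambda>e. e * e\<^sup>2)"
    by (intro landau_o.big.mult holomorphic_bigo_quadratic[OF g_holomorphic[OF z(1)] \<rho>_pos D]) auto
  then have "(\<lambda>\<delta>. sqrt_up \<delta> * (g z (sqrt_up \<delta>) - g z 0 - damping_coeff S a b * sqrt_up \<delta>))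
      \<in> O[at 0](\<lambda>\<delta>. sqrt_up \<delta> * (sqrt_up \<delta>)\<^sup>2)"
    by (rule landau_o.big.compose[OF _ filterlim_sqrt_up])
  moreover have "sqrt_up \<delta> * (g z (sqrt_up \<delta>) - g z 0 - damping_coeff S a b * sqrt_up \<delta>)
      = br (Some z) \<delta> - (z * sqrt_up \<delta> + damping_coeff S a b * \<delta>)" for \<delta>
  proof -
    have "sqrt_up \<delta> * (g z (sqrt_up \<delta>) - g z 0 - damping_coeff S a b * sqrt_up \<delta>)
      = br (Some z) \<delta> - (z * sqrt_up \<delta> + damping_coeff S a b * (sqrt_up \<delta>)\<^sup>2)"
      by (simp add: br_def g_0[OF z(1)] algebra_simps power2_eq_square)
    then show ?thesis by (simp only: sqrt_up_square)
  qed
  ultimately show ?thesis by (simp add: power3_eq_cube power2_eq_square mult.assoc)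
qed

text \<open>The asymptotic hypothesis is divided by \<open>sqrt_up \<delta>\<close> to read off the
  limit of the scaled branch, which must be \<open>zp i\<close>. For i = 1 this admits both the
  first eigenfrequency and the trivial one.\<close>

lemma eigenmode_form:
  assumes i: "i \<in> {1..N}" and w: "subwavelength S \<omega>"
    and asym: "(\<lambda>\<delta>. \<omega> \<delta> / of_real v - sqrt_up (of_real (ev i / ratio) * \<delta>)) \<in> O[at 0](\<lambda>\<delta>. \<delta>)"
    and a: "eigenvector (cap_mat S) a (ev i)"
    and M: "- M < left_end S 1" "right_end S N < M"
  obtains K where "\<forall>\<^sub>F \<delta> in at 0. \<forall>u. eigenmode S \<delta> (\<omega> \<delta>) u
     \<longrightarrow> (\<exists>c. c \<noteq> 0 \<and> mode_form S M K (mode_val a) (mode_slope a) \<delta> (\<lambda>x. c * u x))"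
proof -
  obtain b where b: "b \<in> I" "germ_eq \<omega> (br b)" by (rule subwavelength_imp_br[OF w])
  have lim: "((\<lambda>\<delta>. scaled b (sqrt_up \<delta>)) \<longlongrightarrow> scaled b 0) (at 0)"
    by (rule filterlim_compose[OF scaled_tendsto[OF b(1)] filterlim_sqrt_up])
  have "(\<lambda>\<delta>. (\<omega> \<delta> / of_real v - sqrt_up (of_real (ev i / ratio) * \<delta>)) * (1 / sqrt_up \<delta>))
      \<in> O[at 0](\<lambda>\<delta>. \<delta> * (1 / sqrt_up \<delta>))"
    by (intro landau_o.big.mult asym) auto
  moreover have "\<delta> * (1 / sqrt_up \<delta>) = sqrt_up \<delta>" for \<delta>
    using sqrt_up_square[of \<delta>] by (cases "\<delta> = 0") (simp_all add: field_simps power2_eq_square)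
  ultimately have O: "(\<lambda>\<delta>. (\<omega> \<delta> / of_real v - sqrt_up (of_real (ev i / ratio) * \<delta>)) / sqrt_up \<delta>) \<in> O[at 0](sqrt_up)"
    by (simp only: times_divide_eq_right mult_1_right)
  obtain C where C: "\<forall>\<^sub>F \<delta> in at 0.
      norm ((\<omega> \<delta> / of_real v - sqrt_up (of_real (ev i / ratio) * \<delta>)) / sqrt_up \<delta>) \<le> C * norm (sqrt_up \<delta>)"
    by (rule bounded_quotient_nhds[OF O])
  have "((\<lambda>\<delta>. C * norm (sqrt_up \<delta>)) \<longlongrightarrow> C * norm (0::complex)) (at 0)"
    using filterlim_sqrt_up by (intro tendsto_intros) (simp add: filterlim_at)
  then have "((\<lambda>\<delta>. C * norm (sqrt_up \<delta>)) \<longlongrightarrow> 0) (at 0)" by simp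
  with C have lim1: "((\<lambda>\<delta>. (\<omega> \<delta> / of_real v - sqrt_up (of_real (ev i / ratio) * \<delta>)) / sqrt_up \<delta>) \<longlongrightarrow> 0) (at 0)"
    by (rule Lim_null_comparison)
  have nz: "\<forall>\<^sub>F \<delta> in at (0::complex). \<delta> \<noteq> 0 \<and> norm \<delta> < 1"
    by (rule eventually_small) simp
  have "\<forall>\<^sub>F \<delta> in at 0. (\<omega> \<delta> / of_real v - sqrt_up (of_real (ev i / ratio) * \<delta>)) / sqrt_up \<delta>
      = scaled b (sqrt_up \<delta>) / of_real v - of_real (zp i) / of_real v"
    using b(2) nz unfolding germ_eq_def
  proof eventually_elim
    case (elim \<delta>)
    then show ?case
      using sqrt_up_ev[OF i, of \<delta>] v_pos by (simp add: br_def field_simps)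
  qed
  with lim1 have "((\<lambda>\<delta>. scaled b (sqrt_up \<delta>) / of_real v - of_real (zp i) / of_real v) \<longlongrightarrow> 0) (at 0)"
    by (rule Lim_transform_eventually)
  moreover have "((\<lambda>\<delta>. scaled b (sqrt_up \<delta>) / of_real v - of_real (zp i) / of_real v)
      \<longlongrightarrow> scaled b 0 / of_real v - of_real (zp i) / of_real v) (at 0)"
    using v_pos by (intro tendsto_intros lim) auto
  ultimately have "scaled b 0 / of_real v - of_real (zp i) / of_real v = 0"
    using tendsto_unique[OF trivial_limit_at] LIM_unique by blast
  then have s0: "(scaled b 0)\<^sup>2 = of_real (v * vb * ev i)"
    using v_pos zp_square[OF i] by (simp flip: of_real_power)
  obtain K where K: "\<forall>\<^sub>F e in at 0. \<forall>u. eigenmode S (e\<^sup>2) (e * scaled b e) u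
     \<longrightarrow> (\<exists>c. c \<noteq> 0 \<and> mode_form S M K (mode_val a) (mode_slope a) (e\<^sup>2) (\<lambda>x. c * u x))"
    by (rule mode_form_along_curve[OF \<rho>_pos scaled_holomorphic[OF b(1)] s0 a M])
  have "\<forall>\<^sub>F \<delta> in at 0. \<forall>u. eigenmode S ((sqrt_up \<delta>)\<^sup>2) (sqrt_up \<delta> * scaled b (sqrt_up \<delta>)) u
     \<longrightarrow> (\<exists>c. c \<noteq> 0 \<and> mode_form S M K (mode_val a) (mode_slope a) ((sqrt_up \<delta>)\<^sup>2) (\<lambda>x. c * u x))"
    by (rule eventually_compose_filterlim[OF K filterlim_sqrt_up])
  with b(2) have "\<forall>\<^sub>F \<delta> in at 0. \<forall>u. eigenmode S \<delta> (\<omega> \<delta>) u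
     \<longrightarrow> (\<exists>c. c \<noteq> 0 \<and> mode_form S M K (mode_val a) (mode_slope a) \<delta> (\<lambda>x. c * u x))"
    unfolding germ_eq_def by eventually_elim (simp add: sqrt_up_square br_def)
  then show thesis by (rule that)
qed

end

theorem theorem5p2:
  fixes S :: resonator_chain and N :: nat and v r :: real
  assumes "chain S"
    and "N = num_res S" and "v = speed_out S" and "r = speed_ratio S"
  shows "card (subwavelength_germs S) = 2 * N
   \<and> (\<exists>(ev :: nat \<Rightarrow> real) (\<omega>1 :: complex \<Rightarrow> complex)
         (\<omega>p :: nat \<Rightarrow> complex \<Rightarrow> complex) (\<omega>m :: nat \<Rightarrow> complex \<Rightarrow> complex).
        ev 1 = 0 \<and> strict_mono_on {1..N} ev \<and> {l. eigenvalue (cap_mat S) l} = ev ` {1..N}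
      \<comment> \<open>these are the subwavelength resonant frequencies\<close>
      \<and> subwavelength S (\<lambda>\<delta>. 0) \<and> subwavelength S \<omega>1
      \<and> (\<forall>i\<in>{2..N}. subwavelength S (\<omega>p i) \<and> subwavelength S (\<omega>m i))
      \<and> (\<forall>\<eta>. subwavelength S \<eta> \<longrightarrow>
            germ_eq \<eta> (\<lambda>\<delta>. 0) \<or> germ_eq \<eta> \<omega>1
          \<or> (\<exists>i\<in>{2..N}. germ_eq \<eta> (\<omega>p i) \<or> germ_eq \<eta> (\<omega>m i)))
      \<comment> \<open>the first eigenfrequency\<close>
      \<and> \<omega>1 analytic_on {0}
      \<and> (\<lambda>\<delta>. \<omega>1 \<delta> - omega1_coeff S * \<delta>) \<in> O[at 0](\<lambda>\<delta>. \<delta>\<^sup>2)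
      \<comment> \<open>the remaining frequencies\<close>
      \<and> (\<forall>i\<in>{2..N}.
            (\<exists>g. g analytic_on {0} \<and> germ_eq (\<omega>p i) (\<lambda>\<delta>. g (sqrt_up \<delta>)))
          \<and> (\<exists>g. g analytic_on {0} \<and> germ_eq (\<omega>m i) (\<lambda>\<delta>. g (sqrt_up \<delta>)))
          \<and> (\<forall>a b. eigenvector (cap_mat S) a (ev i)
                \<longrightarrow> eigenvector (transpose_mat (cap_mat S)) b (ev i) \<longrightarrow>
                (\<lambda>\<delta>. \<omega>p i \<delta> - (of_real v * sqrt_up (of_real (ev i / r) * \<delta>)
                                 + damping_coeff S a b * \<delta>)) \<in> O[at 0](\<lambda>\<delta>. sqrt_up \<delta> ^ 3)
              \<and> (\<lambda>\<delta>. \<omega>m i \<delta> - (- of_real v * sqrt_up (of_real (ev i / r) * \<delta>)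
                                 + damping_coeff S a b * \<delta>)) \<in> O[at 0](\<lambda>\<delta>. sqrt_up \<delta> ^ 3)))
      \<comment> \<open>the eigenmodes, after normalization\<close>
      \<and> (\<forall>i\<in>{1..N}. \<forall>\<omega> a M. subwavelength S \<omega>
            \<longrightarrow> (\<lambda>\<delta>. \<omega> \<delta> / of_real v - sqrt_up (of_real (ev i / r) * \<delta>)) \<in> O[at 0](\<lambda>\<delta>. \<delta>)
            \<longrightarrow> eigenvector (cap_mat S) a (ev i)
            \<longrightarrow> - M < left_end S 1 \<longrightarrow> right_end S N < M \<longrightarrow>
            (\<exists>(A :: nat \<Rightarrow> complex) (B :: nat \<Rightarrow> complex) K.
                (\<forall>j\<in>{1..N}. A j = of_real (vec_index a (j - 1)))
              \<and> (\<forall>j\<in>{1..<N}. B j = (A (j + 1) - A j) / of_real (res_gap S j))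
              \<and> (\<forall>\<^sub>F \<delta> in at 0. \<forall>u. eigenmode S \<delta> (\<omega> \<delta>) u
                    \<longrightarrow> (\<exists>c. c \<noteq> 0 \<and> mode_form S M K A B \<delta> (\<lambda>x. c * u x))))))"
proof -
  interpret resonators S by unfold_locales (rule assms(1))
  obtain g h \<rho> \<eta> where "branch_data S g h \<rho> \<eta>" by (rule branches)
  then interpret branch_data S g h \<rho> \<eta> .
  note params = assms(2-4)
  define \<omega>1 where "\<omega>1 \<delta> = \<delta> * h \<delta>" for \<delta>
  define \<omega>p where "\<omega>p i = br (Some (of_real (zp i)))" for i
  define \<omega>m where "\<omega>m i = br (Some (- of_real (zp i)))" for i
  have \<omega>1: "germ_eq \<omega>1 (br (Some 0))" "\<omega>1 analytic_on {0}"
    "(\<lambda>\<delta>. \<omega>1 \<delta> - omega1_coeff S * \<delta>) \<in> O[at 0](\<lambda>\<delta>. \<delta>\<^sup>2)"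
    using first_frequency unfolding \<omega>1_def[abs_def] by auto
  have 0: "0 \<in> Z" by (simp add: Z_def)
  have refl: "germ_eq f f" for f by (simp add: germ_eq_def)
  have sub1: "subwavelength S (\<lambda>\<delta>. 0)"
    by (rule subwavelength_br[of None]) (simp_all add: I_def germ_eq_def br_def)
  have sub2: "subwavelength S \<omega>1"
    by (rule subwavelength_br[OF _ \<omega>1(1)]) (simp add: I_def 0)
  have sub3: "subwavelength S (\<omega>p i)" "subwavelength S (\<omega>m i)" if "i \<in> {2..N}" for i
    unfolding \<omega>p_def \<omega>m_def using that Z_zp[of i] params(1)
    by (auto intro!: subwavelength_br[OF _ refl] simp: I_def)
  have all: "germ_eq \<eta> (\<lambda>\<delta>. 0) \<or> germ_eq \<eta> \<omega>1 \<or> (\<exists>i\<in>{2..N}. germ_eq \<eta> (\<omega>p i) \<or> germ_eq \<eta> (\<omega>m i))"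
    if sub: "subwavelength S \<eta>" for \<eta>
  proof -
    obtain b where b: "b \<in> I" "germ_eq \<eta> (br b)" by (rule subwavelength_imp_br[OF sub])
    show ?thesis
    proof (cases b)
      case None
      then show ?thesis using b by (simp add: br_def[abs_def])
    next
      case (Some z)
      then have "z \<in> Z" using b by (auto simp: I_def)
      then consider i where "i \<in> {1..N}" "z = of_real (zp i)" | i where "i \<in> {2..N}" "z = - of_real (zp i)"
        unfolding Z_eq params(1) by blast
      then show ?thesis
      proof cases
        case 1
        show ?thesis
        proof (cases "i = 1")
          \<comment> \<open>Since \<open>zp 1\<close> is 0, the plus branch of index 1 is the first
            eigenfrequency.\<close>
          case True
          then have "germ_eq \<eta> (br (Some 0))" using b 1 Some zp_1 by simp
          with \<omega>1(1) have "germ_eq \<eta> \<omega>1"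
            unfolding germ_eq_def by eventually_elim simp
          then show ?thesis by blast
        next
          case False
          then have "i \<in> {2..N}" using 1 by auto
          then show ?thesis using b 1 Some by (auto simp: \<omega>p_def)
        qed
      next
        case 2
        then show ?thesis using b Some by (auto simp: \<omega>m_def)
      qed
    qed
  qed
  have exp: "(\<lambda>\<delta>. \<omega>p i \<delta> - (of_real v * sqrt_up (of_real (ev i / r) * \<delta>) + damping_coeff S a b * \<delta>)) \<in> O[at 0](\<lambda>\<delta>. sqrt_up \<delta> ^ 3)"
    "(\<lambda>\<delta>. \<omega>m i \<delta> - (- of_real v * sqrt_up (of_real (ev i / r) * \<delta>) + damping_coeff S a b * \<delta>)) \<in> O[at 0](\<lambda>\<delta>. sqrt_up \<delta> ^ 3)"
    if i: "i \<in> {2..N}" and ab: "eigenvector (cap_mat S) a (ev i)" "eigenvector (transpose_mat (cap_mat S)) b (ev i)" for i a b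
  proof -
    have i2: "i \<in> {2..num_res S}" "i \<in> {1..num_res S}" using i params by auto
    have s: "of_real v * sqrt_up (of_real (ev i / r) * \<delta>) = of_real (zp i) * sqrt_up \<delta>" for \<delta>
      using sqrt_up_ev[OF i2(2)] params by simp
    have s': "- of_real v * sqrt_up (of_real (ev i / r) * \<delta>) = - of_real (zp i) * sqrt_up \<delta>" for \<delta>
      using s[of \<delta>] by simp
    show "(\<lambda>\<delta>. \<omega>p i \<delta> - (of_real v * sqrt_up (of_real (ev i / r) * \<delta>) + damping_coeff S a b * \<delta>)) \<in> O[at 0](\<lambda>\<delta>. sqrt_up \<delta> ^ 3)"
      unfolding s \<omega>p_def by (rule br_expansion[OF i2(1) Z_zp(1)[OF i2(2)] _ ab]) simp
    show "(\<lambda>\<delta>. \<omega>m i \<delta> - (- of_real v * sqrt_up (of_real (ev i / r) * \<delta>) + damping_coeff S a b * \<delta>)) \<in> O[at 0](\<lambda>\<delta>. sqrt_up \<delta> ^ 3)"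
      unfolding s' \<omega>m_def by (rule br_expansion[OF i2(1) Z_zp(2)[OF i2(1)] _ ab]) simp
  qed
  have an: "\<exists>g. g analytic_on {0} \<and> germ_eq (\<omega>p i) (\<lambda>\<delta>. g (sqrt_up \<delta>))"
    "\<exists>g. g analytic_on {0} \<and> germ_eq (\<omega>m i) (\<lambda>\<delta>. g (sqrt_up \<delta>))" if "i \<in> {2..N}" for i
    unfolding \<omega>p_def \<omega>m_def using that params Z_zp[of i] by (intro br_analytic; auto)+
  have modes: "\<exists>(A :: nat \<Rightarrow> complex) (B :: nat \<Rightarrow> complex) K.
                (\<forall>j\<in>{1..N}. A j = of_real (vec_index a (j - 1)))
              \<and> (\<forall>j\<in>{1..<N}. B j = (A (j + 1) - A j) / of_real (res_gap S j))
              \<and> (\<forall>\<^sub>F \<delta> in at 0. \<forall>u. eigenmode S \<delta> (\<omega> \<delta>) u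
                    \<longrightarrow> (\<exists>c. c \<noteq> 0 \<and> mode_form S M K A B \<delta> (\<lambda>x. c * u x)))"
    if hyps: "i \<in> {1..N}" "subwavelength S \<omega>"
      "(\<lambda>\<delta>. \<omega> \<delta> / of_real v - sqrt_up (of_real (ev i / r) * \<delta>)) \<in> O[at 0](\<lambda>\<delta>. \<delta>)"
      "eigenvector (cap_mat S) a (ev i)" "- M < left_end S 1" "right_end S N < M" for i \<omega> a M
  proof -
    obtain K where K: "\<forall>\<^sub>F \<delta> in at 0. \<forall>u. eigenmode S \<delta> (\<omega> \<delta>) u
     \<longrightarrow> (\<exists>c. c \<noteq> 0 \<and> mode_form S M K (mode_val a) (mode_slope a) \<delta> (\<lambda>x. c * u x))"
      by (rule eigenmode_form[OF hyps[unfolded params]])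
    show ?thesis
      by (rule exI[of _ "mode_val a"], rule exI[of _ "mode_slope a"], rule exI[of _ K])
        (use K params in \<open>auto simp: mode_val_def mode_slope_def\<close>)
  qed
  have card: "card (subwavelength_germs S) = 2 * N"
    using card_germs card_Z N_pos params by simp
  show ?thesis
  proof (rule conjI[OF card], rule exI[of _ ev], rule exI[of _ \<omega>1], rule exI[of _ \<omega>p],
      rule exI[of _ \<omega>m], intro conjI)
    show "ev 1 = 0" by (rule ev_1)
    show "strict_mono_on {1..N} ev" using ev_strict_mono params by simp
    show "{l. eigenvalue (cap_mat S) l} = ev ` {1..N}" using eigenvalue_evs ev_image params by simp
    show "\<forall>\<eta>. subwavelength S \<eta> \<longrightarrow> germ_eq \<eta> (\<lambda>\<delta>. 0) \<or> germ_eq \<eta> \<omega>1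
        \<or> (\<exists>i\<in>{2..N}. germ_eq \<eta> (\<omega>p i) \<or> germ_eq \<eta> (\<omega>m i))"
      using all by blast
  qed (use sub1 sub2 sub3 \<omega>1 exp an modes in \<open>blast+\<close>)
qed

end
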